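(* Let $\gamma$ be a simple closed, smooth, strictly convex curve on the unit sphere $\mathbf{S}^2$ lying entirely in an open hemisphere, with length $P$, enclosed area $A$ (area of the convex region inside the hemisphere bounded by $\gamma$), and geodesic curvature $k(x)>0$ with minimum $k_{\min}>0$. For the billiard inside $\gamma$, let $\delta$ be the proportion of the phase space not occupied by $m$-orbits. Then $$\delta \geq \frac{\pi}{2\arctan(\frac{1}{k_{\min}})}\cdot \frac{P^2+A^2-4\pi A}{P\left(2\pi+\sqrt{P^2+(2\pi-A)^2}\right)}.$$
   Context: Billiard setup on the surface: $x$ is an arclength parameter on $\gamma$ ($x\in\mathbf{R}/P\mathbf{Z}$); the billiard trajectories inside $\gamma$ are geodesic segments of the surface. The phase space is $\Omega=\{(x,\varphi): x\in\mathbf{R}/P\mathbf{Z},\ \varphi\in(0,\pi)\}$, $\varphi$ the angle between the tangent to $\gamma$ at $\gamma(x)$ and a geodesic chord leaving $\gamma(x)$ into the region bounded by $\gamma$. The billiard map $T(x,\varphi)=(y,\psi)$ sends it to the next hit point and reflected angle (angle of reflection equals angle of incidence). $T$ preserves $d\mu=\sin\varphi\,dx\,d\varphi$ and $\mu(\Omega)=2P$. Let $L(x,y)$ be the (geodesic) distance between $\gamma(x)$ and $\gamma(y)$. A billiard configuration $\{x_n\}_{n\in\mathbf{Z}}$ (consecutive bounce points of a trajectory) is an $m$-configuration if for all $M<N$ the second variation of $\sum_{n=M}^{N-1}L(x_n,x_{n+1})$ with respect to $x_{M+1},\dots,x_{N-1}$ (endpoints fixed) is negative definite; the corresponding orbits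 of $T$ are $m$-orbits. $\mathcal{M}\subseteq\Omega$ is the set of points on $m$-orbits, $\Delta=\Omega\setminus\mathcal{M}$, $\delta=\mu(\Delta)/\mu(\Omega)$. *)

theory Defs
  imports "HOL-Analysis.Analysis"
begin

text \<open>Curves on the unit sphere in real^3, parametrised by a real parameter,
  P-periodic.  Derivatives are vector derivatives.\<close>

definition tang :: "(real \<Rightarrow> real^3) \<Rightarrow> real \<Rightarrow> real^3" where
  "tang \<gamma> x = vector_derivative \<gamma> (at x)"

definition smooth_curve :: "(real \<Rightarrow> real^3) \<Rightarrow> bool" where
  "smooth_curve \<gamma> \<longleftrightarrow> (\<exists>D :: nat \<Rightarrow> real \<Rightarrow> real^3. D 0 = \<gamma> \<and>
      (\<forall>n x. (D n has_vector_derivative D (Suc n) x) (at x)))"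

text \<open>Signed geodesic curvature with respect to the normal gamma x tangent
  (for a unit-speed spherical curve).\<close>
definition geod_curv :: "(real \<Rightarrow> real^3) \<Rightarrow> real \<Rightarrow> real" where
  "geod_curv \<gamma> x = cross3 (\<gamma> x) (tang \<gamma> x) \<bullet> vector_derivative (tang \<gamma>) (at x)"

definition inner_region :: "(real \<Rightarrow> real^3) \<Rightarrow> real^3 \<Rightarrow> (real^3) set" where
  "inner_region \<gamma> e = \<Union>{C \<in> components (sphere 0 1 - range \<gamma>). C \<subseteq> {v. v \<bullet> e > 0}}"

text \<open>Surface (area) measure on the unit sphere: area of B is three times the
  volume of the cone over B (total area 4 pi).\<close>
definition sph_area :: "(real^3) set \<Rightarrow> real" where
  "sph_area B = 3 * measure lebesgue {t *\<^sub>R v | t v. 0 \<le> t \<and> t \<le> 1 \<and> v \<in> B}"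

definition sph_strictly_convex :: "(real^3) set \<Rightarrow> bool" where
  "sph_strictly_convex D \<longleftrightarrow> (\<forall>p\<in>closure D. \<forall>q\<in>closure D. p \<noteq> q \<longrightarrow>
      (\<forall>s. 0 < s \<and> s < 1 \<longrightarrow>
          (1 / norm ((1 - s) *\<^sub>R p + s *\<^sub>R q)) *\<^sub>R ((1 - s) *\<^sub>R p + s *\<^sub>R q) \<in> D))"

definition Lgeo :: "(real \<Rightarrow> real^3) \<Rightarrow> real \<Rightarrow> real \<Rightarrow> real" where
  "Lgeo \<gamma> x y = arccos (\<gamma> x \<bullet> \<gamma> y)"

text \<open>Billiard map in coordinates (x, phi), x in [0,P), phi in (0,pi).
  Inward normal at gamma x is cross3 (gamma x) (tang gamma x) (orientation with positive
  geodesic curvature).  The geodesic leaving gamma x at angle phi is c(t); t1 is the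
  first positive time it hits the curve again, y the parameter of that point,
  and psi the angle between tang gamma y and the incoming (= after reflection, outgoing)
  direction, by the reflection law.\<close>
definition billiard_map :: "(real \<Rightarrow> real^3) \<Rightarrow> real \<Rightarrow> real \<times> real \<Rightarrow> real \<times> real" where
  "billiard_map \<gamma> P z = (let x = fst z; \<phi> = snd z; p = \<gamma> x; \<tau> = tang \<gamma> x;
      u = cos \<phi> *\<^sub>R \<tau> + sin \<phi> *\<^sub>R cross3 p \<tau>;
      c = (\<lambda>t. cos t *\<^sub>R p + sin t *\<^sub>R u);
      t1 = Inf {t. 0 < t \<and> c t \<in> \<gamma> ` {0..<P}};
      y = (THE y. y \<in> {0..<P} \<and> \<gamma> y = c t1);
      v = (- sin t1) *\<^sub>R p + cos t1 *\<^sub>R u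
    in (y, arccos (v \<bullet> tang \<gamma> y)))"

definition phase_space :: "real \<Rightarrow> (real \<times> real) set" where
  "phase_space P = {0..<P} \<times> {0<..<pi}"

text \<open>Second variation of sum_{n=M}^{N-1} L(x_n, x_{n+1}) in direction xi
  (xi vanishes outside M+1..N-1, i.e. endpoints fixed).\<close>
definition second_var :: "(real \<Rightarrow> real^3) \<Rightarrow> (int \<Rightarrow> real) \<Rightarrow> int \<Rightarrow> int \<Rightarrow> (int \<Rightarrow> real) \<Rightarrow> real" where
  "second_var \<gamma> xs M N \<xi> =
     deriv (deriv (\<lambda>t. \<Sum>n\<in>{M..<N}. Lgeo \<gamma> (xs n + t * \<xi> n) (xs (n+1) + t * \<xi> (n+1)))) 0"

definition m_config :: "(real \<Rightarrow> real^3) \<Rightarrow> (int \<Rightarrow> real) \<Rightarrow> bool" where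
  "m_config \<gamma> xs \<longleftrightarrow> (\<forall>M N. M < N \<longrightarrow>
     (\<forall>\<xi>. (\<forall>n. (n \<le> M \<or> N \<le> n) \<longrightarrow> \<xi> n = 0) \<and> (\<exists>n. \<xi> n \<noteq> 0) \<longrightarrow>
        second_var \<gamma> xs M N \<xi> < 0))"

definition m_set :: "(real \<Rightarrow> real^3) \<Rightarrow> real \<Rightarrow> (real \<times> real) set" where
  "m_set \<gamma> P = {z \<in> phase_space P. \<exists>zs :: int \<Rightarrow> real \<times> real. zs 0 = z \<and>
      (\<forall>n. zs n \<in> phase_space P \<and> billiard_map \<gamma> P (zs n) = zs (n + 1)) \<and>
      m_config \<gamma> (fst \<circ> zs)}"

text \<open>Invariant measure sin phi dx dphi (on the Lebesgue completion).\<close>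
definition billiard_measure :: "(real \<times> real) measure" where
  "billiard_measure = density lebesgue (\<lambda>z. ennreal (sin (snd z)))"

definition delta_nonm :: "(real \<Rightarrow> real^3) \<Rightarrow> real \<Rightarrow> real" where
  "delta_nonm \<gamma> P = measure billiard_measure (phase_space P - m_set \<gamma> P)
                     / measure billiard_measure (phase_space P)"

end

(* On an m-orbit the Riccati recursion attached to the second variation has positive solutions.
   Written in angles it says that each chord splits as L = alpha + beta, where the pieces meeting at
   a bounce point satisfy the mirror equation cot alpha + cot beta = 2 k / sin phi; hence
   alpha + beta >= 2 arctan (sin phi / k) there.  Averaging over the set M of m-orbits, which is
   invariant, bounds the integral of L over M below by that of 2 arctan (sin phi / k).
   On the other hand the integral of L over the whole phase space is at most 2 pi A (Santalo).
   The fibre integral of 2 arctan (sin phi / k) is 2 pi (sqrt (1 + k^2) - k), whose integral over the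
   curve is at least 2 pi (sqrt (P^2 + K^2) - K) by Minkowski, where K = 2 pi - A is the total
   curvature (Gauss-Bonnet).  What remains is paid for by the complement of M, where
   2 arctan (sin phi / k) <= 2 arctan (1 / k_min).

   A point x of the curve and a second point y replace the pair (x, phi): since
   d phi / d y = sin psi / sin L, all changes of variables are one-dimensional, and the symmetry of
   the density in x and y is the invariance of the measure. *)
theory Submission
  imports Defs "HOL-Complex_Analysis.Complex_Analysis" "HOL-Real_Asymp.Real_Asymp"
begin

unbundle no fps_syntax

section \<open>Integration lemmas\<close>

text \<open>Negative definiteness is a condition on every finite window of an orbit. It amounts to
  positivity of countably many functions \<open>alpha j\<close> along the orbit, where
  \<open>alpha j\<close> solves the Riccati recursion with horizon \<open>j\<close>. This makes the
  set of m-orbits Borel and splits each chord, with horizons \<open>j + 1\<close> and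
  \<open>j\<close> at its two ends. Convexity is assumed of the region, whereas every formula about
  chords needs the pointwise inequality \<open>\<gamma> y \<bullet> nu x > 0\<close>. The bridge is
  that the closed region contains the curve, which comes from the Jordan curve theorem after
  projecting the sphere to the plane. The same projection reduces the angle under which the curve is
  seen from an interior point to the winding number of a simple loop, bounded by 1 in modulus
  whatever the orientation. Area and chord length are read off from one polar integration formula
  about a boundary point. With s = sqrt (P^2 + K^2) the estimates combine to 2 pi (s - 2 pi) <= 2
  arctan (1 / k_min) mu(Delta), and (s - 2 pi) (s + 2 pi) is the numerator P^2 + A^2 - 4 pi
  A.\<close>

lemma SUP_nn_integral_indicator_incseq:
  fixes f :: "'a \<Rightarrow> ennreal"
  assumes "f \<in> borel_measurable M" "range A \<subseteq> sets M" "incseq A"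
  shows "(SUP n. \<integral>\<^sup>+x. f x * indicator (A n) x \<partial>M) = (\<integral>\<^sup>+x. f x * indicator (\<Union>n. A n) x \<partial>M)"
proof -
  have "(SUP n. emeasure (density M f) (A n)) = emeasure (density M f) (\<Union>n. A n)"
    using assms by (intro SUP_emeasure_incseq) auto
  then show ?thesis
    using assms by (simp add: emeasure_density sets.countable_UN range_subsetD cong: SUP_cong)
qed

text \<open>\<open>g\<close> may be unbounded and \<open>g'\<close> singular at the ends: one use is
  with minus the cotangent of an angle, which sweeps the whole line. The rule on compact intervals
  is applied to an exhaustion, and monotone convergence does the rest.\<close>

lemma nn_integral_substitution_open_interval:
  fixes f :: "real \<Rightarrow> ennreal" and g g' :: "real \<Rightarrow> real"
  assumes f [measurable]: "f \<in> borel_measurable borel"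
    and der: "\<And>y. a < y \<Longrightarrow> y < b \<Longrightarrow> (g has_real_derivative g' y) (at y)"
    and cont: "continuous_on {a<..<b} g'"
    and pos: "\<And>y. a < y \<Longrightarrow> y < b \<Longrightarrow> 0 < g' y"
    and ab: "a < b"
  shows "(\<integral>\<^sup>+z. f z * indicator (g ` {a<..<b}) z \<partial>lborel)
       = (\<integral>\<^sup>+y. f (g y) * g' y * indicator {a<..<b} y \<partial>lborel)"
proof -
  \<comment> \<open>The offset 3 makes \<open>u n < v n\<close> hold from \<open>n = 0\<close>
    on.\<close>
  define u where "u = (\<lambda>n::nat. a + (b - a) / (n + 3))"
  define v where "v = (\<lambda>n::nat. b - (b - a) / (n + 3))"
  have uv: "a < u n" "u n < v n" "v n < b" for n
  proof -
    have "(b - a) / (real n + 3) \<le> (b - a) / 3"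
      using ab by (intro divide_left_mono) auto
    also have "\<dots> < (b - a) / 2" using ab by simp
    finally show "u n < v n" unfolding u_def v_def by argo
  qed (use ab in \<open>auto simp: u_def v_def\<close>)
  have mono: "(b - a) / (real m + 3) \<le> (b - a) / (real n + 3)" if "n \<le> m" for n m
    using that ab by (intro divide_left_mono) auto
  have inc: "incseq (\<lambda>n. {u n..v n})"
    unfolding incseq_def u_def v_def using mono by fastforce
  have tend: "(\<lambda>n. (b - a) / (real n + 3)) \<longlonglongrightarrow> 0"
    by real_asymp
  have Un: "(\<Union>n. {u n..v n}) = {a<..<b}"
  proof (intro equalityI subsetI)
    fix y assume y: "y \<in> {a<..<b}"
    have "\<forall>\<^sub>F n in sequentially. (b - a) / (real n + 3) < min (y - a) (b - y)"
      using y by (intro order_tendstoD(2)[OF tend]) auto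
    then obtain n where "(b - a) / (real n + 3) < min (y - a) (b - y)"
      using eventually_happens by fastforce
    then have "y \<in> {u n..v n}" by (auto simp: u_def v_def)
    then show "y \<in> (\<Union>n. {u n..v n})" by blast
  next
    fix y assume "y \<in> (\<Union>n. {u n..v n})"
    then obtain n where "u n \<le> y" "y \<le> v n" by auto
    then show "y \<in> {a<..<b}" using uv[of n] by simp
  qed
  have smono: "g x < g y" if "a < x" "x < y" "y < b" for x y
    using that der pos by (intro DERIV_pos_imp_increasing[of x y g]) (meson order_le_less_trans order_less_le_trans)+
  have contg: "continuous_on {a<..<b} g"
    using der by (intro DERIV_continuous_on) (auto intro: has_field_derivative_at_within)
  have img: "g ` {u n..v n} = {g (u n)..g (v n)}" for n
  proof (rule subset_antisym)
    show "g ` {u n..v n} \<subseteq> {g (u n)..g (v n)}"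
    proof (rule image_subsetI)
      fix x assume x: "x \<in> {u n..v n}"
      then have "g (u n) \<le> g x" "g x \<le> g (v n)"
        using smono[of "u n" x] smono[of x "v n"] uv[of n] by fastforce+
      then show "g x \<in> {g (u n)..g (v n)}" by simp
    qed
    show "{g (u n)..g (v n)} \<subseteq> g ` {u n..v n}"
    proof
      fix z assume "z \<in> {g (u n)..g (v n)}"
      moreover have "{u n..v n} \<subseteq> {a<..<b}" using uv[of n] by auto
      ultimately obtain x where "u n \<le> x" "x \<le> v n" "g x = z"
        using uv[of n] IVT'[of g "u n" z "v n"] continuous_on_subset[OF contg, of "{u n..v n}"] by auto
      then show "z \<in> g ` {u n..v n}" by auto
    qed
  qed
  \<comment> \<open>Only the behaviour of \<open>g\<close> and \<open>g'\<close> inside the interval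
    is known; their extensions by 0 are Borel on the whole line, as the limit of integrals
    requires.\<close>
  define h where "h = (\<lambda>y. if y \<in> {a<..<b} then g y else 0)"
  define h' where "h' = (\<lambda>y. if y \<in> {a<..<b} then g' y else 0)"
  have [measurable]: "h \<in> borel_measurable borel" "h' \<in> borel_measurable borel"
    unfolding h_def h'_def
    by (intro borel_measurable_continuous_on_if contg cont continuous_on_const borel_open open_greaterThanLessThan)+
  have "(\<integral>\<^sup>+z. f z * indicator (g ` {a<..<b}) z \<partial>lborel)
      = (\<integral>\<^sup>+z. f z * indicator (\<Union>n. {g (u n)..g (v n)}) z \<partial>lborel)"
    unfolding Un[symmetric] image_UN img ..
  also have "\<dots> = (SUP n. \<integral>\<^sup>+z. f z * indicator {g (u n)..g (v n)} z \<partial>lborel)"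
  proof (rule SUP_nn_integral_indicator_incseq[symmetric])
    show "incseq (\<lambda>n. {g (u n)..g (v n)})"
      using inc unfolding img[symmetric] incseq_def by (meson image_mono)
  qed auto
  also have "\<dots> = (SUP n. \<integral>\<^sup>+y. f (h y) * h' y * indicator {u n..v n} y \<partial>lborel)"
  proof (rule SUP_cong[OF refl])
    fix n
    have sub: "{u n..v n} \<subseteq> {a<..<b}" using uv[of n] by auto
    have "(\<integral>\<^sup>+z. f z * indicator {g (u n)..g (v n)} z \<partial>lborel)
        = (\<integral>\<^sup>+y. f (g y) * g' y * indicator {u n..v n} y \<partial>lborel)"
      using sub uv[of n]
      by (intro nn_integral_substitution_aux der continuous_on_subset[OF cont sub] less_imp_le[OF pos]) auto
    also have "\<dots> = (\<integral>\<^sup>+y. f (h y) * h' y * indicator {u n..v n} y \<partial>lborel)"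
      using sub by (intro nn_integral_cong) (auto simp: h_def h'_def split: split_indicator)
    finally show "(\<integral>\<^sup>+z. f z * indicator {g (u n)..g (v n)} z \<partial>lborel) =
      (\<integral>\<^sup>+y. f (h y) * h' y * indicator {u n..v n} y \<partial>lborel)" .
  qed
  also have "\<dots> = (\<integral>\<^sup>+y. f (h y) * h' y * indicator (\<Union>n. {u n..v n}) y \<partial>lborel)"
    by (rule SUP_nn_integral_indicator_incseq[OF _ _ inc]) auto
  also have "\<dots> = (\<integral>\<^sup>+y. f (g y) * g' y * indicator {a<..<b} y \<partial>lborel)"
    unfolding Un by (intro nn_integral_cong) (auto simp: h_def h'_def split: split_indicator)
  finally show ?thesis .
qed

lemma nn_integral_real3:
  fixes f :: "real^3 \<Rightarrow> ennreal"
  assumes [measurable]: "f \<in> borel_measurable borel"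
  shows "(\<integral>\<^sup>+v. f v \<partial>lborel) = (\<integral>\<^sup>+c. \<integral>\<^sup>+b. \<integral>\<^sup>+a. f (vector [a, b, c]) \<partial>lborel \<partial>lborel \<partial>lborel)"
proof -
  define \<Phi> :: "real \<times> real \<times> real \<Rightarrow> real^3" where "\<Phi> = (\<lambda>(c, b, a). vector [a, b, c])"
  have "\<Phi> = (\<lambda>z. (snd (snd z)) *\<^sub>R axis 1 1 + (fst (snd z)) *\<^sub>R axis 2 1 + (fst z) *\<^sub>R axis 3 1)"
    by (auto simp: \<Phi>_def fun_eq_iff vec_eq_iff forall_3 axis_def)
  then have [measurable]: "\<Phi> \<in> borel_measurable borel"
    by (auto intro!: borel_measurable_continuous_onI continuous_intros)
  have [measurable]: "\<Phi> \<in> borel_measurable (lborel \<Otimes>\<^sub>M (lborel \<Otimes>\<^sub>M lborel))"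
    by (simp add: lborel_prod)
  have Basis: "Basis = {axis 1 1, axis 2 1, axis (3::3) (1::real)}"
    by (auto simp: Basis_vec_def UNIV_3)
  have ne: "axis 1 1 \<noteq> (axis 2 1 :: real^3)" "axis 1 1 \<noteq> (axis 3 1 :: real^3)" "axis 2 1 \<noteq> (axis 3 1 :: real^3)"
    by (auto simp: axis_eq_axis)
  have "lborel = distr (lborel \<Otimes>\<^sub>M (lborel \<Otimes>\<^sub>M lborel)) borel \<Phi>"
  proof (rule lborel_eqI)
    fix l u :: "real^3" assume le: "\<And>b. b \<in> Basis \<Longrightarrow> l \<bullet> b \<le> u \<bullet> b"
    then have le': "l $ 1 \<le> u $ 1" "l $ 2 \<le> u $ 2" "l $ 3 \<le> u $ 3"
      using le[of "axis 1 1"] le[of "axis 2 1"] le[of "axis 3 1"] by (simp_all add: Basis inner_axis)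
    have "\<Phi> -` box l u \<inter> space (lborel \<Otimes>\<^sub>M (lborel \<Otimes>\<^sub>M lborel))
        = {l $ 3<..<u $ 3} \<times> {l $ 2<..<u $ 2} \<times> {l $ 1<..<u $ 1}"
      by (auto simp: \<Phi>_def space_pair_measure mem_box_cart forall_3)
    then have "emeasure (distr (lborel \<Otimes>\<^sub>M (lborel \<Otimes>\<^sub>M lborel)) borel \<Phi>) (box l u)
        = emeasure (lborel \<Otimes>\<^sub>M (lborel \<Otimes>\<^sub>M lborel)) ({l $ 3<..<u $ 3} \<times> {l $ 2<..<u $ 2} \<times> {l $ 1<..<u $ 1})"
      by (subst emeasure_distr) auto
    also have "\<dots> = (u $ 3 - l $ 3) * ((u $ 2 - l $ 2) * (u $ 1 - l $ 1))"
    proof -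
      have "emeasure (lborel \<Otimes>\<^sub>M lborel) ({l $ 2<..<u $ 2} \<times> {l $ 1<..<u $ 1})
          = ennreal ((u $ 2 - l $ 2) * (u $ 1 - l $ 1))"
        using le' by (simp add: lborel.emeasure_pair_measure_Times ennreal_mult)
      then show ?thesis
        using le' by (simp only: lborel_prod[where 'a=real and 'b=real])
          (subst lborel.emeasure_pair_measure_Times, auto simp: ennreal_mult intro!: borel_open open_Times)
    qed
    also have "\<dots> = (\<Prod>b\<in>Basis. (u - l) \<bullet> b)"
      unfolding Basis using ne by (simp add: inner_axis inner_diff_left algebra_simps)
    finally show "emeasure (distr (lborel \<Otimes>\<^sub>M (lborel \<Otimes>\<^sub>M lborel)) borel \<Phi>) (box l u) = ennreal (\<Prod>b\<in>Basis. (u - l) \<bullet> b)" .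
  qed simp
  moreover have "(\<integral>\<^sup>+v. f v \<partial>distr (lborel \<Otimes>\<^sub>M (lborel \<Otimes>\<^sub>M lborel)) borel \<Phi>)
      = (\<integral>\<^sup>+z. f (\<Phi> z) \<partial>(lborel \<Otimes>\<^sub>M (lborel \<Otimes>\<^sub>M lborel)))"
    by (rule nn_integral_distr) auto
  ultimately have "(\<integral>\<^sup>+v. f v \<partial>lborel) = (\<integral>\<^sup>+z. f (\<Phi> z) \<partial>(lborel \<Otimes>\<^sub>M (lborel \<Otimes>\<^sub>M lborel)))"
    by simp
  also have "\<dots> = (\<integral>\<^sup>+c. \<integral>\<^sup>+ba. f (\<Phi> (c, ba)) \<partial>(lborel \<Otimes>\<^sub>M lborel) \<partial>lborel)"
    by (subst lborel.nn_integral_fst[symmetric] lborel_prod | simp add: lborel_prod)+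
  also have "\<dots> = (\<integral>\<^sup>+c. \<integral>\<^sup>+b. \<integral>\<^sup>+a. f (\<Phi> (c, b, a)) \<partial>lborel \<partial>lborel \<partial>lborel)"
    by (intro nn_integral_cong) (subst lborel.nn_integral_fst[symmetric], auto)
  finally show ?thesis by (simp add: \<Phi>_def)
qed

lemma nn_integral_orthogonal_transformation:
  fixes f :: "real^'n::{finite,wellorder} \<Rightarrow> ennreal" and T :: "real^'n::_ \<Rightarrow> real^'n::_"
  assumes [measurable]: "f \<in> borel_measurable borel" and T: "orthogonal_transformation T"
  shows "(\<integral>\<^sup>+v. f (T v) \<partial>lborel) = (\<integral>\<^sup>+v. f v \<partial>lborel)"
proof -
  have [measurable]: "T \<in> borel_measurable borel"
    using T by (intro borel_measurable_continuous_onI linear_continuous_on)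
      (simp add: linear_conv_bounded_linear[symmetric] orthogonal_transformation_linear)
  have "lborel = distr lborel borel T"
  proof (rule lborel_eqI)
    fix l u :: "real^'n::_" assume le: "\<And>b. b \<in> Basis \<Longrightarrow> l \<bullet> b \<le> u \<bullet> b"
    have bT: "bij T" using T by (rule orthogonal_transformation_bij)
    have V: "T -` box l u = inv T ` box l u" using bT by (simp add: bij_vimage_eq_inv_image)
    have invT: "orthogonal_transformation (inv T)" using T by (rule orthogonal_transformation_inv)
    have meas: "T -` box l u \<in> sets borel"
      using measurable_sets[of T borel borel "box l u"] by simp
    have "emeasure (distr lborel borel T) (box l u) = emeasure lborel (T -` box l u)"
      by (simp add: emeasure_distr)
    also have "\<dots> = emeasure lebesgue (inv T ` box l u)"
      using meas unfolding V by (simp add: emeasure_completion)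
    also have "\<dots> = ennreal (measure lebesgue (inv T ` box l u))"
      using measurable_orthogonal_image[OF invT lmeasurable_box] by (simp add: emeasure_eq_measure2)
    also have "\<dots> = ennreal (measure lebesgue (box l u))"
      by (simp add: measure_orthogonal_image[OF invT lmeasurable_box])
    also have "\<dots> = ennreal (\<Prod>b\<in>Basis. (u - l) \<bullet> b)"
      using le by (simp add: measure_lborel_box inner_diff_left)
    finally show "emeasure (distr lborel borel T) (box l u) = ennreal (\<Prod>b\<in>Basis. (u - l) \<bullet> b)" .
  qed simp
  moreover have "(\<integral>\<^sup>+v. f v \<partial>distr lborel borel T) = (\<integral>\<^sup>+v. f (T v) \<partial>lborel)"
    by (rule nn_integral_distr) auto
  ultimately show ?thesis by simp
qed

lemma nn_integral_orthonormal_frame: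
  fixes f :: "real^3 \<Rightarrow> ennreal" and p t n :: "real^3"
  assumes [measurable]: "f \<in> borel_measurable borel"
    and fr: "norm p = 1" "norm t = 1" "norm n = 1" "p \<bullet> t = 0" "p \<bullet> n = 0" "t \<bullet> n = 0"
  shows "(\<integral>\<^sup>+v. f v \<partial>lborel)
       = (\<integral>\<^sup>+c. \<integral>\<^sup>+b. \<integral>\<^sup>+a. f (a *\<^sub>R p + b *\<^sub>R t + c *\<^sub>R n) \<partial>lborel \<partial>lborel \<partial>lborel)"
proof -
  define T :: "real^3 \<Rightarrow> real^3" where "T = (\<lambda>v. (v $ 1) *\<^sub>R p + (v $ 2) *\<^sub>R t + (v $ 3) *\<^sub>R n)"
  have lin: "linear T"
    unfolding T_def by (intro linearI) (simp_all add: algebra_simps)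
  have "T v \<bullet> T w = v \<bullet> w" for v w
  proof -
    have "p \<bullet> p = 1" "t \<bullet> t = 1" "n \<bullet> n = 1" "t \<bullet> p = 0" "n \<bullet> p = 0" "n \<bullet> t = 0"
      using fr by (simp_all add: norm_eq_1 inner_commute)
    then have "T v \<bullet> T w = v $ 1 * w $ 1 + v $ 2 * w $ 2 + v $ 3 * w $ 3"
      using fr by (simp add: T_def inner_add_left inner_add_right)
    then show ?thesis by (simp add: inner_vec_def sum_3)
  qed
  then have T: "orthogonal_transformation T"
    using lin by (simp add: orthogonal_transformation_def)
  then have [measurable]: "T \<in> borel_measurable borel"
    by (intro borel_measurable_continuous_onI linear_continuous_on)
      (simp add: linear_conv_bounded_linear[symmetric] orthogonal_transformation_linear)
  have "(\<integral>\<^sup>+v. f v \<partial>lborel) = (\<integral>\<^sup>+v. f (T v) \<partial>lborel)"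
    by (rule nn_integral_orthogonal_transformation[OF assms(1) T, symmetric])
  also have "\<dots> = (\<integral>\<^sup>+c. \<integral>\<^sup>+b. \<integral>\<^sup>+a. f (T (vector [a, b, c])) \<partial>lborel \<partial>lborel \<partial>lborel)"
    by (rule nn_integral_real3) measurable
  finally show ?thesis by (simp add: T_def)
qed

text \<open>Polar coordinates with pole \<open>p\<close> on the hemisphere around \<open>n\<close>:
  \<open>q\<close> is the tangent of the polar angle measured from \<open>n\<close>, and
  \<open>w\<close> is the cotangent of the distance r to \<open>p\<close>. The density is d theta
  times sin r dr. With these coordinates every substitution is affine. The factor 3 cancels the 1/3
  from the radial integral of c^2 and matches the convention in \<open>sph_area\<close>.\<close>

lemma nn_integral_cone:
  fixes f :: "real^3 \<Rightarrow> ennreal" and p t n :: "real^3"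
  assumes [measurable]: "f \<in> borel_measurable borel"
    and hom: "\<And>s v. 0 < s \<Longrightarrow> f (s *\<^sub>R v) = f v"
    and fr: "norm p = 1" "norm t = 1" "norm n = 1" "p \<bullet> t = 0" "p \<bullet> n = 0" "t \<bullet> n = 0"
  shows "3 * (\<integral>\<^sup>+v. f v * indicator {v. 0 < v \<bullet> n \<and> norm v \<le> 1} v \<partial>lborel)
       = (\<integral>\<^sup>+q. \<integral>\<^sup>+w. f ((sqrt (1 + q\<^sup>2) * w) *\<^sub>R p + q *\<^sub>R t + n)
            * ennreal (1 / (1 + q\<^sup>2) * (1 / sqrt (1 + w\<^sup>2) ^ 3)) \<partial>lborel \<partial>lborel)"
proof -
  have fr': "p \<bullet> p = 1" "t \<bullet> t = 1" "n \<bullet> n = 1" "t \<bullet> p = 0" "n \<bullet> p = 0" "n \<bullet> t = 0"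
    using fr by (simp_all add: norm_eq_1 inner_commute)
  have pos: "0 < 1 + x\<^sup>2" for x :: real by (simp add: add_pos_nonneg)
  define R where "R = (\<lambda>q w. sqrt (1 + q\<^sup>2) * sqrt (1 + w\<^sup>2) :: real)"
  have Rpos: "0 < R q w" for q w unfolding R_def by (simp add: pos)
  define e where "e = (\<lambda>q w. (sqrt (1 + q\<^sup>2) * w) *\<^sub>R p + q *\<^sub>R t + n)"
  have norm_e: "norm (e q w) = R q w" for q w
  proof -
    have "e q w \<bullet> e q w = (1 + q\<^sup>2) * (1 + w\<^sup>2)"
      using fr fr' pos[of q] by (simp add: e_def inner_add_left inner_add_right power2_eq_square algebra_simps)
    then show ?thesis by (simp add: norm_eq_sqrt_inner R_def real_sqrt_mult)
  qed
  let ?I = "indicator {v. 0 < v \<bullet> n \<and> norm v \<le> 1} :: real^3 \<Rightarrow> ennreal"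
  have [measurable]: "{v::real^3. 0 < v \<bullet> n \<and> norm v \<le> 1} \<in> sets borel" by measurable
  \<comment> \<open>\<open>c\<close> is the height along \<open>n\<close>. The substitutions b = c q
    and a = c sqrt (1 + q^2) w contribute the Jacobian c^2 sqrt (1 + q^2), and c <= 1 / R says that
    the point has norm at most 1.\<close>
  define H where "H = (\<lambda>c q w. f (e q w) * ennreal (c\<^sup>2 * sqrt (1 + q\<^sup>2)) * indicator {0<..1 / R q w} c)"
  have em: "(\<lambda>x. e (g x) (h x)) \<in> borel_measurable M"
    if [measurable]: "g \<in> borel_measurable M" "h \<in> borel_measurable M" for g h and M :: "'m measure"
    unfolding e_def by measurable
  have Hm: "(\<lambda>x. H (k x) (g x) (h x)) \<in> borel_measurable M"
    if [measurable]: "k \<in> borel_measurable M" "g \<in> borel_measurable M" "h \<in> borel_measurable M" for k g h and M :: "'m measure"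
  proof -
    have [measurable]: "(\<lambda>x. e (g x) (h x)) \<in> borel_measurable M" by (rule em) measurable
    show ?thesis unfolding H_def R_def greaterThanAtMost_iff indicator_def by measurable
  qed
  have inner: "(\<integral>\<^sup>+b. \<integral>\<^sup>+a. f (a *\<^sub>R p + b *\<^sub>R t + c *\<^sub>R n) * ?I (a *\<^sub>R p + b *\<^sub>R t + c *\<^sub>R n) \<partial>lborel \<partial>lborel)
      = (\<integral>\<^sup>+q. \<integral>\<^sup>+w. H c q w \<partial>lborel \<partial>lborel)" for c
  proof (cases "0 < c")
    case False
    have "f (a *\<^sub>R p + b *\<^sub>R t + c *\<^sub>R n) * ?I (a *\<^sub>R p + b *\<^sub>R t + c *\<^sub>R n) = 0" for a b
      using False fr fr' by (simp add: inner_add_left)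
    moreover have "H c q w = 0" for q w using False by (simp add: H_def)
    ultimately show ?thesis by (simp only:)
  next
    case True
    define F where "F = (\<lambda>v. f v * ?I v)"
    have [measurable]: "F \<in> borel_measurable borel" unfolding F_def by measurable
    have "(\<integral>\<^sup>+b. \<integral>\<^sup>+a. F (a *\<^sub>R p + b *\<^sub>R t + c *\<^sub>R n) \<partial>lborel \<partial>lborel)
        = ennreal c * (\<integral>\<^sup>+q. \<integral>\<^sup>+a. F (a *\<^sub>R p + (c * q) *\<^sub>R t + c *\<^sub>R n) \<partial>lborel \<partial>lborel)"
      using True by (subst nn_integral_real_affine[where c=c and t=0]) auto
    also have "\<dots> = (\<integral>\<^sup>+q. ennreal c * (\<integral>\<^sup>+a. F (a *\<^sub>R p + (c * q) *\<^sub>R t + c *\<^sub>R n) \<partial>lborel) \<partial>lborel)"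
      by (rule nn_integral_cmult[symmetric]) measurable
    also have "\<dots> = (\<integral>\<^sup>+q. \<integral>\<^sup>+w. H c q w \<partial>lborel \<partial>lborel)"
    proof (rule nn_integral_cong)
      fix q
      have k: "0 < c * sqrt (1 + q\<^sup>2)" using True pos by simp
      have "(\<integral>\<^sup>+a. F (a *\<^sub>R p + (c * q) *\<^sub>R t + c *\<^sub>R n) \<partial>lborel)
          = ennreal (c * sqrt (1 + q\<^sup>2)) * (\<integral>\<^sup>+w. F ((c * sqrt (1 + q\<^sup>2) * w) *\<^sub>R p + (c * q) *\<^sub>R t + c *\<^sub>R n) \<partial>lborel)"
        using k by (subst nn_integral_real_affine[where c="c * sqrt (1 + q\<^sup>2)" and t=0]) auto
      also have "\<dots> = (\<integral>\<^sup>+w. ennreal (c * sqrt (1 + q\<^sup>2)) * F ((c * sqrt (1 + q\<^sup>2) * w) *\<^sub>R p + (c * q) *\<^sub>R t + c *\<^sub>R n) \<partial>lborel)"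
        by (rule nn_integral_cmult[symmetric]) measurable
      finally have "ennreal c * (\<integral>\<^sup>+a. F (a *\<^sub>R p + (c * q) *\<^sub>R t + c *\<^sub>R n) \<partial>lborel)
        = (\<integral>\<^sup>+w. ennreal c * (ennreal (c * sqrt (1 + q\<^sup>2)) * F ((c * sqrt (1 + q\<^sup>2) * w) *\<^sub>R p + (c * q) *\<^sub>R t + c *\<^sub>R n)) \<partial>lborel)"
        by (simp only:) (rule nn_integral_cmult[symmetric], measurable)
      also have "\<dots> = (\<integral>\<^sup>+w. H c q w \<partial>lborel)"
      proof (rule nn_integral_cong)
        fix w
        have *: "(c * sqrt (1 + q\<^sup>2) * w) *\<^sub>R p + (c * q) *\<^sub>R t + c *\<^sub>R n = c *\<^sub>R e q w"
          by (simp add: e_def algebra_simps)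
        have "e q w \<bullet> n = 1" using fr fr' by (simp add: e_def inner_add_left)
        then have **: "?I (c *\<^sub>R e q w) = indicator {0<..1 / R q w} c"
          using True Rpos[of q w] by (auto simp: norm_e indicator_def field_simps)
        show "ennreal c * (ennreal (c * sqrt (1 + q\<^sup>2)) * F ((c * sqrt (1 + q\<^sup>2) * w) *\<^sub>R p + (c * q) *\<^sub>R t + c *\<^sub>R n)) = H c q w"
          unfolding * F_def ** H_def hom[OF True] using True pos[of q]
          by (simp add: ennreal_mult[symmetric] mult.assoc[symmetric] power2_eq_square)
             (simp add: ennreal_mult mult_ac)
      qed
      finally show "ennreal c * (\<integral>\<^sup>+a. F (a *\<^sub>R p + (c * q) *\<^sub>R t + c *\<^sub>R n) \<partial>lborel) = (\<integral>\<^sup>+w. H c q w \<partial>lborel)" .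
    qed
    finally show ?thesis by (simp add: F_def)
  qed
  have radial: "3 * (\<integral>\<^sup>+c. H c q w \<partial>lborel)
      = f (e q w) * ennreal (1 / (1 + q\<^sup>2) * (1 / sqrt (1 + w\<^sup>2) ^ 3))" for q w
  proof -
    have s: "sqrt (1 + q\<^sup>2) ^ 2 = 1 + q\<^sup>2" using pos[of q] by simp
    have "(\<integral>\<^sup>+c. H c q w \<partial>lborel)
        = (\<integral>\<^sup>+c. (f (e q w) * ennreal (sqrt (1 + q\<^sup>2))) * (ennreal (c\<^sup>2) * indicator {0<..1 / R q w} c) \<partial>lborel)"
      unfolding H_def by (intro nn_integral_cong) (simp add: ennreal_mult mult_ac pos less_imp_le)
    also have "\<dots> = (f (e q w) * ennreal (sqrt (1 + q\<^sup>2))) * (\<integral>\<^sup>+c. (ennreal (c\<^sup>2) * indicator {0<..1 / R q w} c) \<partial>lborel)"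
      by (rule nn_integral_cmult) measurable
    also have "(\<integral>\<^sup>+c. (ennreal (c\<^sup>2) * indicator {0<..1 / R q w} c) \<partial>lborel)
        = (\<integral>\<^sup>+c. (ennreal (c\<^sup>2) * indicator {0..1 / R q w} c) \<partial>lborel)"
      by (intro nn_integral_cong) (auto simp: indicator_def)
    also have "\<dots> = ennreal ((1 / R q w) ^ 3 / 3 - 0 ^ 3 / 3)"
      using Rpos[of q w]
      by (intro nn_integral_FTC_Icc) (auto intro!: derivative_eq_intros simp: power2_eq_square)
    finally have "3 * (\<integral>\<^sup>+c. H c q w \<partial>lborel)
      = f (e q w) * (ennreal 3 * (ennreal (sqrt (1 + q\<^sup>2)) * ennreal ((1 / R q w) ^ 3 / 3)))"
      by (simp add: mult_ac)
    also have "ennreal 3 * (ennreal (sqrt (1 + q\<^sup>2)) * ennreal ((1 / R q w) ^ 3 / 3))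
       = ennreal (3 * (sqrt (1 + q\<^sup>2) * ((1 / R q w) ^ 3 / 3)))"
    proof -
      have nn: "0 \<le> sqrt (1 + q\<^sup>2)" "0 \<le> (1 / R q w) ^ 3 / 3"
        using Rpos[of q w] pos[of q] by (simp_all add: less_imp_le)
      show ?thesis by (simp only: ennreal_mult[symmetric] nn mult_nonneg_nonneg zero_le_numeral)
    qed
    also have "3 * (sqrt (1 + q\<^sup>2) * ((1 / R q w) ^ 3 / 3)) = 1 / (1 + q\<^sup>2) * (1 / sqrt (1 + w\<^sup>2) ^ 3)"
    proof -
      define sq sw where "sq = sqrt (1 + q\<^sup>2)" and "sw = sqrt (1 + w\<^sup>2)"
      have "0 < sq" "0 < sw" "1 + q\<^sup>2 = sq * sq" using pos[of q] pos[of w] s by (auto simp: sq_def sw_def power2_eq_square)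
      moreover from this have "3 * (sq * ((1 / (sq * sw)) ^ 3 / 3)) = 1 / (sq * sq) * (1 / sw ^ 3)"
        by (simp add: field_simps power3_eq_cube)
      ultimately show ?thesis unfolding R_def sq_def[symmetric] sw_def[symmetric] by simp
    qed
    finally show ?thesis .
  qed
  have "(\<integral>\<^sup>+v. f v * ?I v \<partial>lborel) = (\<integral>\<^sup>+c. \<integral>\<^sup>+q. \<integral>\<^sup>+w. H c q w \<partial>lborel \<partial>lborel \<partial>lborel)"
    unfolding inner[symmetric] by (rule nn_integral_orthonormal_frame) (use fr in measurable)
  also have "\<dots> = (\<integral>\<^sup>+q. \<integral>\<^sup>+c. \<integral>\<^sup>+w. H c q w \<partial>lborel \<partial>lborel \<partial>lborel)"
    by (rule lborel_pair.Fubini') (auto intro!: lborel.borel_measurable_nn_integral Hm simp: split_beta')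
  also have "\<dots> = (\<integral>\<^sup>+q. \<integral>\<^sup>+w. \<integral>\<^sup>+c. H c q w \<partial>lborel \<partial>lborel \<partial>lborel)"
    by (intro nn_integral_cong lborel_pair.Fubini') (auto intro!: Hm simp: split_beta')
  finally have "3 * (\<integral>\<^sup>+v. f v * ?I v \<partial>lborel) = 3 * (\<integral>\<^sup>+q. \<integral>\<^sup>+w. \<integral>\<^sup>+c. H c q w \<partial>lborel \<partial>lborel \<partial>lborel)"
    by simp
  also have "\<dots> = (\<integral>\<^sup>+q. 3 * (\<integral>\<^sup>+w. \<integral>\<^sup>+c. H c q w \<partial>lborel \<partial>lborel) \<partial>lborel)"
    by (rule nn_integral_cmult[symmetric]) (auto intro!: lborel.borel_measurable_nn_integral Hm simp: split_beta')
  also have "\<dots> = (\<integral>\<^sup>+q. \<integral>\<^sup>+w. 3 * (\<integral>\<^sup>+c. H c q w \<partial>lborel) \<partial>lborel \<partial>lborel)"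
    by (intro nn_integral_cong nn_integral_cmult[symmetric]) (auto intro!: lborel.borel_measurable_nn_integral Hm simp: split_beta')
  finally show ?thesis unfolding radial e_def .
qed

text \<open>If b is the second summand on the right, then cot a + cot b = 2 \<kappa>, that is, sin
  (a + b) = 2 \<kappa> sin a sin b. Since sin a sin b <= sin^2 ((a + b) / 2), the half sum has
  cotangent at most \<kappa>. For a + b >= pi the bound is trivial.\<close>

lemma arccot_add_ge:
  fixes a \<kappa> :: real
  assumes a: "0 < a" "a < pi" and k: "0 < \<kappa>"
  shows "2 * arctan (1 / \<kappa>) \<le> a + (pi / 2 - arctan (2 * \<kappa> - cot a))"
proof -
  define b where "b = pi / 2 - arctan (2 * \<kappa> - cot a)"
  have b: "0 < b" "b < pi"
    using arctan_bounded[of "2 * \<kappa> - cot a"] unfolding b_def by auto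
  have inv: "arctan (1 / \<kappa>) = pi / 2 - arctan \<kappa>"
    using arctan_inverse[of "\<kappa>"] k by (simp add: inverse_eq_divide)
  have cotb: "cot b = 2 * \<kappa> - cot a"
    unfolding b_def cot_altdef tan_cot by (simp add: tan_arctan)
  show ?thesis
  proof (cases "a + b < pi")
    case False
    then show ?thesis using k inv zero_less_arctan_iff[of \<kappa>] unfolding b_def[symmetric] by linarith
  next
    case True
    define s where "s = (a + b) / 2"
    have s: "0 < s" "s < pi / 2" using a b True by (auto simp: s_def)
    have sp: "sin a > 0" "sin b > 0" "sin s > 0" "cos s > 0"
      using a b s by (auto intro!: sin_gt_zero cos_gt_zero)
    have "sin (a + b) = 2 * sin s * cos s" proof -
      have "2 * s = a + b" by (simp add: s_def)
      then show ?thesis using sin_double[of s] by simp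
    qed
    then have "2 * \<kappa> * (sin a * sin b) = 2 * sin s * cos s"
      using cotb sp by (simp add: cot_def field_simps sin_add)
    moreover have "sin a * sin b \<le> (sin s)\<^sup>2"
    proof -
      have "sin a * sin b = (cos (a - b) - cos (2 * s)) / 2"
      proof -
        have "2 * s = a + b" by (simp add: s_def)
        then show ?thesis by (simp only: sin_times_sin)
      qed
      also have "\<dots> \<le> (1 - cos (2 * s)) / 2" by simp
      also have "\<dots> = (sin s)\<^sup>2" by (simp add: cos_double_sin)
      finally show ?thesis .
    qed
    then have "2 * \<kappa> * (sin a * sin b) \<le> 2 * \<kappa> * (sin s)\<^sup>2"
      using k by (intro mult_left_mono) auto
    ultimately have "2 * sin s * cos s \<le> 2 * \<kappa> * (sin s)\<^sup>2" by simp
    then have "cos s \<le> \<kappa> * sin s" using sp by (simp add: power2_eq_square)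
    then have "tan (pi / 2 - s) \<le> \<kappa>" unfolding tan_cot using sp by (simp add: tan_def field_simps)
    then have "arctan (tan (pi / 2 - s)) \<le> arctan \<kappa>" by (simp add: arctan_le_iff)
    then have "pi / 2 - s \<le> arctan \<kappa>" using s by (subst (asm) arctan_tan) auto
    then show ?thesis unfolding inv b_def[symmetric] s_def by argo
  qed
qed

text \<open>Integration by parts leaves a cos^2 / (1 + a^2 sin^2), whose primitive is a combination
  of \<phi> and arctan (s tan \<phi>) with s = sqrt (1 + a^2).\<close>

lemma integral_arctan_sin:
  fixes a :: real
  assumes a: "0 < a"
  shows "((\<lambda>\<phi>. arctan (a * sin \<phi>) * sin \<phi>) has_integral pi * (sqrt (1 + a\<^sup>2) - 1) / a) {0..pi}"
proof -
  define s where "s = sqrt (1 + a\<^sup>2)"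
  have s1: "1 < s" "s\<^sup>2 = 1 + a\<^sup>2" using a by (auto simp: s_def)
  define D where "D = (\<lambda>\<phi>::real. (cos \<phi>)\<^sup>2 + s * (sin \<phi>)\<^sup>2)"
  have Dpos: "D \<phi> > 0" for \<phi>
  proof -
    have "D \<phi> = 1 + (s - 1) * (sin \<phi>)\<^sup>2"
      unfolding D_def using sin_cos_squared_add[of \<phi>] by (simp add: algebra_simps)
    then show ?thesis using s1 by (smt (verit) mult_nonneg_nonneg zero_le_power2)
  qed
  \<comment> \<open>arctan (s tan \<phi>) jumps at pi / 2. Its difference to \<phi>, rewritten by
    the addition theorem, is \<open>E\<close>, which is smooth because \<open>D\<close> is positive;
    \<phi> + E \<phi> therefore continues it over all of [0, pi].\<close>
  define E where "E = (\<lambda>\<phi>. arctan ((s - 1) * sin \<phi> * cos \<phi> / D \<phi>))"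
  define F where "F = (\<lambda>\<phi>. - cos \<phi> * arctan (a * sin \<phi>) - (1 / a) * \<phi>
      + (s / a) * (\<phi> + E \<phi>))"
  have "((\<lambda>\<phi>. arctan (a * sin \<phi>) * sin \<phi>) has_integral (F pi - F 0)) {0..pi}"
  proof (rule fundamental_theorem_of_calculus)
    fix \<phi> :: real
    let ?N = "(s - 1) * sin \<phi> * cos \<phi>"
    define x where "x = sin \<phi>" define y where "y = cos \<phi>"
    have xy: "x\<^sup>2 + y\<^sup>2 = 1" by (simp add: x_def y_def)
    have Dx: "D \<phi> = y\<^sup>2 + s * x\<^sup>2" by (simp add: D_def x_def y_def)
    have D0: "y\<^sup>2 + s * x\<^sup>2 > 0" using Dpos[of \<phi>] Dx by simp
    have Q0: "0 < y\<^sup>2 + s\<^sup>2 * x\<^sup>2"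
      using xy s1 by (smt (verit) mult_nonneg_nonneg zero_le_power2 mult_right_mono power2_eq_square one_le_power zero_less_one mult_cancel_right1 mult_le_cancel_right1)
    have dD: "(D has_real_derivative (2 * (s - 1) * x * y)) (at \<phi>)"
      unfolding D_def x_def y_def by (auto intro!: derivative_eq_intros simp: algebra_simps power2_eq_square)
    have d1: "((\<lambda>\<phi>. (s - 1) * sin \<phi> * cos \<phi> / D \<phi>) has_real_derivative
        (((s - 1) * (y\<^sup>2 - x\<^sup>2)) * D \<phi> - ((s - 1) * x * y) * (2 * (s - 1) * x * y)) / (D \<phi>)\<^sup>2) (at \<phi>)"
      using Dpos[of \<phi>] unfolding x_def y_def
      by (auto intro!: derivative_eq_intros dD[unfolded x_def y_def] simp: algebra_simps power2_eq_square)
    have sq: "(D \<phi>)\<^sup>2 + ((s - 1) * x * y)\<^sup>2 = y\<^sup>2 + s\<^sup>2 * x\<^sup>2"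
    proof -
      have "(D \<phi>)\<^sup>2 + ((s - 1) * x * y)\<^sup>2 = (x\<^sup>2 + y\<^sup>2) * (y\<^sup>2 + s\<^sup>2 * x\<^sup>2)"
        unfolding Dx by (simp add: power2_eq_square algebra_simps)
      then show ?thesis using xy by simp
    qed
    have num: "((s - 1) * (y\<^sup>2 - x\<^sup>2)) * D \<phi> - ((s - 1) * x * y) * (2 * (s - 1) * x * y) = s - (y\<^sup>2 + s\<^sup>2 * x\<^sup>2)"
    proof -
      have x2: "x\<^sup>2 = 1 - y\<^sup>2" using xy by simp
      have "((s - 1) * (y\<^sup>2 - x\<^sup>2)) * D \<phi> - ((s - 1) * x * y) * (2 * (s - 1) * x * y)
        = (s - 1) * ((y\<^sup>2 - x\<^sup>2) * (y\<^sup>2 + s * x\<^sup>2) - 2 * (s - 1) * x\<^sup>2 * y\<^sup>2)"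
        unfolding Dx by (simp add: power2_eq_square algebra_simps)
      also have "\<dots> = s - (y\<^sup>2 + s\<^sup>2 * x\<^sup>2)"
        unfolding x2 by (simp add: power2_eq_square algebra_simps)
      finally show ?thesis .
    qed
    have d2: "(E has_real_derivative
        (s / (y\<^sup>2 + s\<^sup>2 * x\<^sup>2) - 1)) (at \<phi>)"
    proof -
      have "(s - (y\<^sup>2 + s\<^sup>2 * x\<^sup>2)) / (D \<phi>)\<^sup>2 / (1 + ((s - 1) * x * y / D \<phi>)\<^sup>2)
          = (s - (y\<^sup>2 + s\<^sup>2 * x\<^sup>2)) / ((D \<phi>)\<^sup>2 + ((s - 1) * x * y)\<^sup>2)"
        using Dpos[of \<phi>] by (simp add: divide_simps)
      also have "\<dots> = s / (y\<^sup>2 + s\<^sup>2 * x\<^sup>2) - 1"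
        unfolding sq using Q0 by (simp add: field_simps)
      finally have e: "(s - (y\<^sup>2 + s\<^sup>2 * x\<^sup>2)) / (D \<phi>)\<^sup>2 / (1 + ((s - 1) * x * y / D \<phi>)\<^sup>2) = s / (y\<^sup>2 + s\<^sup>2 * x\<^sup>2) - 1" .
      show ?thesis
        unfolding E_def by (rule DERIV_cong[OF DERIV_chain2[OF DERIV_arctan d1[unfolded num]]])
          (use e in \<open>simp add: x_def[symmetric] y_def[symmetric] divide_inverse mult_ac\<close>)
    qed
    have dF: "(F has_real_derivative (x * arctan (a * x) - y * (a * y / (1 + (a * x)\<^sup>2)) - 1 / a
        + (s / a) * (1 + (s / (y\<^sup>2 + s\<^sup>2 * x\<^sup>2) - 1)))) (at \<phi>)"
      unfolding F_def
      by (auto intro!: derivative_eq_intros d2 simp: x_def y_def divide_inverse mult_ac)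
    have z: "- y * (a * y / (1 + (a * x)\<^sup>2)) - 1 / a + (s / a) * (1 + (s / (y\<^sup>2 + s\<^sup>2 * x\<^sup>2) - 1)) = 0"
    proof -
      have q: "y\<^sup>2 + s\<^sup>2 * x\<^sup>2 = 1 + (a * x)\<^sup>2"
        using xy s1 by (simp add: power_mult_distrib algebra_simps)
      have qp: "0 < 1 + (a * x)\<^sup>2" using Q0 q by simp
      have "- y * (a * y / (1 + (a * x)\<^sup>2)) - 1 / a + (s / a) * (1 + (s / (y\<^sup>2 + s\<^sup>2 * x\<^sup>2) - 1))
          = (- a\<^sup>2 * y\<^sup>2 - (1 + (a * x)\<^sup>2) + s\<^sup>2) / (a * (1 + (a * x)\<^sup>2))"
        unfolding q using a qp
        by (simp add: field_simps power2_eq_square) (simp add: diff_divide_distrib[symmetric] add_divide_distrib[symmetric] algebra_simps)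
      also have "- a\<^sup>2 * y\<^sup>2 - (1 + (a * x)\<^sup>2) + s\<^sup>2 = - a\<^sup>2 * (x\<^sup>2 + y\<^sup>2 - 1)"
        using s1 by (simp add: power_mult_distrib algebra_simps)
      also have "\<dots> = 0" using xy by simp
      finally show ?thesis by simp
    qed
    have "(F has_real_derivative arctan (a * sin \<phi>) * sin \<phi>) (at \<phi>)"
      using z by (intro DERIV_cong[OF dF]) (simp add: x_def mult.commute)
    then show "(F has_vector_derivative arctan (a * sin \<phi>) * sin \<phi>) (at \<phi> within {0..pi})"
      by (simp add: has_real_derivative_iff_has_vector_derivative[symmetric] has_field_derivative_at_within)
  qed simp
  moreover have "F pi - F 0 = pi * (s - 1) / a" using a by (simp add: F_def E_def field_simps)
  ultimately show ?thesis by (simp add: s_def)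
qed

lemma periodic_of_int:
  fixes f :: "real \<Rightarrow> 'a"
  assumes "\<And>x. f (x + P) = f x"
  shows "f (x + of_int m * P) = f x"
proof -
  have nat: "f (x + of_nat n * P) = f x" for n x
  proof (induction n)
    case (Suc n)
    then show ?case using assms[of "x + of_nat n * P"] by (simp add: algebra_simps)
  qed simp
  show ?thesis
  proof (cases m)
    case (nonneg n)
    then show ?thesis using nat[of x n] by simp
  next
    case (neg n)
    then have "(of_int m :: real) = - of_nat (Suc n)" by simp
    then have "x + of_int m * P + of_nat (Suc n) * P = x" by (simp only: mult_minus_left)
    then show ?thesis using nat[of "x + of_int m * P" "Suc n"] by metis
  qed
qed

lemma has_vector_derivative_Complex:
  assumes "(f has_real_derivative f') (at x)" "(g has_real_derivative g') (at x)"
  shows "((\<lambda>x. Complex (f x) (g x)) has_vector_derivative Complex f' g') (at x)"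
  unfolding Complex_eq using assms
  by (auto intro!: derivative_eq_intros simp: has_real_derivative_iff_has_vector_derivative)

text \<open>Dividing numerator and denominator by \<open>y - x\<close> leaves limits
  \<open>c\<close> over 0. This describes a chord whose ends merge: its tangential component
  vanishes to first order, its normal component to second order.\<close>

lemma filterlim_quotient_vanishing_denom:
  fixes f g :: "real \<Rightarrow> real"
  assumes f: "(f has_real_derivative c) (at x)" "f x = 0" "0 < c"
    and g: "(g has_real_derivative 0) (at x)" "g x = 0"
  shows "(\<forall>\<^sub>F y in at_right x. 0 < g y) \<Longrightarrow> filterlim (\<lambda>y. f y / g y) at_top (at_right x)"
    and "(\<forall>\<^sub>F y in at_left x. 0 < g y) \<Longrightarrow> filterlim (\<lambda>y. f y / g y) at_bot (at_left x)"
proof -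
  have fl: "((\<lambda>y. f y / (y - x)) \<longlongrightarrow> c) (at x within S)" and gl: "((\<lambda>y. g y / (y - x)) \<longlongrightarrow> 0) (at x within S)" for S
    using f g by (auto simp: has_field_derivative_iff intro: tendsto_within_subset)
  {
    assume e: "\<forall>\<^sub>F y in at_right x. 0 < g y"
    have "filterlim (\<lambda>y. (f y / (y - x)) / (g y / (y - x))) at_top (at_right x)"
    proof (rule LIM_at_top_divide[OF fl f(3) gl])
      show "\<forall>\<^sub>F y in at_right x. 0 < g y / (y - x)"
        using e eventually_at_right_less[of x] by eventually_elim simp
    qed
    moreover have ev2: "\<forall>\<^sub>F y in at_right x. (f y / (y - x)) / (g y / (y - x)) = f y / g y"
      using eventually_at_right_less[of x] by eventually_elim simp
    ultimately show "filterlim (\<lambda>y. f y / g y) at_top (at_right x)"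
      by (simp only: filterlim_cong[OF refl refl ev2])
  }
  {
    assume e: "\<forall>\<^sub>F y in at_left x. 0 < g y"
    have ev: "\<forall>\<^sub>F y in at_left x. y < x" by (simp add: eventually_at_filter)
    have "filterlim (\<lambda>y. (f y / (y - x)) / (- (g y / (y - x)))) at_top (at_left x)"
    proof (rule LIM_at_top_divide[OF fl f(3)])
      show "((\<lambda>y. - (g y / (y - x))) \<longlongrightarrow> 0) (at_left x)" using tendsto_minus[OF gl] by simp
      show "\<forall>\<^sub>F y in at_left x. 0 < - (g y / (y - x))"
        using e ev by eventually_elim (simp add: divide_pos_neg)
    qed
    then have "filterlim (\<lambda>y. - ((f y / (y - x)) / (- (g y / (y - x))))) at_bot (at_left x)"
      by (simp add: filterlim_uminus_at_bot)
    moreover have ev2: "\<forall>\<^sub>F y in at_left x. - ((f y / (y - x)) / (- (g y / (y - x)))) = f y / g y"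
      using ev by eventually_elim simp
    ultimately show "filterlim (\<lambda>y. f y / g y) at_bot (at_left x)"
      by (simp only: filterlim_cong[OF refl refl ev2])
  }
qed

lemma borel_measurable_fst_real [measurable]: "fst \<in> borel_measurable (borel :: (real \<times> real) measure)"
  and borel_measurable_snd_real [measurable]: "snd \<in> borel_measurable (borel :: (real \<times> real) measure)"
  by (intro borel_measurable_continuous_onI continuous_intros)+

text \<open>Trades the range on which angles are monotone for one that treats both ends of a chord
  alike, as needed to exchange them.\<close>

lemma nn_integral_period_shift:
  fixes h :: "real \<Rightarrow> ennreal"
  assumes [measurable]: "h \<in> borel_measurable borel" and per: "\<And>y. h (y + P) = h y"
    and x: "0 \<le> x" "x < P"
  shows "(\<integral>\<^sup>+y. h y * indicator {x<..<x + P} y \<partial>lborel) = (\<integral>\<^sup>+y. h y * indicator ({0..<P} - {x}) y \<partial>lborel)"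
proof -
  have "(\<integral>\<^sup>+y. h y * indicator {x<..<x + P} y \<partial>lborel)
      = (\<integral>\<^sup>+y. h y * indicator {x<..<P} y + h y * indicator {P..<x + P} y \<partial>lborel)"
    using x by (intro nn_integral_cong) (auto split: split_indicator)
  also have "\<dots> = (\<integral>\<^sup>+y. h y * indicator {x<..<P} y \<partial>lborel) + (\<integral>\<^sup>+y. h y * indicator {P..<x + P} y \<partial>lborel)"
    by (rule nn_integral_add) measurable
  also have "(\<integral>\<^sup>+y. h y * indicator {P..<x + P} y \<partial>lborel) = (\<integral>\<^sup>+y. h (P + 1 * y) * indicator {P..<x + P} (P + 1 * y) \<partial>lborel)"
    by (subst nn_integral_real_affine[where c=1 and t=P]) auto
  also have "\<dots> = (\<integral>\<^sup>+y. h y * indicator {0..<x} y \<partial>lborel)"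
    using per by (intro nn_integral_cong) (auto simp: add.commute split: split_indicator)
  also have "(\<integral>\<^sup>+y. h y * indicator {x<..<P} y \<partial>lborel) + (\<integral>\<^sup>+y. h y * indicator {0..<x} y \<partial>lborel)
      = (\<integral>\<^sup>+y. h y * indicator {x<..<P} y + h y * indicator {0..<x} y \<partial>lborel)"
    by (rule nn_integral_add[symmetric]) measurable
  also have "\<dots> = (\<integral>\<^sup>+y. h y * indicator ({0..<P} - {x}) y \<partial>lborel)"
    using x by (intro nn_integral_cong) (auto split: split_indicator)
  finally show ?thesis .
qed

lemma cot_measurable [measurable]: "cot \<in> borel_measurable (borel :: real measure)"
  unfolding cot_def[abs_def] by measurable

lemma funpow_borel_measurable: "f \<in> borel_measurable borel \<Longrightarrow> f ^^ n \<in> borel_measurable borel"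
  for f :: "real \<times> real \<Rightarrow> real \<times> real"
proof (induction n)
  case (Suc n)
  then show ?case by (auto simp: comp_def intro: measurable_compose)
qed (simp add: id_def)

text \<open>In terms of w = cot r, with c / s = cot L, the integrands become sin r and 1 in dr over
  0 < r <= L. The first integral is the area of a sector of radius L per unit angle, the second
  recovers L.\<close>

lemma nn_integral_Ici_inverse_powers:
  assumes "0 < s" "c\<^sup>2 + s\<^sup>2 = 1"
  shows "(\<integral>\<^sup>+w. ennreal (1 / sqrt (1 + w\<^sup>2) ^ 3) * indicator {c / s..} w \<partial>lborel) = ennreal (1 - c)"
    and "(\<integral>\<^sup>+w. ennreal (1 / (1 + w\<^sup>2)) * indicator {c / s..} w \<partial>lborel) = ennreal (pi / 2 - arctan (c / s))"
proof -
  have pos: "0 < 1 + w\<^sup>2" for w :: real by (simp add: add_pos_nonneg)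
  have "((\<lambda>w. w / sqrt (1 + w\<^sup>2)) has_real_derivative 1 / sqrt (1 + w\<^sup>2) ^ 3) (at w)" for w :: real
  proof -
    define q where "q = sqrt (1 + w\<^sup>2)"
    have q: "0 < q" "q\<^sup>2 = 1 + w\<^sup>2" using pos[of w] by (auto simp: q_def)
    have d: "((\<lambda>w. sqrt (1 + w\<^sup>2)) has_real_derivative w / q) (at w)"
      using pos[of w] by (auto intro!: derivative_eq_intros simp: q_def field_simps)
    have "((\<lambda>w. w / sqrt (1 + w\<^sup>2)) has_real_derivative (1 * q - w * (w / q)) / (q * q)) (at w)"
      using DERIV_divide[OF DERIV_ident d] q(1) by (simp add: q_def[symmetric])
    moreover have "(1 * q - w * (w / q)) / (q * q) = 1 / q ^ 3"
    proof -
      have "1 * q - w * (w / q) = (q\<^sup>2 - w\<^sup>2) / q" using q(1) by (simp add: field_simps power2_eq_square)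
      also have "\<dots> = 1 / q" using q(2) by simp
      finally show ?thesis using q(1) by (simp add: power3_eq_cube)
    qed
    ultimately show ?thesis by (simp add: q_def)
  qed
  moreover have "((\<lambda>w::real. w / sqrt (1 + w\<^sup>2)) \<longlongrightarrow> 1) at_top" by real_asymp
  ultimately have "(\<integral>\<^sup>+w. ennreal (1 / sqrt (1 + w\<^sup>2) ^ 3) * indicator {c / s..} w \<partial>lborel)
      = ennreal (1 - (c / s) / sqrt (1 + (c / s)\<^sup>2))"
    by (intro nn_integral_FTC_atLeast) (auto simp: pos less_imp_le)
  also have "(c / s) / sqrt (1 + (c / s)\<^sup>2) = c"
  proof -
    have "1 + (c / s)\<^sup>2 = (1 / s)\<^sup>2" using assms by (simp add: power_divide field_simps)
    then show ?thesis using assms(1) by simp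
  qed
  finally show "(\<integral>\<^sup>+w. ennreal (1 / sqrt (1 + w\<^sup>2) ^ 3) * indicator {c / s..} w \<partial>lborel) = ennreal (1 - c)" .
  show "(\<integral>\<^sup>+w. ennreal (1 / (1 + w\<^sup>2)) * indicator {c / s..} w \<partial>lborel) = ennreal (pi / 2 - arctan (c / s))"
  proof (rule nn_integral_FTC_atLeast)
    show "(\<lambda>w::real. 1 / (1 + w\<^sup>2)) \<in> borel_measurable borel" by measurable
    show "(arctan has_real_derivative 1 / (1 + w\<^sup>2)) (at w)" for w
      using DERIV_arctan[of w] by (simp add: inverse_eq_divide)
    show "0 \<le> 1 / (1 + w\<^sup>2)" for w :: real using pos[of w] by simp
  qed (rule tendsto_arctan_at_top)
qed

text \<open>The conclusion \<open>A \<le> B\<close> is kept because \<open>ennreal (B - A)\<close>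
  alone forgets a negative sign.\<close>

lemma nn_integral_FTC_open:
  fixes f F :: "real \<Rightarrow> real"
  assumes ab: "a < b"
    and F: "\<And>x. a < x \<Longrightarrow> x < b \<Longrightarrow> (F has_real_derivative f x) (at x)"
    and cont: "continuous_on {a<..<b} f"
    and nonneg: "\<And>x. a < x \<Longrightarrow> x < b \<Longrightarrow> 0 \<le> f x"
    and A: "(F \<longlongrightarrow> A) (at_right a)" and B: "(F \<longlongrightarrow> B) (at_left b)"
  shows "(\<integral>\<^sup>+x. ennreal (f x) * indicator {a<..<b} x \<partial>lborel) = ennreal (B - A)" and "A \<le> B"
proof -
  have isC: "isCont f x" if "a < x" "x < b" for x
    using cont that by (simp add: continuous_on_eq_continuous_at)
  have 1: "set_integrable lborel (einterval (ereal a) (ereal b)) f"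
    "(LBINT x=ereal a..ereal b. f x) = B - A"
    using ab F isC nonneg A B
    by (intro interval_integral_FTC_nonneg[where F=F]; simp add: ereal_tendsto_simps)+
  have int: "integrable lborel (\<lambda>x. indicator {a<..<b} x * f x)"
    using 1(1) by (simp add: set_integrable_def)
  have val: "(\<integral>x. indicator {a<..<b} x * f x \<partial>lborel) = B - A"
    using 1(2) ab by (simp add: interval_lebesgue_integral_def set_lebesgue_integral_def)
  have nn: "AE x in lborel. 0 \<le> indicator {a<..<b} x * f x"
    using nonneg by (auto simp: indicator_def)
  have "(\<integral>\<^sup>+x. ennreal (f x) * indicator {a<..<b} x \<partial>lborel) = (\<integral>\<^sup>+x. ennreal (indicator {a<..<b} x * f x) \<partial>lborel)"
    by (intro nn_integral_cong) (auto simp: indicator_def)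
  also have "\<dots> = ennreal (B - A)" using nn_integral_eq_integral[OF int nn] val by simp
  finally show "(\<integral>\<^sup>+x. ennreal (f x) * indicator {a<..<b} x \<partial>lborel) = ennreal (B - A)" .
  show "A \<le> B" using integral_nonneg_AE[OF nn] val by simp
qed

lemma nn_integral_Ioi_Ici:
  "(\<integral>\<^sup>+w. h w * indicator {c<..} w \<partial>lborel) = (\<integral>\<^sup>+w. h w * indicator {c..} w \<partial>lborel)" for c :: real
proof (rule nn_integral_cong_AE)
  have "AE w in lborel. w \<noteq> c" by (rule AE_lborel_singleton)
  then show "AE w in lborel. h w * indicator {c<..} w = h w * indicator {c..} w"
    by eventually_elim (auto simp: indicator_def)
qed

section \<open>Stereographic projection\<close>

lemma orthonormal_cross:
  fixes q a :: "real^3"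
  assumes "norm q = 1" "norm a = 1" "q \<bullet> a = 0"
  shows "norm (cross3 q a) = 1" "q \<bullet> cross3 q a = 0" "a \<bullet> cross3 q a = 0" "cross3 a (cross3 q a) = q"
    "cross3 (cross3 q a) q = a"
proof -
  show "norm (cross3 q a) = 1"
    using norm_cross_dot[of q a] assms by (simp add: power2_eq_1_iff) (smt (verit) norm_ge_zero)
  show "q \<bullet> cross3 q a = 0" "a \<bullet> cross3 q a = 0" by (simp_all add: dot_cross_self)
  show "cross3 a (cross3 q a) = q"
    using assms by (simp add: Lagrange inner_commute norm_eq_1)
  show "cross3 (cross3 q a) q = a"
    using assms by (subst cross_skew) (simp add: Lagrange inner_commute norm_eq_1)
qed

lemma orthonormal_expand:
  fixes q a v :: "real^3"
  assumes "norm q = 1" "norm a = 1" "q \<bullet> a = 0"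
  shows "v = (v \<bullet> q) *\<^sub>R q + (v \<bullet> a) *\<^sub>R a + (v \<bullet> cross3 q a) *\<^sub>R cross3 q a"
proof -
  define b where "b = cross3 q a"
  have b: "norm b = 1" "q \<bullet> b = 0" "a \<bullet> b = 0"
    using orthonormal_cross[OF assms] by (simp_all add: b_def)
  define w where "w = v - ((v \<bullet> q) *\<^sub>R q + (v \<bullet> a) *\<^sub>R a + (v \<bullet> b) *\<^sub>R b)"
  have 1: "q \<bullet> q = 1" "a \<bullet> a = 1" "b \<bullet> b = 1" "a \<bullet> q = 0" "b \<bullet> q = 0" "b \<bullet> a = 0"
    using assms b by (simp_all add: norm_eq_1 inner_commute)
  have w: "w \<bullet> q = 0" "w \<bullet> a = 0" "w \<bullet> b = 0"
    using 1 assms b by (simp_all add: w_def inner_diff_left inner_add_left)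
  have "cross3 w b = 0" using w by (simp add: b_def Lagrange)
  then have "norm w = 0" using norm_cross_dot[of w b] w b by simp
  then show ?thesis by (simp add: w_def b_def)
qed

lemma orthonormal_inner:
  fixes q a v w :: "real^3"
  assumes "norm q = 1" "norm a = 1" "q \<bullet> a = 0"
  shows "v \<bullet> w = (v \<bullet> q) * (w \<bullet> q) + (v \<bullet> a) * (w \<bullet> a) + (v \<bullet> cross3 q a) * (w \<bullet> cross3 q a)"
  by (subst orthonormal_expand[OF assms, of w])
    (simp add: inner_add_right mult.commute)

lemma orthonormal_cross_inner:
  fixes q a v w :: "real^3"
  assumes "norm q = 1" "norm a = 1" "q \<bullet> a = 0"
  shows "cross3 v w \<bullet> q = (v \<bullet> a) * (w \<bullet> cross3 q a) - (v \<bullet> cross3 q a) * (w \<bullet> a)"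
proof -
  have "cross3 v w \<bullet> q = cross3 v w \<bullet> cross3 a (cross3 q a)"
    using orthonormal_cross[OF assms] by simp
  also have "\<dots> = (v \<bullet> a) * (w \<bullet> cross3 q a) - (v \<bullet> cross3 q a) * (w \<bullet> a)"
    unfolding dot_cross by (simp add: algebra_simps)
  finally show ?thesis .
qed

lemma exists_orthonormal:
  fixes q :: "real^3"
  obtains a :: "real^3" where "norm a = 1" "q \<bullet> a = 0"
proof -
  obtain y :: "real^3" where "y \<noteq> 0" "orthogonal q y"
    using orthogonal_to_vector_exists[of q] by auto
  then have "norm (y /\<^sub>R norm y) = 1" "q \<bullet> (y /\<^sub>R norm y) = 0"
    by (auto simp: orthogonal_def)
  then show ?thesis by (rule that)
qed

text \<open>Stereographic projection from \<open>- q\<close>, with \<open>a\<close> and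
  \<open>cross3 q a\<close> as real and imaginary axes. Complex values give access to the Jordan
  curve theorem and to winding numbers.\<close>

definition stereo :: "real^3 \<Rightarrow> real^3 \<Rightarrow> real^3 \<Rightarrow> complex" where
  "stereo q a v = (1 / (1 + v \<bullet> q)) *\<^sub>R Complex (v \<bullet> a) (v \<bullet> cross3 q a)"

definition unstereo :: "real^3 \<Rightarrow> real^3 \<Rightarrow> complex \<Rightarrow> real^3" where
  "unstereo q a z = (1 / (1 + (norm z)\<^sup>2)) *\<^sub>R
     ((1 - (norm z)\<^sup>2) *\<^sub>R q + (2 * Re z) *\<^sub>R a + (2 * Im z) *\<^sub>R cross3 q a)"

context
  fixes q a :: "real^3"
  assumes qa: "norm q = 1" "norm a = 1" "q \<bullet> a = 0"
begin

lemma sphere_inner_gt_minus_1: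
  assumes "norm v = 1" "v \<noteq> - q"
  shows "0 < 1 + v \<bullet> q"
proof -
  have "(norm (v + q))\<^sup>2 = 2 * (1 + v \<bullet> q)"
    using assms qa by (simp add: power2_norm_eq_inner inner_add_left inner_add_right inner_commute norm_eq_1)
  moreover have "v + q \<noteq> 0" using assms by (simp add: eq_neg_iff_add_eq_0)
  ultimately show ?thesis by (smt (verit) zero_less_norm_iff zero_less_power)
qed

lemma norm_stereo:
  assumes "norm v = 1" "v \<noteq> - q"
  shows "(norm (stereo q a v))\<^sup>2 = (1 - v \<bullet> q) / (1 + v \<bullet> q)"
proof -
  have d: "0 < 1 + v \<bullet> q" using sphere_inner_gt_minus_1[OF assms] .
  have "(v \<bullet> a)\<^sup>2 + (v \<bullet> cross3 q a)\<^sup>2 = (1 - v \<bullet> q) * (1 + v \<bullet> q)"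
    using orthonormal_inner[OF qa, of v v] assms by (simp add: norm_eq_1 power2_eq_square algebra_simps)
  then show ?thesis
    using d unfolding stereo_def cmod_power2
    by (simp add: power_divide add_divide_distrib[symmetric]) (simp add: power2_eq_square)
qed

lemma unstereo_stereo:
  assumes "norm v = 1" "v \<noteq> - q"
  shows "unstereo q a (stereo q a v) = v"
proof -
  define d where "d = 1 + v \<bullet> q"
  have d: "0 < d" using sphere_inner_gt_minus_1[OF assms] by (simp add: d_def)
  have n: "(norm (stereo q a v))\<^sup>2 = (2 - d) / d" using norm_stereo[OF assms] by (simp add: d_def)
  have "1 + (norm (stereo q a v))\<^sup>2 = 2 / d" "1 - (norm (stereo q a v))\<^sup>2 = 2 * (v \<bullet> q) / d"
    using d unfolding n by (simp_all add: field_simps d_def)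
  moreover have "Re (stereo q a v) = (v \<bullet> a) / d" "Im (stereo q a v) = (v \<bullet> cross3 q a) / d"
    by (simp_all add: stereo_def d_def)
  ultimately have "unstereo q a (stereo q a v)
      = (v \<bullet> q) *\<^sub>R q + (v \<bullet> a) *\<^sub>R a + (v \<bullet> cross3 q a) *\<^sub>R cross3 q a"
    using d by (simp add: unstereo_def scaleR_add_right)
  then show ?thesis using orthonormal_expand[OF qa, of v] by simp
qed

lemma unstereo_props:
  shows norm_unstereo: "norm (unstereo q a z) = 1"
    and unstereo_neq: "unstereo q a z \<noteq> - q"
    and stereo_unstereo: "stereo q a (unstereo q a z) = z"
proof -
  define b where "b = cross3 q a"
  have b: "norm b = 1" "q \<bullet> b = 0" "a \<bullet> b = 0"
    using orthonormal_cross[OF qa] by (simp_all add: b_def)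
  have 1: "q \<bullet> q = 1" "a \<bullet> a = 1" "b \<bullet> b = 1" "a \<bullet> q = 0" "b \<bullet> q = 0" "b \<bullet> a = 0"
    using qa b by (simp_all add: norm_eq_1 inner_commute)
  define m where "m = (norm z)\<^sup>2"
  have m: "0 \<le> m" "m = (Re z)\<^sup>2 + (Im z)\<^sup>2" by (simp_all add: m_def cmod_power2)
  define u where "u = unstereo q a z"
  have u: "u = (1 / (1 + m)) *\<^sub>R ((1 - m) *\<^sub>R q + (2 * Re z) *\<^sub>R a + (2 * Im z) *\<^sub>R b)"
    by (simp add: u_def unstereo_def m_def b_def)
  have i: "u \<bullet> q = (1 - m) / (1 + m)" "u \<bullet> a = 2 * Re z / (1 + m)" "u \<bullet> b = 2 * Im z / (1 + m)"
    using qa b 1 by (simp_all add: u inner_add_left)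
  have "u \<bullet> u = (1 - m)\<^sup>2 / (1 + m)\<^sup>2 + 4 * m / (1 + m)\<^sup>2"
    unfolding orthonormal_inner[OF qa, of u u] b_def[symmetric] i m(2)
    by (simp add: power2_eq_square add_divide_distrib[symmetric] algebra_simps)
  also have "\<dots> = (1 + m)\<^sup>2 / (1 + m)\<^sup>2"
    by (simp add: add_divide_distrib[symmetric] power2_eq_square algebra_simps)
  also have "\<dots> = 1" using m(1) by simp
  finally show n: "norm u = 1" by (simp add: norm_eq_1)
  have d: "1 + u \<bullet> q = 2 / (1 + m)" using m(1) i(1) by (simp add: field_simps)
  show "u \<noteq> - q"
  proof
    assume "u = - q"
    then have "1 + u \<bullet> q = 0" using 1 by simp
    with d m(1) show False by simp
  qed
  show "stereo q a u = z"
    unfolding stereo_def d b_def[symmetric] i(2,3) using m(1)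
    by (simp add: complex_eq_iff)
qed

lemma continuous_on_unstereo: "continuous_on S (unstereo q a)"
proof -
  have "1 + (norm z)\<^sup>2 \<noteq> 0" for z :: complex by (smt (verit) zero_le_power2)
  then show ?thesis unfolding unstereo_def[abs_def] by (intro continuous_intros) auto
qed

lemma continuous_on_stereo:
  assumes "S \<subseteq> {v. norm v = 1 \<and> v \<noteq> - q}"
  shows "continuous_on S (stereo q a)"
proof -
  have "1 + v \<bullet> q \<noteq> 0" if "v \<in> S" for v
    using sphere_inner_gt_minus_1[of v] assms that by fastforce
  then show ?thesis unfolding stereo_def[abs_def] Complex_eq by (intro continuous_intros) auto
qed

end

section \<open>Convex spherical curves\<close>

locale spherical_billiard =
  fixes \<gamma> :: "real \<Rightarrow> real^3" and P :: real and e :: "real^3"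
  assumes P_pos: "0 < P"
    and on_sphere: "\<forall>x. norm (\<gamma> x) = 1"
    and periodic: "\<forall>x. \<gamma> (x + P) = \<gamma> x"
    and simple: "inj_on \<gamma> {0..<P}"
    and smooth: "smooth_curve \<gamma>"
    and arclength: "\<forall>x. norm (tang \<gamma> x) = 1"
    and hemisphere: "\<forall>x. 0 < \<gamma> x \<bullet> e"
    and strictly_convex: "sph_strictly_convex (inner_region \<gamma> e)"
    and curv_pos: "\<forall>x. 0 < geod_curv \<gamma> x"
begin

abbreviation \<tau> where "\<tau> \<equiv> tang \<gamma>"
abbreviation k where "k \<equiv> geod_curv \<gamma>"
text \<open>The unit normal of the curve within the sphere; that it points into the region is the
  content of \<open>inner_region_nu_pos\<close>.\<close>

definition nu where "nu x = cross3 (\<gamma> x) (\<tau> x)"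
abbreviation D where "D \<equiv> inner_region \<gamma> e"

lemma curve_deriv: "(\<gamma> has_vector_derivative \<tau> x) (at x)"
  and tang_deriv': "(\<tau> has_vector_derivative vector_derivative \<tau> (at x)) (at x)"
  and tang_deriv2: "\<exists>D3. (( \<lambda>x. vector_derivative \<tau> (at x)) has_vector_derivative D3) (at x)"
proof -
  obtain Df :: "nat \<Rightarrow> real \<Rightarrow> real^3" where Df: "Df 0 = \<gamma>"
    "\<And>n x. (Df n has_vector_derivative Df (Suc n) x) (at x)"
    using smooth unfolding smooth_curve_def by auto
  have t: "\<tau> = Df 1"
    unfolding tang_def using Df(2)[of 0] by (auto simp: Df(1) fun_eq_iff vector_derivative_at)
  have t': "(\<lambda>x. vector_derivative \<tau> (at x)) = Df 2"
    unfolding t using Df(2)[of 1] by (auto simp: fun_eq_iff vector_derivative_at numeral_2_eq_2)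
  show "(\<gamma> has_vector_derivative \<tau> x) (at x)" using Df(2)[of 0] by (simp add: t Df(1))
  show "(\<tau> has_vector_derivative vector_derivative \<tau> (at x)) (at x)"
    using Df(2)[of 1 x] t' by (simp add: t fun_eq_iff numeral_2_eq_2)
  show "\<exists>D3. ((\<lambda>x. vector_derivative \<tau> (at x)) has_vector_derivative D3) (at x)"
    unfolding t' using Df(2)[of 2 x] by auto
qed

lemma curve_inner_deriv: "((\<lambda>y. \<gamma> y \<bullet> w) has_real_derivative \<tau> y \<bullet> w) (at y)"
  using bounded_linear.has_vector_derivative[OF bounded_linear_inner_left curve_deriv, of w y]
  by (simp add: has_real_derivative_iff_has_vector_derivative)

lemma inner_curve_self: "\<gamma> x \<bullet> \<gamma> x = 1" "\<tau> x \<bullet> \<tau> x = 1"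
  using on_sphere arclength by (simp_all add: norm_eq_1)

lemma curve_tang: "\<gamma> x \<bullet> \<tau> x = 0"
proof -
  have "((\<lambda>y. \<gamma> y \<bullet> \<gamma> y) has_vector_derivative (\<gamma> x \<bullet> \<tau> x + \<tau> x \<bullet> \<gamma> x)) (at x)"
    by (rule bounded_bilinear.has_vector_derivative[OF bounded_bilinear_inner curve_deriv curve_deriv])
  moreover have "((\<lambda>y. \<gamma> y \<bullet> \<gamma> y) has_vector_derivative 0) (at x)"
    by (simp add: inner_curve_self)
  ultimately have "\<gamma> x \<bullet> \<tau> x + \<tau> x \<bullet> \<gamma> x = 0" by (rule vector_derivative_unique_at)
  then show ?thesis by (simp add: inner_commute)
qed

lemmas frame = on_sphere[rule_format] arclength[rule_format] curve_tang

lemma nu_facts: "norm (nu x) = 1" "\<gamma> x \<bullet> nu x = 0" "\<tau> x \<bullet> nu x = 0" "nu x \<bullet> nu x = 1"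
  "nu x \<bullet> \<gamma> x = 0" "nu x \<bullet> \<tau> x = 0" "\<tau> x \<bullet> \<gamma> x = 0"
  using orthonormal_cross[OF frame, of x] curve_tang[of x]
  by (simp_all add: nu_def norm_eq_1 inner_commute)

lemma frame_expand: "v = (v \<bullet> \<gamma> x) *\<^sub>R \<gamma> x + (v \<bullet> \<tau> x) *\<^sub>R \<tau> x + (v \<bullet> nu x) *\<^sub>R nu x"
  unfolding nu_def by (rule orthonormal_expand[OF frame])

lemma frame_inner: "v \<bullet> w = (v \<bullet> \<gamma> x) * (w \<bullet> \<gamma> x) + (v \<bullet> \<tau> x) * (w \<bullet> \<tau> x) + (v \<bullet> nu x) * (w \<bullet> nu x)"
  unfolding nu_def by (rule orthonormal_inner[OF frame])

lemma vector_derivative_tang: "vector_derivative \<tau> (at x) = - \<gamma> x + k x *\<^sub>R nu x"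
proof -
  define w where "w = vector_derivative \<tau> (at x)"
  have "((\<lambda>y. \<tau> y \<bullet> \<tau> y) has_vector_derivative (\<tau> x \<bullet> w + w \<bullet> \<tau> x)) (at x)"
    unfolding w_def by (rule bounded_bilinear.has_vector_derivative[OF bounded_bilinear_inner tang_deriv' tang_deriv'])
  moreover have "((\<lambda>y. \<tau> y \<bullet> \<tau> y) has_vector_derivative 0) (at x)"
    by (simp add: inner_curve_self)
  ultimately have "\<tau> x \<bullet> w + w \<bullet> \<tau> x = 0" by (rule vector_derivative_unique_at)
  then have 1: "w \<bullet> \<tau> x = 0" by (simp add: inner_commute)
  have "((\<lambda>y. \<gamma> y \<bullet> \<tau> y) has_vector_derivative (\<gamma> x \<bullet> w + \<tau> x \<bullet> \<tau> x)) (at x)"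
    unfolding w_def by (rule bounded_bilinear.has_vector_derivative[OF bounded_bilinear_inner curve_deriv tang_deriv'])
  moreover have "((\<lambda>y. \<gamma> y \<bullet> \<tau> y) has_vector_derivative 0) (at x)"
    by (simp add: curve_tang)
  ultimately have "\<gamma> x \<bullet> w + \<tau> x \<bullet> \<tau> x = 0" by (rule vector_derivative_unique_at)
  then have 2: "w \<bullet> \<gamma> x = - 1" by (simp add: inner_commute inner_curve_self)
  have 3: "w \<bullet> nu x = k x" by (simp add: geod_curv_def w_def nu_def inner_commute)
  show ?thesis using frame_expand[of w x] unfolding 1 2 3 w_def[symmetric] by simp
qed

lemma tang_deriv: "(\<tau> has_vector_derivative (- \<gamma> x + k x *\<^sub>R nu x)) (at x)"
  using tang_deriv'[of x] by (simp add: vector_derivative_tang)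

lemma tang_inner_deriv: "((\<lambda>y. \<tau> y \<bullet> w) has_real_derivative (- (\<gamma> y \<bullet> w) + k y * (nu y \<bullet> w))) (at y)"
  using bounded_linear.has_vector_derivative[OF bounded_linear_inner_left tang_deriv, of w y]
  by (simp add: has_real_derivative_iff_has_vector_derivative inner_add_left inner_diff_left)

lemma continuous_curve: "continuous_on S \<gamma>" "continuous_on S \<tau>" "continuous_on S nu" "continuous_on S k"
proof -
  have c: "continuous_on UNIV \<gamma>" "continuous_on UNIV \<tau>" "continuous_on UNIV (\<lambda>x. vector_derivative \<tau> (at x))"
    using curve_deriv tang_deriv' tang_deriv2
    by (meson continuous_at_imp_continuous_on has_vector_derivative_continuous)+
  show "continuous_on S \<gamma>" "continuous_on S \<tau>"
    using c by (auto intro: continuous_on_subset)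
  show "continuous_on S nu" unfolding nu_def[abs_def]
    using c by (intro continuous_on_cross) (auto intro: continuous_on_subset)
  show "continuous_on S k" unfolding geod_curv_def[abs_def]
    using c by (intro continuous_on_inner continuous_on_cross) (auto intro: continuous_on_subset)
qed

lemma shift_derivative: "((\<lambda>y. y + P) has_vector_derivative 1) (at x)"
  by (auto intro!: derivative_eq_intros)

lemma tang_periodic: "\<tau> (x + P) = \<tau> x"
proof -
  have "((\<lambda>y. \<gamma> (y + P)) has_vector_derivative \<tau> (x + P)) (at x)"
    using vector_diff_chain_at[of "\<lambda>y. y + P" 1 x \<gamma> "\<tau> (x + P)"] curve_deriv[of "x + P"]
    shift_derivative[of x] by (simp add: o_def)
  then have "(\<gamma> has_vector_derivative \<tau> (x + P)) (at x)" using periodic by simp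
  then show ?thesis using curve_deriv by (metis vector_derivative_at)
qed

lemma nu_periodic: "nu (x + P) = nu x"
  by (simp add: nu_def tang_periodic periodic)

lemma reduce_mod:
  obtains m :: int where "x + of_int m * P \<in> {0..<P}"
proof -
  have "x / P - of_int \<lfloor>x / P\<rfloor> \<ge> 0" "x / P - of_int \<lfloor>x / P\<rfloor> < 1" by linarith+
  then have "(x / P - of_int \<lfloor>x / P\<rfloor>) * P \<ge> 0" "(x / P - of_int \<lfloor>x / P\<rfloor>) * P < 1 * P"
    using P_pos by (auto intro: mult_nonneg_nonneg mult_strict_right_mono simp del: mult_1)
  then have "x + of_int (- \<lfloor>x / P\<rfloor>) * P \<in> {0..<P}"
    using P_pos by (simp add: algebra_simps)
  then show ?thesis by (rule that)
qed

lemma curve_range: "range \<gamma> = \<gamma> ` {0..<P}"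
proof -
  have "\<gamma> x \<in> \<gamma> ` {0..<P}" for x
  proof -
    obtain m where "x + of_int m * P \<in> {0..<P}" by (rule reduce_mod)
    moreover have "\<gamma> (x + of_int m * P) = \<gamma> x" using periodic by (intro periodic_of_int) auto
    ultimately show ?thesis by (metis image_eqI)
  qed
  then show ?thesis by auto
qed

lemma curve_eq_imp:
  assumes "\<gamma> x = \<gamma> y" "\<bar>x - y\<bar> < P"
  shows "x = y"
proof -
  obtain m where m: "x + of_int m * P \<in> {0..<P}" by (rule reduce_mod)
  obtain l where l: "y + of_int l * P \<in> {0..<P}" by (rule reduce_mod)
  have "\<gamma> (x + of_int m * P) = \<gamma> (y + of_int l * P)"
    using periodic assms by (simp add: periodic_of_int)
  then have eq: "x + of_int m * P = y + of_int l * P"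
    using simple m l by (meson inj_onD)
  then have "x - y = of_int (l - m) * P" by (simp add: algebra_simps)
  then have "\<bar>of_int (l - m)\<bar> * P < 1 * P" using assms(2) P_pos by (simp add: abs_mult)
  then have "\<bar>of_int (l - m) :: real\<bar> < 1" using P_pos by (simp del: mult_1)
  then have "l = m" by linarith
  then show ?thesis using eq by simp
qed

lemma compact_curve: "compact (range \<gamma>)"
proof -
  have "range \<gamma> = \<gamma> ` {0..P}"
    using curve_range by (auto simp: image_iff)
  then show ?thesis using continuous_curve(1) by (metis compact_Icc compact_continuous_image)
qed

lemma curve_neq_minus: "\<gamma> x \<noteq> - \<gamma> y"
  using hemisphere by (metis inner_minus_left less_asym neg_less_0_iff_less)

context
  fixes q a :: "real^3"
  assumes q: "norm q = 1" "norm a = 1" "q \<bullet> a = 0" and off: "\<And>x. \<gamma> x \<noteq> - q"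
begin

definition stereo_path where "stereo_path t = stereo q a (\<gamma> (P * t))"

lemma stereo_path_simple: "simple_path stereo_path" "pathfinish stereo_path = pathstart stereo_path"
proof -
  have "continuous_on {0..1} stereo_path"
    unfolding stereo_path_def[abs_def]
    using off on_sphere
    by (intro continuous_on_compose2[OF continuous_on_stereo[OF q order_refl]] continuous_on_compose2[OF continuous_curve(1)[of UNIV]]
        continuous_intros) auto
  then have "path stereo_path" by (simp add: path_def)
  moreover have "loop_free stereo_path"
    unfolding loop_free_def
  proof (intro ballI impI)
    fix s t :: real
    assume st: "s \<in> {0..1}" "t \<in> {0..1}" "stereo_path s = stereo_path t"
    have eq: "\<gamma> (P * s) = \<gamma> (P * t)"
      using st(3) unstereo_stereo[OF q] on_sphere off unfolding stereo_path_def by metis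
    show "s = t \<or> s = 0 \<and> t = 1 \<or> s = 1 \<and> t = 0"
    proof (rule ccontr)
      assume n: "\<not> (s = t \<or> s = 0 \<and> t = 1 \<or> s = 1 \<and> t = 0)"
      then have "\<bar>s - t\<bar> < 1" using st by auto
      then have "P * \<bar>s - t\<bar> < P * 1" using P_pos by (intro mult_strict_left_mono) auto
      then have "\<bar>P * s - P * t\<bar> < P" using P_pos by (simp add: right_diff_distrib[symmetric] abs_mult)
      then have "P * s = P * t" using curve_eq_imp eq by blast
      then show False using n P_pos by simp
    qed
  qed
  ultimately show "simple_path stereo_path" by (simp add: simple_path_def)
  show "pathfinish stereo_path = pathstart stereo_path"
    using periodic[rule_format, of 0] by (simp add: pathfinish_def pathstart_def stereo_path_def)
qed

lemma stereo_path_image: "path_image stereo_path = stereo q a ` range \<gamma>"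
proof -
  have "(\<lambda>t. P * t) ` {0..1} = {0..P}" using P_pos
    by (simp add: image_mult_atLeastAtMost)
  moreover have "range \<gamma> = \<gamma> ` {0..P}" using curve_range by (auto simp: image_iff)
  ultimately show ?thesis
    unfolding path_image_def stereo_path_def[abs_def] by (metis (no_types, lifting) image_image image_cong)
qed

end

lemma inner_region_subset: "D \<subseteq> sphere 0 1 - range \<gamma>" "v \<in> D \<Longrightarrow> 0 < v \<bullet> e"
  using in_components_subset unfolding inner_region_def by blast+

lemma openin_inner_region: "openin (top_of_set (sphere 0 1)) D"
  unfolding inner_region_def
proof (rule openin_Union)
  fix C assume "C \<in> {C \<in> components (sphere 0 1 - range \<gamma>). C \<subseteq> {v. 0 < v \<bullet> e}}"
  then have C: "C \<in> components (sphere 0 1 - range \<gamma>)" by simp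
  have "range \<gamma> \<subseteq> sphere 0 1" using on_sphere by auto
  then have op: "openin (top_of_set (sphere 0 1)) (sphere 0 1 - range \<gamma>)"
    using compact_curve by (intro openin_diff closed_subset compact_imp_closed) auto
  then have "locally connected (sphere 0 1 - range \<gamma>)"
    using locally_open_subset locally_connected_sphere by blast
  then have "openin (top_of_set (sphere 0 1 - range \<gamma>)) C"
    using C openin_components_locally_connected by blast
  then show "openin (top_of_set (sphere 0 1)) C" using op openin_trans by blast
qed

text \<open>The convexity hypothesis speaks only of \<open>inner_region\<close>, so it has to be
  tied to the curve. In the projection centred at the pole of the hemisphere, the inside domain of
  the loop pulls back to a component within the hemisphere, and its frontier is the whole
  loop.\<close>

lemma curve_subset_closure: "range \<gamma> \<subseteq> closure D"
proof -
  have "e \<noteq> 0" using hemisphere by force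
  define q where "q = e /\<^sub>R norm e"
  have q1: "norm q = 1" using \<open>e \<noteq> 0\<close> by (simp add: q_def)
  have qe: "v \<bullet> e = norm e * (v \<bullet> q)" for v using \<open>e \<noteq> 0\<close> by (simp add: q_def)
  have hq: "0 < v \<bullet> e \<longleftrightarrow> 0 < v \<bullet> q" for v
    using \<open>e \<noteq> 0\<close> by (simp add: qe zero_less_mult_iff)
  obtain a :: "real^3" where a: "norm a = 1" "q \<bullet> a = 0" by (rule exists_orthonormal)
  note qa = q1 a
  have cq: "0 < \<gamma> x \<bullet> q" for x using hemisphere hq by simp
  have off: "\<gamma> x \<noteq> - q" for x
  proof
    assume "\<gamma> x = - q"
    then have "\<gamma> x \<bullet> q = - 1" using q1 by (simp add: norm_eq_1)
    with cq[of x] show False by simp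
  qed
  define \<sigma> where "\<sigma> = stereo q a"
  define \<rho> where "\<rho> = unstereo q a"
  have \<rho>\<sigma>: "\<rho> (\<sigma> v) = v" if "norm v = 1" "v \<noteq> - q" for v
    using unstereo_stereo[OF qa that] by (simp add: \<rho>_def \<sigma>_def)
  have \<sigma>\<rho>: "\<sigma> (\<rho> z) = z" "norm (\<rho> z) = 1" "\<rho> z \<noteq> - q" for z
    using stereo_unstereo[OF qa] norm_unstereo[OF qa] unstereo_neq[OF qa] by (simp_all add: \<rho>_def \<sigma>_def)
  have cont_\<rho>: "continuous_on S \<rho>" for S
    using continuous_on_unstereo[OF qa] by (simp add: \<rho>_def)
  define c where "c = stereo_path q a"
  define U where "U = inside (path_image c)"
  have im: "path_image c = \<sigma> ` range \<gamma>"
    unfolding c_def \<sigma>_def by (rule stereo_path_image[OF qa off])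
  have J: "U \<noteq> {}" "open U" "connected U" "bounded U" "frontier U = path_image c"
    using Jordan_inside_outside[of c] stereo_path_simple[OF qa off] unfolding c_def U_def by auto
  have disc: "norm (\<sigma> v) < 1 \<longleftrightarrow> 0 < v \<bullet> q" if "norm v = 1" "v \<noteq> - q" for v
  proof -
    have "0 < 1 + v \<bullet> q" using sphere_inner_gt_minus_1[OF qa that] .
    then have "(norm (\<sigma> v))\<^sup>2 < 1 \<longleftrightarrow> 0 < v \<bullet> q"
      unfolding \<sigma>_def norm_stereo[OF qa that] by (simp add: field_simps)
    then show ?thesis by (simp add: abs_square_less_1)
  qed
  \<comment> \<open>The unit disc is the image of the open hemisphere around \<open>q\<close>.
    Everything off a convex set containing the loop is outside the loop, so the inside domain stays
    in the disc.\<close>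
  have "path_image c \<subseteq> ball 0 1"
    unfolding im using disc on_sphere off cq by auto
  then have "- ball 0 1 \<subseteq> outside (path_image c)"
    by (intro outside_subset_convex) auto
  then have "U \<subseteq> ball 0 1" unfolding U_def inside_outside by blast
  then have hemi: "0 < \<rho> z \<bullet> q" if "z \<in> U" for z
    using that disc[of "\<rho> z"] \<sigma>\<rho>[of z] by auto
  have \<rho>c: "\<rho> ` path_image c = range \<gamma>"
    unfolding im using \<rho>\<sigma> on_sphere off by (force simp: image_image)
  have disj: "U \<inter> path_image c = {}" by (simp add: U_def inside_no_overlap)
  have V: "\<rho> ` U \<subseteq> sphere 0 1 - range \<gamma>"
  proof safe
    fix z x assume z: "z \<in> U" "\<rho> z = \<gamma> x"
    then have "z = \<sigma> (\<gamma> x)" using \<sigma>\<rho>(1)[of z] by simp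
    then show False using z disj im by auto
  qed (use \<sigma>\<rho> in auto)
  have cV: "connected (\<rho> ` U)" using cont_\<rho> J by (intro connected_continuous_image)
  obtain C where C: "C \<in> components (sphere 0 1 - range \<gamma>)" "\<rho> ` U \<subseteq> C"
    using exists_component_superset[OF V _ cV] V J by auto
  have opV: "openin (top_of_set (sphere 0 1)) (\<rho> ` U)"
  proof -
    have eq: "\<rho> ` U = (sphere 0 1 - {- q}) \<inter> \<sigma> -` U"
      using \<rho>\<sigma> \<sigma>\<rho> by (auto simp: image_iff) (metis)
    have "continuous_on (sphere 0 1 - {- q}) \<sigma>"
      unfolding \<sigma>_def by (rule continuous_on_stereo[OF qa]) auto
    then have "openin (top_of_set (sphere 0 1 - {- q})) (\<rho> ` U)"
      unfolding eq using J(2) by (rule continuous_openin_preimage_gen)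
    moreover have "openin (top_of_set (sphere 0 1)) (sphere 0 1 - {- q})"
      by (intro openin_delete) auto
    ultimately show ?thesis using openin_trans by blast
  qed
  have clV: "\<rho> ` U \<subseteq> \<rho> ` closure U" "compact (\<rho> ` closure U)" "\<rho> ` closure U \<subseteq> \<rho> ` U \<union> range \<gamma>"
  proof -
    show "\<rho> ` U \<subseteq> \<rho> ` closure U" using closure_subset by blast
    have "compact (closure U)" using J(4) by (simp add: compact_closure)
    then show "compact (\<rho> ` closure U)" using cont_\<rho> by (intro compact_continuous_image)
    show "\<rho> ` closure U \<subseteq> \<rho> ` U \<union> range \<gamma>"
      unfolding closure_Un_frontier J(5) image_Un \<rho>c ..
  qed
  have C_sub: "C \<subseteq> sphere 0 1 - range \<gamma>" using C in_components_subset by blast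
  \<comment> \<open>The image of \<open>U\<close> is open in the sphere, and its closure adds only
    points of the curve; hence it is clopen in the connected set \<open>C\<close>.\<close>
  have "C = \<rho> ` U"
  proof -
    have "connected C" using C in_components_connected by blast
    moreover have "openin (top_of_set C) (\<rho> ` U)"
      using opV C C_sub by (meson Diff_subset openin_subset_trans order_trans)
    moreover have "closedin (top_of_set C) (\<rho> ` U)"
    proof -
      have "\<rho> ` U = C \<inter> \<rho> ` closure U" using clV C C_sub by blast
      then show ?thesis using compact_imp_closed[OF clV(2)] by (metis closedin_closed)
    qed
    ultimately show ?thesis using connected_clopen J by (metis image_is_empty)
  qed
  then have "C \<subseteq> {v. 0 < v \<bullet> e}" using hemi by (auto simp: hq)
  then have "\<rho> ` U \<subseteq> D" using C unfolding inner_region_def by blast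
  have "range \<gamma> \<subseteq> \<rho> ` closure U"
    unfolding \<rho>c[symmetric] J(5)[symmetric] by (auto simp: frontier_def)
  also have "\<dots> \<subseteq> closure (\<rho> ` U)"
    using cont_\<rho>[of "closure U"] by (intro image_closure_subset closure_subset) auto
  also have "\<dots> \<subseteq> closure D" using \<open>\<rho> ` U \<subseteq> D\<close> by (rule closure_mono)
  finally show ?thesis .
qed

text \<open>Points of great circle arcs arise as unit positive combinations of the ends, not as
  normalised convex ones; the parameter t / (s + t) converts one form into the other.\<close>

lemma inner_region_comb:
  assumes "p \<in> closure D" "r \<in> closure D" "p \<noteq> r" "0 < s" "0 < t" "v = s *\<^sub>R p + t *\<^sub>R r" "norm v = 1"
  shows "v \<in> D"
proof -
  let ?u = "t / (s + t)"
  have u: "0 < ?u" "?u < 1" using assms by auto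
  have "(1 - ?u) *\<^sub>R p + ?u *\<^sub>R r = (1 / (s + t)) *\<^sub>R v"
    using assms by (simp add: scaleR_add_right field_simps)
  moreover have "norm ((1 / (s + t)) *\<^sub>R v) = 1 / (s + t)" using assms by simp
  ultimately have "(1 / norm ((1 - ?u) *\<^sub>R p + ?u *\<^sub>R r)) *\<^sub>R ((1 - ?u) *\<^sub>R p + ?u *\<^sub>R r) = v"
    using assms by simp
  then show ?thesis
    using strictly_convex assms u unfolding sph_strictly_convex_def by metis
qed

lemma curve_in_closure: "\<gamma> x \<in> closure D" using curve_subset_closure by auto

lemma closure_inner_nonneg: "v \<in> closure D \<Longrightarrow> 0 \<le> v \<bullet> e"
proof -
  assume "v \<in> closure D"
  moreover have "closure D \<subseteq> {v. 0 \<le> v \<bullet> e}"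
    using inner_region_subset(2) by (intro closure_minimal) (auto simp: less_imp_le closed_halfspace_component_ge intro!: closed_Collect_le continuous_intros)
  ultimately show ?thesis by auto
qed

text \<open>If a point of the closed region were strictly below the tangent great circle at
  \<open>\<gamma> x\<close>, then \<open>\<gamma> x\<close> would be a positive combination of it and two nearby points of the
  curve, hence an interior point of the region.\<close>

lemma closure_inner_region_nu_nonneg:
  assumes r: "r \<in> closure D"
  shows "0 \<le> r \<bullet> nu x"
proof (rule ccontr)
  assume neg: "\<not> 0 \<le> r \<bullet> nu x"
  define h where "h y = \<gamma> y \<bullet> nu x" for y
  define g where "g y = \<gamma> y \<bullet> \<tau> x" for y
  have h': "(h has_real_derivative \<tau> y \<bullet> nu x) (at y)" for y
    unfolding h_def by (rule curve_inner_deriv)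
  have g': "(g has_real_derivative \<tau> y \<bullet> \<tau> x) (at y)" for y
    unfolding g_def by (rule curve_inner_deriv)
  have h'': "((\<lambda>y. \<tau> y \<bullet> nu x) has_real_derivative k x) (at x)"
    using tang_inner_deriv[of "nu x" x] by (simp add: nu_facts)
  have h0: "h x = 0" and g0: "g x = 0" by (simp_all add: h_def g_def nu_facts curve_tang)
  obtain d1 where d1: "0 < d1" "\<And>s. 0 < s \<Longrightarrow> s < d1 \<Longrightarrow> 0 < \<tau> (x + s) \<bullet> nu x"
    using DERIV_pos_inc_right[OF h''] curv_pos by (auto simp: nu_facts)
  obtain d2 where d2: "0 < d2" "\<And>s. 0 < s \<Longrightarrow> s < d2 \<Longrightarrow> \<tau> (x - s) \<bullet> nu x < 0"
    using DERIV_pos_inc_left[OF h''] curv_pos by (auto simp: nu_facts)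
  have hpos1: "0 < h (x + s)" if s: "0 < s" "s < d1" for s
  proof -
    obtain z where "x < z" "z < x + s" "h (x + s) - h x = (x + s - x) * (\<tau> z \<bullet> nu x)"
      using MVT2[of x "x + s" h "\<lambda>y. \<tau> y \<bullet> nu x"] h' s by auto
    then show ?thesis using d1(2)[of "z - x"] s h0 by auto
  qed
  have hpos2: "0 < h (x - s)" if s: "0 < s" "s < d2" for s
  proof -
    obtain z where "x - s < z" "z < x" "h x - h (x - s) = (x - (x - s)) * (\<tau> z \<bullet> nu x)"
      using MVT2[of "x - s" x h "\<lambda>y. \<tau> y \<bullet> nu x"] h' s by auto
    moreover have "s * (\<tau> z \<bullet> nu x) < 0"
      using d2(2)[of "x - z"] s calculation by (intro mult_pos_neg) auto
    ultimately show ?thesis using h0 by simp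
  qed
  \<comment> \<open>The tangential coordinate \<open>g\<close> is of first order in
    \<open>y - x\<close> and the height \<open>h\<close> of second order, so nearby points are
    arbitrarily low compared with their horizontal distance.\<close>
  have gl: "((\<lambda>y. (g y - g x) / (y - x)) \<longlongrightarrow> 1) (at x)"
    using g'[of x] unfolding has_field_derivative_iff by (simp add: inner_curve_self)
  have hl: "((\<lambda>y. (h y - h x) / (y - x)) \<longlongrightarrow> 0) (at x)"
    using h'[of x] unfolding has_field_derivative_iff by (simp add: nu_facts)
  \<comment> \<open>\<open>B\<close> exceeds the tangential coordinate of \<open>r\<close> in
    modulus, which is what makes \<open>l1\<close> and \<open>l2\<close> positive further
    down.\<close>
  define B where "B = \<bar>r \<bullet> \<tau> x\<bar> + 1"
  have l: "((\<lambda>y. - (r \<bullet> nu x) * ((g y - g x) / (y - x)) - B * \<bar>(h y - h x) / (y - x)\<bar>) \<longlongrightarrow>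
      - (r \<bullet> nu x) * 1 - B * \<bar>0\<bar>) (at x)"
    by (intro tendsto_intros gl hl)
  have "\<forall>\<^sub>F y in at x. 0 < - (r \<bullet> nu x) * ((g y - g x) / (y - x)) - B * \<bar>(h y - h x) / (y - x)\<bar>"
    using neg by (intro order_tendstoD(1)[OF l]) auto
  then obtain d3 where d3: "0 < d3" "\<And>y. y \<noteq> x \<Longrightarrow> dist y x < d3 \<Longrightarrow>
      0 < - (r \<bullet> nu x) * (g y / (y - x)) - B * \<bar>h y / (y - x)\<bar>"
    unfolding eventually_at by (auto simp: h0 g0)
  \<comment> \<open>Dividing by 3 gives \<open>2 * s < P\<close>, so the two neighbours of
    \<open>x\<close> are distinct points of the curve.\<close>
  define s where "s = Min {d1, d2, d3, P} / 3"
  have s: "0 < s" "s < d1" "s < d2" "s < d3" "2 * s < P"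
    using d1(1) d2(1) d3(1) P_pos by (auto simp: s_def min_def divide_simps)
  define a1 a2 b1 b2 where "a1 = g (x + s)" and "a2 = h (x + s)" and "b1 = g (x - s)" and "b2 = h (x - s)"
  have a2: "0 < a2" and b2: "0 < b2" using hpos1 hpos2 s by (auto simp: a2_def b2_def)
  define R where "R = - (r \<bullet> nu x)"
  define r1 where "r1 = r \<bullet> \<tau> x"
  have R: "0 < R" using neg by (simp add: R_def)
  have B: "0 < B" "\<bar>r1\<bar> < B" by (auto simp: B_def r1_def)
  have A: "B * a2 < R * a1"
    using d3(2)[of "x + s"] s a2 by (simp add: dist_real_def a1_def a2_def R_def field_simps)
  have A': "B * b2 < R * (- b1)"
    using d3(2)[of "x - s"] s b2 by (simp add: dist_real_def b1_def b2_def R_def field_simps)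
  have a1: "0 < a1" using A a2 B R by (meson less_trans mult_pos_pos zero_less_mult_pos)
  have b1: "b1 < 0" using A' b2 B R by (meson less_trans mult_pos_pos zero_less_mult_pos neg_0_less_iff_less)
  define det where "det = a1 * b2 - b1 * a2"
  have det: "0 < det" using a1 a2 b1 b2 unfolding det_def
    by (smt (verit) mult_pos_pos mult_neg_pos)
  \<comment> \<open>Cramer's rule: with these coefficients the tangential and normal coordinates of
    \<open>w + r\<close> vanish. So \<open>w + r\<close> is a multiple of \<open>\<gamma> x\<close>,
    and the multiple is positive because both sides have positive product with
    \<open>e\<close>.\<close>
  define l1 where "l1 = (- r1 * b2 - R * b1) / det"
  define l2 where "l2 = (R * a1 + r1 * a2) / det"
  have "r1 * b2 < B * b2" "- r1 * a2 < B * a2"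
    using B(2) a2 b2 by (intro mult_strict_right_mono; linarith)+
  then have l1: "0 < l1" and l2: "0 < l2"
    using A A' det by (auto simp: l1_def l2_def)
  have e1: "l1 * a1 + l2 * b1 + r1 = 0" and e2: "l1 * a2 + l2 * b2 - R = 0"
    unfolding l1_def l2_def using det by (simp_all add: field_simps) (simp_all add: det_def algebra_simps)
  define w where "w = l1 *\<^sub>R \<gamma> (x + s) + l2 *\<^sub>R \<gamma> (x - s)"
  have "(w + r) \<bullet> \<tau> x = 0" "(w + r) \<bullet> nu x = 0"
    using e1 e2 by (simp_all add: w_def inner_add_left a1_def a2_def b1_def b2_def g_def h_def r1_def R_def)
  then have wr: "w + r = ((w + r) \<bullet> \<gamma> x) *\<^sub>R \<gamma> x"
    using frame_expand[of "w + r" x] by simp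
  define c where "c = (w + r) \<bullet> \<gamma> x"
  have we: "0 < w \<bullet> e" using l1 l2 hemisphere by (simp add: w_def inner_add_left add_pos_pos)
  have "(w + r) \<bullet> e = c * (\<gamma> x \<bullet> e)" using wr by (metis c_def inner_scaleR_left)
  moreover have "0 < (w + r) \<bullet> e" using we closure_inner_nonneg[OF r] by (simp add: inner_add_left)
  ultimately have c: "0 < c" using hemisphere by (metis zero_less_mult_pos2)
  have w0: "w \<noteq> 0" using we by auto
  have ne: "\<gamma> (x + s) \<noteq> \<gamma> (x - s)" using curve_eq_imp[of "x + s" "x - s"] s by auto
  have wD: "(1 / norm w) *\<^sub>R w \<in> D"
  proof -
    have n: "norm ((1 / norm w) *\<^sub>R w) = 1" using w0 by simp
    have eq: "(1 / norm w) *\<^sub>R w = (l1 / norm w) *\<^sub>R \<gamma> (x + s) + (l2 / norm w) *\<^sub>R \<gamma> (x - s)"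
      by (simp add: w_def scaleR_add_right)
    show ?thesis
      using w0 l1 l2 by (intro inner_region_comb[OF curve_in_closure curve_in_closure ne _ _ eq n]) auto
  qed
  show False
  \<comment> \<open>Strict convexity concerns distinct points only. If the two coincide, the heights
    of \<open>w\<close> and \<open>r\<close> have the same sign, although they add up to 0 and that
    of \<open>r\<close> is negative.\<close>
  proof (cases "(1 / norm w) *\<^sub>R w = r")
    case True
    then have "w = norm w *\<^sub>R r" using w0 by auto
    then have "0 < w \<bullet> nu x \<Longrightarrow> 0 < r \<bullet> nu x" by (metis inner_scaleR_left norm_ge_zero zero_less_mult_pos2 mult_nonneg_nonpos not_less)
    moreover have "0 < w \<bullet> nu x" using \<open>(w + r) \<bullet> nu x = 0\<close> neg by (simp add: inner_add_left)
    ultimately show False using neg by simp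
  next
    case False
    have gx: "\<gamma> x = (norm w / c) *\<^sub>R ((1 / norm w) *\<^sub>R w) + (1 / c) *\<^sub>R r"
    proof -
      have "\<gamma> x = (1 / c) *\<^sub>R (w + r)" using wr c by (simp add: c_def[symmetric])
      then show ?thesis using w0 by (simp add: scaleR_add_right)
    qed
    have "(1 / norm w) *\<^sub>R w \<in> closure D" using wD closure_subset by blast
    then have "\<gamma> x \<in> D"
      using c w0 on_sphere by (intro inner_region_comb[OF _ r False _ _ gx]) auto
    then show False using inner_region_subset by auto
  qed
qed

text \<open>\<open>D\<close> is open in the sphere, so a point on the tangent great circle could be
  pushed strictly below it without leaving \<open>D\<close>.\<close>

lemma inner_region_nu_pos:
  assumes v: "v \<in> D"
  shows "0 < v \<bullet> nu x"
proof (rule ccontr)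
  assume "\<not> 0 < v \<bullet> nu x"
  then have v0: "v \<bullet> nu x = 0" using closure_inner_region_nu_nonneg[of v x] v closure_subset by force
  have v1: "norm v = 1" using v inner_region_subset by auto
  obtain T where T: "open T" "D = sphere 0 1 \<inter> T"
    using openin_inner_region by (auto simp: openin_open)
  define f where "f t = (1 / norm (v - t *\<^sub>R nu x)) *\<^sub>R (v - t *\<^sub>R nu x)" for t :: real
  have nz: "v - t *\<^sub>R nu x \<noteq> 0" for t
  proof
    assume *: "v - t *\<^sub>R nu x = 0"
    then have "(v - t *\<^sub>R nu x) \<bullet> nu x = 0" by simp
    then have "t = 0" using v0 by (simp add: inner_diff_left nu_facts)
    then show False using * v1 by auto
  qed
  have "continuous (at 0) f" unfolding f_def[abs_def] using nz[of 0]
    by (intro continuous_intros) auto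
  then have "(f \<longlongrightarrow> f 0) (at 0)" by (simp add: isCont_def)
  moreover have "f 0 = v" using v1 by (simp add: f_def)
  ultimately have "\<forall>\<^sub>F t in at 0. f t \<in> T" using T v by (intro topological_tendstoD) auto
  then obtain d where d: "0 < d" "\<And>t. t \<noteq> 0 \<Longrightarrow> dist t 0 < d \<Longrightarrow> f t \<in> T"
    unfolding eventually_at by auto
  have "f (d / 2) \<in> D" using d T nz[of "d / 2"] by (auto simp: f_def)
  then have "0 \<le> f (d / 2) \<bullet> nu x" using closure_inner_region_nu_nonneg closure_subset by blast
  moreover have "f (d / 2) \<bullet> nu x = - (d / 2) / norm (v - (d / 2) *\<^sub>R nu x)"
    using v0 by (simp add: f_def inner_diff_left nu_facts)
  moreover have "- (d / 2) / norm (v - (d / 2) *\<^sub>R nu x) < 0"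
    using d nz[of "d / 2"] by (simp add: divide_neg_pos)
  ultimately show False by simp
qed

text \<open>The midpoint of the chord lies in \<open>D\<close>, and \<open>\<gamma> x\<close>
  contributes nothing to its height over the tangent at \<open>x\<close>. This inequality keeps all
  chord angles strictly between 0 and pi.\<close>

lemma curve_nu_pos:
  assumes "\<gamma> y \<noteq> \<gamma> x"
  shows "0 < \<gamma> y \<bullet> nu x"
proof -
  define w where "w = \<gamma> x + \<gamma> y"
  have "w \<noteq> 0" using curve_neq_minus[of x y] by (simp add: w_def eq_neg_iff_add_eq_0)
  then have n: "norm ((1 / norm w) *\<^sub>R w) = 1" by simp
  have eq: "(1 / norm w) *\<^sub>R w = (1 / norm w) *\<^sub>R \<gamma> x + (1 / norm w) *\<^sub>R \<gamma> y"
    by (simp add: w_def scaleR_add_right)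
  have "(1 / norm w) *\<^sub>R w \<in> D"
    using assms \<open>w \<noteq> 0\<close>
    by (intro inner_region_comb[OF curve_in_closure curve_in_closure _ _ _ eq n]) auto
  then have "0 < (1 / norm w) *\<^sub>R w \<bullet> nu x" by (rule inner_region_nu_pos)
  then have "0 < w \<bullet> nu x" using \<open>w \<noteq> 0\<close> by (simp add: zero_less_divide_iff)
  then show ?thesis by (simp add: w_def inner_add_left nu_facts)
qed

text \<open>Project from \<open>- v\<close>, so that \<open>v\<close> goes to 0. The integrand is
  the rate at which the argument of the projected curve turns, hence the integral is 2 pi times a
  winding number. Both \<open>v\<close> and \<open>- v\<close> must be off the curve: one is the
  centre, the other the point at infinity.\<close>

lemma winding_integral_le:
  assumes v: "norm v = 1" and off: "\<And>x. \<gamma> x \<noteq> v" "\<And>x. \<gamma> x \<noteq> - v"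
  shows "\<exists>I. ((\<lambda>x. (v \<bullet> nu x) / (1 - (v \<bullet> \<gamma> x)\<^sup>2)) has_integral I) {0..P} \<and> \<bar>I\<bar> \<le> 2 * pi"
proof -
  obtain a :: "real^3" where a: "norm a = 1" "v \<bullet> a = 0" by (rule exists_orthonormal)
  note va = v a
  define b where "b = cross3 v a"
  define X Y d where "X x = \<gamma> x \<bullet> a" and "Y x = \<gamma> x \<bullet> b" and "d x = 1 + \<gamma> x \<bullet> v" for x
  define X' Y' d' where "X' x = \<tau> x \<bullet> a" and "Y' x = \<tau> x \<bullet> b" and "d' x = \<tau> x \<bullet> v" for x
  have der: "(X has_real_derivative X' x) (at x)" "(Y has_real_derivative Y' x) (at x)"
    "(d has_real_derivative d' x) (at x)" for x
    unfolding X_def[abs_def] Y_def[abs_def] d_def[abs_def] X'_def Y'_def d'_def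
    using curve_inner_deriv by (auto intro!: derivative_eq_intros)
  have dpos: "0 < d x" for x
    unfolding d_def using sphere_inner_gt_minus_1[OF va] on_sphere off by blast
  have XY: "(X x)\<^sup>2 + (Y x)\<^sup>2 = 1 - (v \<bullet> \<gamma> x)\<^sup>2" for x
    using orthonormal_inner[OF va, of "\<gamma> x" "\<gamma> x"]
    by (simp add: inner_curve_self X_def Y_def b_def power2_eq_square inner_commute)
  have XYpos: "0 < (X x)\<^sup>2 + (Y x)\<^sup>2" for x
  proof (rule ccontr)
    assume "\<not> 0 < (X x)\<^sup>2 + (Y x)\<^sup>2"
    then have "X x = 0" "Y x = 0" by (auto simp: not_less sum_power2_le_zero_iff)
    then have *: "\<gamma> x = (\<gamma> x \<bullet> v) *\<^sub>R v"
      using orthonormal_expand[OF va, of "\<gamma> x"] by (simp add: X_def Y_def b_def)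
    moreover have "(\<gamma> x \<bullet> v)\<^sup>2 = 1" using XY[of x] \<open>X x = 0\<close> \<open>Y x = 0\<close> by (simp add: inner_commute)
    ultimately show False using off[of x] by (auto simp: power2_eq_1_iff)
  qed
  have XY': "X x * Y' x - Y x * X' x = v \<bullet> nu x" for x
    using orthonormal_cross_inner[OF va, of "\<gamma> x" "\<tau> x"]
    by (simp add: nu_def X_def Y_def X'_def Y'_def b_def inner_commute)
  define z where "z x = (1 / d x) *\<^sub>R Complex (X x) (Y x)" for x
  define z' where "z' x = (1 / d x) *\<^sub>R Complex (X' x) (Y' x) + (- d' x / (d x)\<^sup>2) *\<^sub>R Complex (X x) (Y x)" for x
  have z: "(z has_vector_derivative z' x) (at x)" for x
  proof -
    have "((\<lambda>x. 1 / d x) has_real_derivative (- d' x / (d x)\<^sup>2)) (at x)"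
      using dpos[of x] by (auto intro!: derivative_eq_intros der simp: power2_eq_square)
    then show ?thesis
      unfolding z_def[abs_def] z'_def
      by (intro has_vector_derivative_scaleR has_vector_derivative_Complex der)
  qed
  define c where "c = stereo_path v a"
  have c: "c = (\<lambda>t. z (P * t))"
    by (simp add: c_def stereo_path_def[OF va off(2)] fun_eq_iff z_def stereo_def d_def X_def Y_def b_def)
  have c': "(c has_vector_derivative P *\<^sub>R z' (P * t)) (at t)" for t
  proof -
    have "((\<lambda>t. P * t) has_vector_derivative P) (at t)"
      by (auto intro!: derivative_eq_intros)
    from vector_diff_chain_at[OF this, of z "z' (P * t)"] show ?thesis
      using z unfolding c by (simp add: o_def)
  qed
  have cont: "continuous_on UNIV X" "continuous_on UNIV Y" "continuous_on UNIV d"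
    "continuous_on UNIV X'" "continuous_on UNIV Y'" "continuous_on UNIV d'"
    using continuous_curve(1,2)[of UNIV]
    by (simp_all add: X_def[abs_def] Y_def[abs_def] d_def[abs_def] X'_def[abs_def] Y'_def[abs_def] d'_def[abs_def]
        continuous_on_inner continuous_on_add)
  have d0: "d x \<noteq> 0" for x using dpos[of x] by simp
  have "continuous_on UNIV z'"
    unfolding z'_def[abs_def] Complex_eq
    by (intro continuous_intros cont) (simp_all add: d0)
  then have "continuous_on {0..1} (\<lambda>t. z' (P * t))"
    by (rule continuous_on_compose2) (auto intro!: continuous_on_mult continuous_on_const continuous_on_id)
  then have "continuous_on {0..1} (\<lambda>t. P *\<^sub>R z' (P * t))"
    by (intro continuous_on_scaleR continuous_on_const)
  then have "c C1_differentiable_on {0..1}"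
    unfolding C1_differentiable_on_def by (intro exI[of _ "\<lambda>t. P *\<^sub>R z' (P * t)"] conjI ballI c')
  then have vp: "valid_path c" by (simp add: valid_path_def C1_differentiable_imp_piecewise)
  have z0: "z x \<noteq> 0" for x
    using XYpos[of x] dpos[of x] by (auto simp: z_def complex_eq_iff)
  have c0: "0 \<notin> path_image c" using z0 by (auto simp: path_image_def c)
  have "simple_path c" "pathfinish c = pathstart c"
    unfolding c_def using stereo_path_simple[OF va off(2)] by auto
  \<comment> \<open>For a simple loop the winding number is at most 1 in modulus for either
    orientation and on either side.\<close>
  then have w: "winding_number c 0 \<in> {-1, 0, 1}"
    using simple_closed_path_winding_number_cases c0 by blast
  define W where "W = Re (winding_number c 0)"
  have W: "\<bar>W\<bar> \<le> 1" "winding_number c 0 = of_real W"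
    using w by (auto simp: W_def)
  have "((\<lambda>w. 1 / (w - 0)) has_contour_integral (2 * pi * \<i> * winding_number c 0)) c"
    using winding_number_valid_path[OF vp c0] contour_integrable_inversediff[OF vp c0]
    by (simp add: has_contour_integral_integral)
  then have "((\<lambda>t. 1 / c t * vector_derivative c (at t)) has_integral (2 * pi * \<i> * W)) {0..1}"
    unfolding has_contour_integral W(2) by simp
  from has_integral_linear[OF this bounded_linear_Im]
  have "((\<lambda>t. Im (1 / c t * vector_derivative c (at t))) has_integral Im (2 * pi * \<i> * W)) {0..1}"
    unfolding o_def .
  moreover have "Im (1 / c t * vector_derivative c (at t)) = P * ((v \<bullet> nu (P * t)) / (1 - (v \<bullet> \<gamma> (P * t))\<^sup>2))" for t
  proof -
    let ?x = "P * t"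
    let ?u = "Complex (X ?x) (Y ?x)" and ?u' = "Complex (X' ?x) (Y' ?x)"
    have u0: "?u \<noteq> 0" using XYpos[of ?x] by (auto simp: complex_eq_iff)
    \<comment> \<open>The real factor 1 / d only adds a real number to the logarithmic derivative,
      which disappears in the imaginary part.\<close>
    have "1 / z ?x * z' ?x = ?u' / ?u + of_real (- d' ?x / d ?x)"
      using dpos[of ?x] u0 unfolding z_def z'_def scaleR_conv_of_real
      by (simp add: field_simps power2_eq_square)
    then have "Im (1 / z ?x * z' ?x) = (X ?x * Y' ?x - Y ?x * X' ?x) / ((X ?x)\<^sup>2 + (Y ?x)\<^sup>2)"
      by (simp add: Im_divide mult.commute)
    moreover have "1 / z ?x * (P *\<^sub>R z' ?x) = P *\<^sub>R (1 / z ?x * z' ?x)" by simp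
    ultimately have "Im (1 / z ?x * (P *\<^sub>R z' ?x)) = P * ((X ?x * Y' ?x - Y ?x * X' ?x) / ((X ?x)\<^sup>2 + (Y ?x)\<^sup>2))"
      by (simp only: scaleR_complex.sel)
    then show ?thesis
      using c'[of t] unfolding XY XY' c by (simp add: vector_derivative_at)
  qed
  ultimately have 1: "((\<lambda>t. P * ((v \<bullet> nu (P * t)) / (1 - (v \<bullet> \<gamma> (P * t))\<^sup>2))) has_integral (2 * pi * W)) {0..1}"
    by simp
  have im: "(\<lambda>x. x / (1 / P)) ` {0..1} = {0..P}"
  proof -
    have h: "(\<lambda>x. x / (1 / P)) = (\<lambda>x. P * x)" by (simp add: fun_eq_iff)
    show ?thesis unfolding h using P_pos by (simp add: image_mult_atLeastAtMost)
  qed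
  have "((\<lambda>x. P * ((v \<bullet> nu (P * (1 / P * x))) / (1 - (v \<bullet> \<gamma> (P * (1 / P * x)))\<^sup>2)))
      has_integral (1 / \<bar>1 / P\<bar>) *\<^sub>R (2 * pi * W)) {0..P}"
    using has_integral_stretch_real[OF 1, of "1 / P"] P_pos unfolding im by auto
  then have "((\<lambda>x. P * ((v \<bullet> nu x) / (1 - (v \<bullet> \<gamma> x)\<^sup>2))) has_integral P * (2 * pi * W)) {0..P}"
    using P_pos by simp
  from has_integral_mult_right[OF this, of "1 / P"]
  have "((\<lambda>x. (v \<bullet> nu x) / (1 - (v \<bullet> \<gamma> x)\<^sup>2)) has_integral (2 * pi * W)) {0..P}"
    using P_pos by simp
  moreover have "\<bar>2 * pi * W\<bar> \<le> 2 * pi" using W(1) by (simp add: abs_mult)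
  ultimately show ?thesis by blast
qed

section \<open>Chords and the billiard map\<close>

text \<open>For a chord from \<open>\<gamma> x\<close> to \<open>\<gamma> y\<close> of length \<open>L\<close>, \<open>cosL\<close> and \<open>sinL\<close> are the cosine and sine
  of \<open>L\<close>, \<open>ang x y\<close> is the angle \<open>\<phi>\<close> at which it leaves \<open>\<gamma> x\<close>, and the angle \<open>\<psi>\<close> after reflection
  at \<open>\<gamma> y\<close> is \<open>pi - ang y x\<close>.\<close>

definition cosL where "cosL x y = \<gamma> x \<bullet> \<gamma> y"
definition sinL where "sinL x y = sqrt (1 - (cosL x y)\<^sup>2)"
definition tcomp where "tcomp x y = \<gamma> y \<bullet> \<tau> x"
definition ncomp where "ncomp x y = \<gamma> y \<bullet> nu x"
definition ang where "ang x y = pi / 2 - arctan (tcomp x y / ncomp x y)"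

lemma periodic_comps:
  "cosL x (y + P) = cosL x y" "sinL x (y + P) = sinL x y" "tcomp x (y + P) = tcomp x y"
  "ncomp x (y + P) = ncomp x y" "ang x (y + P) = ang x y"
  "cosL (x + P) y = cosL x y" "sinL (x + P) y = sinL x y" "tcomp (x + P) y = tcomp x y"
  "ncomp (x + P) y = ncomp x y" "ang (x + P) y = ang x y"
  by (simp_all add: cosL_def sinL_def tcomp_def ncomp_def ang_def periodic tang_periodic nu_periodic)

lemma L_sym: "cosL x y = cosL y x" "sinL x y = sinL y x"
  by (simp_all add: cosL_def sinL_def inner_commute)

lemma curve_neq: "x < y \<Longrightarrow> y < x + P \<Longrightarrow> \<gamma> x \<noteq> \<gamma> y"
  using curve_eq_imp[of x y] by auto

lemma nu_deriv: "(nu has_vector_derivative (- k x *\<^sub>R \<tau> x)) (at x)"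
proof -
  have "cross3 (\<gamma> x) (nu x) = - \<tau> x"
    using orthonormal_cross(5)[OF frame, of x] unfolding nu_def[symmetric] by (metis cross_skew)
  then have calc: "cross3 (\<gamma> x) (- \<gamma> x + k x *\<^sub>R nu x) + cross3 (\<tau> x) (\<tau> x) = - k x *\<^sub>R \<tau> x"
    by (simp only: cross_add_right cross_mult_right cross_minus_right cross_refl) simp
  have "bounded_bilinear (cross3 :: real^3 \<Rightarrow> real^3 \<Rightarrow> real^3)"
    using bilinear_conv_bounded_bilinear bilinear_cross by blast
  note bb = bounded_bilinear.has_vector_derivative[OF this curve_deriv tang_deriv]
  have "((\<lambda>x. cross3 (\<gamma> x) (\<tau> x)) has_vector_derivative - k x *\<^sub>R \<tau> x) (at x)"
    using bb[of x] unfolding calc .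
  then show ?thesis by (simp add: nu_def[abs_def])
qed

lemma nu_inner_deriv: "((\<lambda>y. nu y \<bullet> w) has_real_derivative (- k y * (\<tau> y \<bullet> w))) (at y)"
  using bounded_linear.has_vector_derivative[OF bounded_linear_inner_left nu_deriv, of w y]
  by (simp add: has_real_derivative_iff_has_vector_derivative)

context
  fixes x y assumes neq: "\<gamma> x \<noteq> \<gamma> y"
begin

lemma cosL_bounds: "- 1 < cosL x y" "cosL x y < 1"
proof -
  have "\<bar>cosL x y\<bar> \<le> 1"
    using Cauchy_Schwarz_ineq2[of "\<gamma> x" "\<gamma> y"] on_sphere by (simp add: cosL_def)
  moreover have "cosL x y \<noteq> 1"
  proof
    assume "cosL x y = 1"
    then have "(norm (\<gamma> x - \<gamma> y))\<^sup>2 = 0"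
      by (simp add: power2_norm_eq_inner inner_diff_left inner_diff_right inner_curve_self cosL_def inner_commute)
    then show False using neq by simp
  qed
  moreover have "cosL x y \<noteq> - 1"
  proof
    assume "cosL x y = - 1"
    then have "(norm (\<gamma> x + \<gamma> y))\<^sup>2 = 0"
      by (simp add: power2_norm_eq_inner inner_add_left inner_add_right inner_curve_self cosL_def inner_commute)
    then show False using curve_neq_minus[of x y] by (simp add: eq_neg_iff_add_eq_0)
  qed
  ultimately show "- 1 < cosL x y" "cosL x y < 1" by auto
qed

lemma sinL_pos: "0 < sinL x y" and sinL_sq: "(sinL x y)\<^sup>2 = 1 - (cosL x y)\<^sup>2"
  using cosL_bounds unfolding sinL_def by (auto simp: power2_less_1_iff abs_square_less_1[symmetric] abs_less_iff less_imp_le)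

lemma comps_sq: "(tcomp x y)\<^sup>2 + (ncomp x y)\<^sup>2 = (sinL x y)\<^sup>2"
  using frame_inner[of "\<gamma> y" "\<gamma> y" x] unfolding sinL_sq
  by (simp add: tcomp_def ncomp_def cosL_def inner_curve_self power2_eq_square inner_commute)

lemma ncomp_pos: "0 < ncomp x y"
  unfolding ncomp_def using curve_nu_pos neq by metis

lemma sqrt_ratio: "sqrt (1 + (tcomp x y / ncomp x y)\<^sup>2) = sinL x y / ncomp x y"
proof -
  have "1 + (tcomp x y / ncomp x y)\<^sup>2 = (sinL x y / ncomp x y)\<^sup>2"
    using ncomp_pos by (simp add: power_divide comps_sq[symmetric] field_simps)
  then show ?thesis using ncomp_pos sinL_pos by (simp add: less_imp_le)
qed

lemma ang_bounds: "0 < ang x y" "ang x y < pi"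
  unfolding ang_def using arctan_bounded[of "tcomp x y / ncomp x y"] by auto

lemma cos_ang: "cos (ang x y) = tcomp x y / sinL x y"
  unfolding ang_def cos_diff using ncomp_pos sinL_pos by (simp add: sin_arctan sqrt_ratio)

lemma sin_ang: "sin (ang x y) = ncomp x y / sinL x y"
  unfolding ang_def sin_diff using ncomp_pos sinL_pos by (simp add: cos_arctan sqrt_ratio)

text \<open>The Wronskian of the two components is, up to sign, the triple product of
  \<open>\<gamma> x\<close>, \<open>\<gamma> y\<close> and \<open>\<tau> y\<close>, which is the
  normal component seen from the other end of the chord.\<close>

lemma ratio_deriv:
  "((\<lambda>y. tcomp x y / ncomp x y) has_real_derivative - (ncomp y x / (ncomp x y)\<^sup>2)) (at y)"
proof -
  have "ncomp y x = tcomp x y * (\<tau> y \<bullet> nu x) - ncomp x y * (\<tau> y \<bullet> \<tau> x)"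
    using orthonormal_cross_inner[OF frame, of "\<gamma> y" "\<tau> y" x]
    by (simp add: ncomp_def tcomp_def nu_def inner_commute)
  then have "((\<tau> y \<bullet> \<tau> x) * ncomp x y - tcomp x y * (\<tau> y \<bullet> nu x)) / (ncomp x y * ncomp x y) = - (ncomp y x / (ncomp x y)\<^sup>2)"
    by (simp add: power2_eq_square minus_divide_left mult.commute)
  moreover have d: "((\<lambda>y. tcomp x y) has_real_derivative \<tau> y \<bullet> \<tau> x) (at y)"
    "((\<lambda>y. ncomp x y) has_real_derivative \<tau> y \<bullet> nu x) (at y)"
    unfolding tcomp_def ncomp_def by (rule curve_inner_deriv)+
  ultimately show ?thesis using DERIV_divide[OF d] ncomp_pos by (simp only: less_imp_neq[symmetric] not_False_eq_True)
qed

lemma ang_deriv2: "((\<lambda>y. ang x y) has_real_derivative ncomp y x / (sinL x y)\<^sup>2) (at y)"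
proof -
  have "ncomp y x / (ncomp x y)\<^sup>2 / (1 + (tcomp x y / ncomp x y)\<^sup>2) = ncomp y x / (sinL x y)\<^sup>2"
  proof -
    have "1 + (tcomp x y / ncomp x y)\<^sup>2 = (sinL x y)\<^sup>2 / (ncomp x y)\<^sup>2"
      using ncomp_pos by (simp add: power_divide comps_sq[symmetric] field_simps)
    then show ?thesis using ncomp_pos by simp
  qed
  then show ?thesis
    unfolding ang_def
    by (intro DERIV_cong[OF DERIV_diff[OF DERIV_const DERIV_chain2[OF DERIV_arctan ratio_deriv]]])
      (simp add: divide_inverse mult.commute)
qed

end

text \<open>The tangent at the moving end turns at rate \<open>k y\<close>; the rest of the
  derivative is the turning of the chord there, sin psi times cot L. Subtracted from the derivative
  of \<open>ang x y\<close>, this isolates the curvature for Gauss-Bonnet.\<close>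

lemma ang_deriv1:
  assumes neq: "\<gamma> x \<noteq> \<gamma> y"
  shows "((\<lambda>y. ang y x) has_real_derivative - (k y - ncomp y x * cosL x y / (sinL x y)\<^sup>2)) (at y)"
proof -
  note n = neq[symmetric]
  have t: "((\<lambda>y. tcomp y x) has_real_derivative (- cosL x y + k y * ncomp y x)) (at y)"
    using tang_inner_deriv[of "\<gamma> x" y] by (simp add: tcomp_def[abs_def] ncomp_def cosL_def inner_commute)
  have nn: "((\<lambda>y. ncomp y x) has_real_derivative (- k y * tcomp y x)) (at y)"
    using nu_inner_deriv[of "\<gamma> x" y] by (simp add: tcomp_def[abs_def] ncomp_def cosL_def inner_commute)
  have N: "ncomp y x \<noteq> 0" using ncomp_pos[OF n] by simp
  have S: "(tcomp y x)\<^sup>2 = (sinL x y)\<^sup>2 - (ncomp y x)\<^sup>2" using comps_sq[OF n] L_sym by simp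
  have S0: "sinL x y \<noteq> 0" using sinL_pos[OF neq] by simp
  have r: "((\<lambda>y. tcomp y x / ncomp y x) has_real_derivative
      ((k y * (sinL x y)\<^sup>2 - cosL x y * ncomp y x) / (ncomp y x)\<^sup>2)) (at y)"
  proof -
    have "(- cosL x y + k y * ncomp y x) * ncomp y x - tcomp y x * (- k y * tcomp y x)
        = k y * ((tcomp y x)\<^sup>2 + (ncomp y x)\<^sup>2) - cosL x y * ncomp y x"
      by (simp add: power2_eq_square algebra_simps)
    also have "\<dots> = k y * (sinL x y)\<^sup>2 - cosL x y * ncomp y x" unfolding S by simp
    finally show ?thesis using DERIV_divide[OF t nn N] by (simp add: power2_eq_square)
  qed
  have "(k y * (sinL x y)\<^sup>2 - cosL x y * ncomp y x) / (ncomp y x)\<^sup>2 / (1 + (tcomp y x / ncomp y x)\<^sup>2)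
     = (k y - ncomp y x * cosL x y / (sinL x y)\<^sup>2)"
  proof -
    have "1 + (tcomp y x / ncomp y x)\<^sup>2 = (sinL x y)\<^sup>2 / (ncomp y x)\<^sup>2"
      using N by (simp add: power_divide S field_simps)
    then show ?thesis using N S0 by (simp add: field_simps)
  qed
  then show ?thesis
    unfolding ang_def
    by (intro DERIV_cong[OF DERIV_diff[OF DERIV_const DERIV_chain2[OF DERIV_arctan r]]])
      (simp add: divide_inverse mult.commute)
qed

lemma near_neq:
  "\<forall>\<^sub>F y in at_right x. \<gamma> x \<noteq> \<gamma> y" "\<forall>\<^sub>F y in at_left x. \<gamma> x \<noteq> \<gamma> y"
proof -
  show "\<forall>\<^sub>F y in at_right x. \<gamma> x \<noteq> \<gamma> y"
    unfolding eventually_at_right_field using P_pos curve_neq[of x] by (intro exI[of _ "x + P"]) auto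
  show "\<forall>\<^sub>F y in at_left x. \<gamma> x \<noteq> \<gamma> y"
    unfolding eventually_at_left_field using P_pos curve_neq[of _ x]
    by (intro exI[of _ "x - P"]) (auto simp: eq_commute)
qed

lemma ratio_lim:
  "filterlim (\<lambda>y. tcomp x y / ncomp x y) at_top (at_right x)"
  "filterlim (\<lambda>y. tcomp x y / ncomp x y) at_bot (at_left x)"
  "filterlim (\<lambda>y. tcomp y x / ncomp y x) at_bot (at_right x)"
  "filterlim (\<lambda>y. tcomp y x / ncomp y x) at_top (at_left x)"
proof -
  have d: "((\<lambda>y. tcomp x y) has_real_derivative 1) (at x)" "((\<lambda>y. ncomp x y) has_real_derivative 0) (at x)"
    using curve_inner_deriv[of "\<tau> x" x] curve_inner_deriv[of "nu x" x]
    by (simp_all add: tcomp_def[abs_def] ncomp_def[abs_def] inner_curve_self nu_facts)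
  have d': "((\<lambda>y. - tcomp y x) has_real_derivative 1) (at x)" "((\<lambda>y. ncomp y x) has_real_derivative 0) (at x)"
    using DERIV_minus[OF tang_inner_deriv[of "\<gamma> x" x]] nu_inner_deriv[of "\<gamma> x" x]
    by (simp_all add: tcomp_def[abs_def] ncomp_def[abs_def] inner_curve_self nu_facts inner_commute curve_tang)
  have z: "tcomp x x = 0" "ncomp x x = 0" by (simp_all add: tcomp_def ncomp_def curve_tang nu_facts)
  have p: "\<forall>\<^sub>F y in at_right x. 0 < ncomp x y" "\<forall>\<^sub>F y in at_left x. 0 < ncomp x y"
    "\<forall>\<^sub>F y in at_right x. 0 < ncomp y x" "\<forall>\<^sub>F y in at_left x. 0 < ncomp y x"
    using near_neq[of x] ncomp_pos by (auto elim!: eventually_mono)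
  show "filterlim (\<lambda>y. tcomp x y / ncomp x y) at_top (at_right x)"
    "filterlim (\<lambda>y. tcomp x y / ncomp x y) at_bot (at_left x)"
    using filterlim_quotient_vanishing_denom[OF d(1) z(1) _ d(2) z(2)] p by auto
  have "filterlim (\<lambda>y. - (- tcomp y x / ncomp y x)) at_bot (at_right x)"
    using filterlim_quotient_vanishing_denom(1)[OF d'(1) _ _ d'(2) z(2)] p z(1) unfolding filterlim_uminus_at_bot[symmetric]
    by (simp add: filterlim_uminus_at_top)
  then show "filterlim (\<lambda>y. tcomp y x / ncomp y x) at_bot (at_right x)" by simp
  have "filterlim (\<lambda>y. - (- tcomp y x / ncomp y x)) at_top (at_left x)"
    using filterlim_quotient_vanishing_denom(2)[OF d'(1) _ _ d'(2) z(2)] p z(1) 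
    by (simp add: filterlim_uminus_at_bot)
  then show "filterlim (\<lambda>y. tcomp y x / ncomp y x) at_top (at_left x)" by simp
qed

lemma ang_lim:
  "((\<lambda>y. ang x y) \<longlongrightarrow> 0) (at_right x)" "((\<lambda>y. ang x y) \<longlongrightarrow> pi) (at_left (x + P))"
  "((\<lambda>y. ang y x) \<longlongrightarrow> pi) (at_right x)" "((\<lambda>y. ang y x) \<longlongrightarrow> 0) (at_left (x + P))"
proof -
  have sh: "(f \<longlongrightarrow> l) (at_left (x + P))" if "(f \<longlongrightarrow> l) (at_left x)" "\<And>y. f (y + P) = f y" for f :: "real \<Rightarrow> real" and l
  proof -
    have "at_left (x + P) = filtermap (\<lambda>y. y + P) (at_left x)"
      using filtermap_at_left_shift[of "- P" x] by simp
    then show ?thesis using that by (simp add: filterlim_filtermap)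
  qed
  have 1: "((\<lambda>y. pi / 2 - arctan (f y)) \<longlongrightarrow> pi / 2 - pi / 2) F" if "filterlim f at_top F" for f :: "real \<Rightarrow> real" and F
    by (intro tendsto_intros filterlim_compose[OF tendsto_arctan_at_top that])
  have 2: "((\<lambda>y. pi / 2 - arctan (f y)) \<longlongrightarrow> pi / 2 - (- (pi / 2))) F" if "filterlim f at_bot F" for f :: "real \<Rightarrow> real" and F
    by (intro tendsto_intros filterlim_compose[OF tendsto_arctan_at_bot that])
  show "((\<lambda>y. ang x y) \<longlongrightarrow> 0) (at_right x)" using 1[OF ratio_lim(1)] by (simp add: ang_def)
  show "((\<lambda>y. ang y x) \<longlongrightarrow> pi) (at_right x)" using 2[OF ratio_lim(3)] by (simp add: ang_def)
  show "((\<lambda>y. ang x y) \<longlongrightarrow> pi) (at_left (x + P))"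
    using 2[OF ratio_lim(2)] by (intro sh) (simp_all add: periodic_comps, simp add: ang_def)
  show "((\<lambda>y. ang y x) \<longlongrightarrow> 0) (at_left (x + P))"
    using 1[OF ratio_lim(4)] by (intro sh) (simp_all add: periodic_comps, simp add: ang_def)
qed

text \<open>By connectedness it is enough that values above and below every number occur. Both are
  found near \<open>x\<close>, and those to the left of \<open>x\<close> are moved to the right end
  by periodicity.\<close>

lemma ratio_surj: "(\<lambda>y. tcomp x y / ncomp x y) ` {x<..<x + P} = UNIV"
proof -
  let ?f = "\<lambda>y. tcomp x y / ncomp x y"
  have cont: "continuous_on {x<..<x + P} ?f"
    using curve_neq[of x] ratio_deriv[of x]
    by (intro DERIV_continuous_on[where D="\<lambda>y. - (ncomp y x / (ncomp x y)\<^sup>2)"])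
      (auto intro: has_field_derivative_at_within)
  have con: "connected (?f ` {x<..<x + P})" by (intro connected_continuous_image cont) simp
  have "q \<in> ?f ` {x<..<x + P}" for q
  proof -
    have "\<forall>\<^sub>F y in at_right x. q < ?f y" using ratio_lim(1)[of x] by (simp add: filterlim_at_top_dense)
    moreover have "\<forall>\<^sub>F y in at_right x. y \<in> {x<..<x + P}"
      using P_pos by (intro eventually_at_right_real) auto
    ultimately have "\<forall>\<^sub>F y in at_right x. q < ?f y \<and> y \<in> {x<..<x + P}" by eventually_elim simp
    then obtain y1 where y1: "q < ?f y1" "y1 \<in> {x<..<x + P}"
      using eventually_happens[of _ "at_right x"] by auto
    have "\<forall>\<^sub>F y in at_left x. ?f y < q" using ratio_lim(2)[of x] by (simp add: filterlim_at_bot_dense)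
    moreover have "\<forall>\<^sub>F y in at_left x. y \<in> {x - P<..<x}"
      using P_pos by (intro eventually_at_left_real) auto
    ultimately have "\<forall>\<^sub>F y in at_left x. ?f y < q \<and> y \<in> {x - P<..<x}" by eventually_elim simp
    then obtain y2 where y2: "?f y2 < q" "y2 \<in> {x - P<..<x}"
      using eventually_happens[of _ "at_left x"] by auto
    then have y2': "?f (y2 + P) < q" "y2 + P \<in> {x<..<x + P}" by (auto simp: periodic_comps)
    have "{?f (y2 + P)..?f y1} \<subseteq> ?f ` {x<..<x + P}"
      using y1 y2' by (intro connected_contains_Icc[OF con]) auto
    then show ?thesis using y1 y2' by (meson atLeastAtMost_iff less_imp_le subsetD)
  qed
  then show ?thesis by auto
qed

lemma ang_image: "ang x ` {x<..<x + P} = {0<..<pi}"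
proof (rule equalityI; rule subsetI)
  fix t assume "t \<in> {0<..<pi}"
  have "tan (pi / 2 - t) \<in> (\<lambda>y. tcomp x y / ncomp x y) ` {x<..<x + P}"
    unfolding ratio_surj by simp
  then obtain y where "y \<in> {x<..<x + P}" "tcomp x y / ncomp x y = tan (pi / 2 - t)"
    by force
  then have "ang x y = t" using \<open>t \<in> {0<..<pi}\<close> by (simp add: ang_def arctan_tan)
  then show "t \<in> ang x ` {x<..<x + P}" using \<open>y \<in> _\<close> by blast
qed (use ang_bounds curve_neq in auto)

lemma ang_strict_mono:
  assumes "x < y" "y < z" "z < x + P"
  shows "ang x y < ang x z"
proof (rule DERIV_pos_imp_increasing[OF assms(2)])
  fix w assume "y \<le> w" "w \<le> z"
  then have n: "\<gamma> x \<noteq> \<gamma> w" using assms by (intro curve_neq) auto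
  then show "\<exists>D. (ang x has_real_derivative D) (at w) \<and> 0 < D"
    using ang_deriv2[OF n] ncomp_pos[OF n[symmetric]] sinL_pos[OF n] by fastforce
qed

text \<open>The geodesic is the spherical interpolation \<open>c t\<close> with coefficients sin (L
  - t) / S and sin t / S. They are positive for 0 < t < L, so the geodesic stays inside the open
  region until it meets the curve at \<open>y\<close>.\<close>

lemma billiard_map_ang:
  assumes x: "x \<in> {0..<P}" and y: "y \<in> {0..<P}" and neq: "x \<noteq> y"
  shows "billiard_map \<gamma> P (x, ang x y) = (y, pi - ang y x)"
proof -
  have n: "\<gamma> x \<noteq> \<gamma> y" using simple x y neq by (meson inj_onD)
  define C S where "C = cosL x y" and "S = sinL x y"
  have S: "0 < S" "S\<^sup>2 = 1 - C\<^sup>2" and C: "-1 < C" "C < 1"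
    using sinL_pos[OF n] sinL_sq[OF n] cosL_bounds[OF n] by (auto simp: S_def C_def)
  define L where "L = arccos C"
  have L: "0 < L" "L < pi" "cos L = C" using C by (auto simp: L_def arccos_lt_bounded intro: arccos_lt_bounded)
  have sL: "sin L = S" unfolding L_def S_def sinL_def C_def[symmetric] using C by (simp add: sin_arccos)
  define u where "u = cos (ang x y) *\<^sub>R \<tau> x + sin (ang x y) *\<^sub>R nu x"
  have Su: "S *\<^sub>R u = \<gamma> y - C *\<^sub>R \<gamma> x"
  proof -
    have "S *\<^sub>R u = tcomp x y *\<^sub>R \<tau> x + ncomp x y *\<^sub>R nu x"
      using S by (simp add: u_def cos_ang[OF n] sin_ang[OF n] S_def scaleR_add_right)
    then show ?thesis using frame_expand[of "\<gamma> y" x]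
      by (simp add: tcomp_def ncomp_def C_def cosL_def inner_commute algebra_simps)
  qed
  have u: "u = (1 / S) *\<^sub>R (\<gamma> y - C *\<^sub>R \<gamma> x)" using S(1) unfolding Su[symmetric] by simp
  define c where "c t = cos t *\<^sub>R \<gamma> x + sin t *\<^sub>R u" for t
  have c: "c t = (sin (L - t) / S) *\<^sub>R \<gamma> x + (sin t / S) *\<^sub>R \<gamma> y" for t
  proof -
    have "cos t - sin t * C / S = sin (L - t) / S" using S by (simp add: sin_diff sL L field_simps)
    moreover have "c t = (cos t - sin t * C / S) *\<^sub>R \<gamma> x + (sin t / S) *\<^sub>R \<gamma> y"
      by (simp add: c_def u scaleR_diff_right scaleR_diff_left)
    ultimately show ?thesis by (simp only:)
  qed
  have cL: "c L = \<gamma> y" using S by (simp add: c sL)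
  have nc: "norm (c t) = 1" for t
  proof -
    have uu: "u \<bullet> u = 1" by (simp add: u_def inner_add_left inner_add_right nu_facts inner_curve_self power2_eq_square[symmetric])
    have "\<gamma> x \<bullet> u = 0" by (simp add: u_def inner_add_right nu_facts curve_tang)
    then have "c t \<bullet> c t = 1" using uu
      by (simp add: c_def inner_add_left inner_add_right inner_commute inner_curve_self power2_eq_square[symmetric])
    then show ?thesis by (simp add: norm_eq_1)
  qed
  have cD: "c t \<in> D" if "0 < t" "t < L" for t
    using that L S n by (intro inner_region_comb[OF curve_in_closure curve_in_closure n _ _ c nc])
      (auto intro!: divide_pos_pos sin_gt_zero)
  have Inf: "Inf {t. 0 < t \<and> c t \<in> \<gamma> ` {0..<P}} = L"
  proof (rule cInf_eq_minimum)
    show "L \<in> {t. 0 < t \<and> c t \<in> \<gamma> ` {0..<P}}" using L cL y by auto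
    fix t assume t: "t \<in> {t. 0 < t \<and> c t \<in> \<gamma> ` {0..<P}}"
    show "L \<le> t"
    proof (rule ccontr)
      assume "\<not> L \<le> t"
      then have "c t \<in> D" using t cD by auto
      then show False using t inner_region_subset(1) by auto
    qed
  qed
  have THE: "(THE y'. y' \<in> {0..<P} \<and> \<gamma> y' = c L) = y"
    using y simple by (intro the_equality) (auto simp: cL inj_on_def)
  \<comment> \<open>Reflection flips only the normal component, so the outgoing angle is the angle
    of the arriving velocity with the tangent. That velocity is opposite to the chord seen from
    \<open>y\<close>, whence the supplement.\<close>
  have "(- sin L *\<^sub>R \<gamma> x + cos L *\<^sub>R u) \<bullet> \<tau> y = - tcomp y x / S"
  proof -
    have "(- sin L *\<^sub>R \<gamma> x + cos L *\<^sub>R u) \<bullet> \<tau> y = - S * tcomp y x + C * (- (C * tcomp y x) / S)"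
      by (simp add: inner_add_left u inner_diff_left sL L tcomp_def curve_tang)
    also have "\<dots> = - (S\<^sup>2 + C\<^sup>2) * tcomp y x / S" using S(1) by (simp add: field_simps power2_eq_square)
    finally show ?thesis using S by simp
  qed
  also have "\<dots> = cos (pi - ang y x)"
    using cos_ang[OF n[symmetric]] L_sym by (simp add: S_def cos_diff)
  finally have v: "arccos ((- sin L *\<^sub>R \<gamma> x + cos L *\<^sub>R u) \<bullet> \<tau> y) = pi - ang y x"
    using ang_bounds[OF n[symmetric]] by (simp only: arccos_cos)
  show ?thesis
    unfolding billiard_map_def Let_def fst_conv snd_conv nu_def[symmetric] u_def[symmetric]
      c_def[symmetric] Inf THE v ..
qed

section \<open>Second derivatives of the chord length and the second variation\<close>

definition l11 where "l11 x y = (ncomp x y)\<^sup>2 * cosL x y / (sinL x y) ^ 3 - k x * ncomp x y / sinL x y"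
text \<open>Since ncomp / sinL is the sine of the angle at the respective end, \<open>l11\<close> is
  sin^2 phi cot L - k sin phi and \<open>l12\<close> is sin phi sin psi / sin L: the second partial
  derivatives of the length. \<open>l12\<close> is also the density of the invariant measure in the
  coordinates (x, y).\<close>

definition l12 where "l12 x y = ncomp x y * ncomp y x / (sinL x y) ^ 3"

text \<open>Eliminates \<open>\<tau> y \<bullet> nu x\<close> between the triple product for
  \<open>ncomp y x\<close> and the orthogonality of \<open>\<gamma> y\<close> and
  \<open>\<tau> y\<close>. It brings the mixed derivative of the length into the form
  \<open>l12\<close>.\<close>

lemma tang_inner_tang:
  "(\<tau> x \<bullet> \<tau> y) * (sinL x y)\<^sup>2 + cosL x y * tcomp x y * tcomp y x = - (ncomp x y * ncomp y x)"
  if neq: "\<gamma> x \<noteq> \<gamma> y"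
proof -
  have 1: "ncomp y x = tcomp x y * (\<tau> y \<bullet> nu x) - ncomp x y * (\<tau> y \<bullet> \<tau> x)"
    using orthonormal_cross_inner[OF frame, of "\<gamma> y" "\<tau> y" x]
    by (simp add: ncomp_def tcomp_def nu_def inner_commute)
  have "\<gamma> y \<bullet> \<tau> y = cosL x y * tcomp y x + tcomp x y * (\<tau> y \<bullet> \<tau> x) + ncomp x y * (\<tau> y \<bullet> nu x)"
    using frame_inner[of "\<gamma> y" "\<tau> y" x] by (simp add: cosL_def tcomp_def ncomp_def inner_commute)
  then have 2: "ncomp x y * (\<tau> y \<bullet> nu x) = - cosL x y * tcomp y x - tcomp x y * (\<tau> y \<bullet> \<tau> x)"
    using curve_tang[of y] by simp
  have "ncomp x y * ncomp y x = tcomp x y * (ncomp x y * (\<tau> y \<bullet> nu x)) - (ncomp x y)\<^sup>2 * (\<tau> y \<bullet> \<tau> x)"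
    unfolding 1 by (simp add: power2_eq_square algebra_simps)
  also have "\<dots> = - cosL x y * tcomp x y * tcomp y x - ((tcomp x y)\<^sup>2 + (ncomp x y)\<^sup>2) * (\<tau> y \<bullet> \<tau> x)"
    unfolding 2 by (simp add: power2_eq_square algebra_simps)
  finally show ?thesis unfolding comps_sq[OF neq] by (simp add: inner_commute)
qed

text \<open>\<open>second_var\<close> is a nested \<open>deriv\<close>, so the first derivative must
  be known on a whole neighbourhood of 0, the second one at 0 only.\<close>

lemma Lgeo_second_deriv:
  fixes a b :: real
  assumes neq: "\<gamma> x \<noteq> \<gamma> y"
  shows "\<exists>f'. (\<forall>\<^sub>F t in nhds 0. ((\<lambda>t. Lgeo \<gamma> (x + t * a) (y + t * b)) has_real_derivative f' t) (at t)) \<and>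
    (f' has_real_derivative (l11 x y * a\<^sup>2 + 2 * l12 x y * a * b + l11 y x * b\<^sup>2)) (at 0)"
proof -
  have lin: "((\<lambda>t. w + t * c) has_vector_derivative c) (at t)" for w c t :: real
    by (auto intro!: derivative_eq_intros)
  have g: "((\<lambda>t. \<gamma> (w + t * c)) has_vector_derivative c *\<^sub>R \<tau> (w + t * c)) (at t)" for w c t
    using vector_diff_chain_at[OF lin[of w c t] curve_deriv] by (simp add: o_def)
  have h: "((\<lambda>t. c *\<^sub>R \<tau> (w + t * c)) has_vector_derivative c *\<^sub>R (c *\<^sub>R (- \<gamma> (w + t * c) + k (w + t * c) *\<^sub>R nu (w + t * c)))) (at t)" for w c t
    using bounded_linear.has_vector_derivative[OF bounded_linear_scaleR_right
        vector_diff_chain_at[OF lin[of w c t] tang_deriv], of c] by (simp add: o_def)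
  define G where "G t = \<gamma> (x + t * a) \<bullet> \<gamma> (y + t * b)" for t
  define G1 where "G1 t = \<gamma> (x + t * a) \<bullet> (b *\<^sub>R \<tau> (y + t * b)) + (a *\<^sub>R \<tau> (x + t * a)) \<bullet> \<gamma> (y + t * b)" for t
  have G: "(G has_real_derivative G1 t) (at t)" for t
    unfolding G_def[abs_def] G1_def has_real_derivative_iff_has_vector_derivative
    by (rule bounded_bilinear.has_vector_derivative[OF bounded_bilinear_inner g g])
  have G1': "(G1 has_real_derivative
      (\<gamma> (x + 0 * a) \<bullet> (b *\<^sub>R (b *\<^sub>R (- \<gamma> (y + 0 * b) + k (y + 0 * b) *\<^sub>R nu (y + 0 * b)))) + (a *\<^sub>R \<tau> (x + 0 * a)) \<bullet> (b *\<^sub>R \<tau> (y + 0 * b)))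
    + ((a *\<^sub>R \<tau> (x + 0 * a)) \<bullet> (b *\<^sub>R \<tau> (y + 0 * b)) + (a *\<^sub>R (a *\<^sub>R (- \<gamma> (x + 0 * a) + k (x + 0 * a) *\<^sub>R nu (x + 0 * a)))) \<bullet> \<gamma> (y + 0 * b))) (at 0)"
    unfolding G1_def[abs_def] has_real_derivative_iff_has_vector_derivative
    by (rule has_vector_derivative_add;
        rule bounded_bilinear.has_vector_derivative[OF bounded_bilinear_inner g h]
        bounded_bilinear.has_vector_derivative[OF bounded_bilinear_inner h g])
  define C S where "C = cosL x y" and "S = sinL x y"
  have S: "0 < S" "S\<^sup>2 = 1 - C\<^sup>2" and C: "-1 < C" "C < 1"
    using sinL_pos[OF neq] sinL_sq[OF neq] cosL_bounds[OF neq] by (auto simp: S_def C_def)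
  have G0: "G 0 = C" by (simp add: G_def C_def cosL_def)
  have G10: "G1 0 = a * tcomp x y + b * tcomp y x"
    by (simp add: G1_def tcomp_def inner_commute)
  have tend: "(G \<longlongrightarrow> G 0) (nhds 0)"
    using DERIV_isCont[OF G[of 0]] by (simp add: isCont_def tendsto_at_iff_tendsto_nhds)
  have ev: "\<forall>\<^sub>F t in nhds 0. - 1 < G t \<and> G t < 1"
    using order_tendstoD[OF tend] C unfolding G0 by (auto intro: eventually_conj)
  define f' where "f' t = inverse (- sqrt (1 - (G t)\<^sup>2)) * G1 t" for t
  have 1: "\<forall>\<^sub>F t in nhds 0. ((\<lambda>t. Lgeo \<gamma> (x + t * a) (y + t * b)) has_real_derivative f' t) (at t)"
    using ev
  proof eventually_elim
    case (elim t)
    show ?case unfolding Lgeo_def G_def[symmetric] f'_def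
      by (rule DERIV_chain2[OF DERIV_arccos G]) (use elim in auto)
  qed
  define G2 where "G2 = a\<^sup>2 * (- C + k x * ncomp x y) + 2 * (a * b * (\<tau> x \<bullet> \<tau> y)) + b\<^sup>2 * (- C + k y * ncomp y x)"
  have nn: "nu x \<bullet> \<gamma> y = ncomp x y" "\<gamma> x \<bullet> nu y = ncomp y x"
    by (simp_all add: ncomp_def inner_commute)
  have G1'': "(G1 has_real_derivative G2) (at 0)"
    by (rule DERIV_cong[OF G1'])
      (simp add: G2_def C_def cosL_def nn inner_diff_left inner_diff_right inner_add_left inner_add_right power2_eq_square algebra_simps)
  have sq: "sqrt (1 - (G 0)\<^sup>2) = S" using S unfolding G0 by (metis real_sqrt_unique less_imp_le)
  have pos: "0 < 1 - (G 0)\<^sup>2" using S unfolding G0 by (metis zero_less_power)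
  have s': "((\<lambda>t. sqrt (1 - (G t)\<^sup>2)) has_real_derivative (- (C * G1 0) / S)) (at 0)"
    by (rule DERIV_cong[OF DERIV_chain2[OF DERIV_real_sqrt[OF pos]
          DERIV_diff[OF DERIV_const DERIV_power[OF G[of 0], of 2]]]]) (use S(1) sq[unfolded G0] in \<open>simp add: G0 field_simps\<close>)
  have i': "((\<lambda>t. inverse (- sqrt (1 - (G t)\<^sup>2))) has_real_derivative (- (C * G1 0) / S ^ 3)) (at 0)"
    by (rule DERIV_cong[OF DERIV_inverse_fun[OF DERIV_minus[OF s']]])
      (use S(1) in \<open>simp_all add: sq field_simps power3_eq_cube\<close>)
  have 2: "(f' has_real_derivative (- (C * G1 0) / S ^ 3 * G1 0 + G2 * inverse (- S))) (at 0)"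
    unfolding f'_def[abs_def] using DERIV_mult[OF i' G1''] by (simp add: sq)
  have "- (C * G1 0) / S ^ 3 * G1 0 + G2 * inverse (- S) = l11 x y * a\<^sup>2 + 2 * l12 x y * a * b + l11 y x * b\<^sup>2"
  proof -
    define t1 t2 n1 n2 tt k1 k2 where d: "t1 = tcomp x y" "t2 = tcomp y x" "n1 = ncomp x y" "n2 = ncomp y x" "tt = \<tau> x \<bullet> \<tau> y" "k1 = k x" "k2 = k y"
    have e1: "t1\<^sup>2 = S\<^sup>2 - n1\<^sup>2" and e2: "t2\<^sup>2 = S\<^sup>2 - n2\<^sup>2" and e3: "n1 * n2 = - tt * S\<^sup>2 - C * t1 * t2"
      using comps_sq[OF neq] comps_sq[OF neq[symmetric]] tang_inner_tang[OF neq] L_sym[of x y]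
      by (simp_all add: d S_def C_def)
    have "S ^ 3 * (- (C * g) / S ^ 3 * g + G2 * inverse (- S)) = - C * g\<^sup>2 - G2 * S\<^sup>2" for g
    proof -
      have "S ^ 3 * (- (C * g) / S ^ 3 * g) = - C * g\<^sup>2" "S ^ 3 * (G2 * inverse (- S)) = - G2 * S\<^sup>2"
        using S(1) by (simp_all add: power2_eq_square power3_eq_cube)
      then show ?thesis by (simp only: distrib_left)
    qed
    then have "S ^ 3 * (- (C * G1 0) / S ^ 3 * G1 0 + G2 * inverse (- S)) = - C * (a * t1 + b * t2)\<^sup>2 - G2 * S\<^sup>2"
      unfolding G10 d(1,2)[symmetric] .
    also have "\<dots> = - C * (a\<^sup>2 * t1\<^sup>2 + b\<^sup>2 * t2\<^sup>2) + C * S\<^sup>2 * (a\<^sup>2 + b\<^sup>2) - (a\<^sup>2 * k1 * n1 + b\<^sup>2 * k2 * n2) * S\<^sup>2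
       + 2 * a * b * (- tt * S\<^sup>2 - C * t1 * t2)"
      unfolding G2_def d[symmetric] by (simp add: power2_eq_square algebra_simps)
    also have "\<dots> = S ^ 3 * (l11 x y * a\<^sup>2 + 2 * l12 x y * a * b + l11 y x * b\<^sup>2)"
    proof -
      have f: "S ^ 3 * l11 x y = n1\<^sup>2 * C - k1 * n1 * S\<^sup>2" "S ^ 3 * l11 y x = n2\<^sup>2 * C - k2 * n2 * S\<^sup>2"
        "S ^ 3 * l12 x y = n1 * n2"
        using S(1) unfolding l11_def l12_def L_sym[of y x] d[symmetric] S_def[symmetric] C_def[symmetric]
        by (simp_all add: field_simps power2_eq_square power3_eq_cube)
      have g: "S ^ 3 * (l11 x y * a\<^sup>2 + 2 * l12 x y * a * b + l11 y x * b\<^sup>2)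
        = (S ^ 3 * l11 x y) * a\<^sup>2 + 2 * (S ^ 3 * l12 x y) * a * b + (S ^ 3 * l11 y x) * b\<^sup>2"
        by (simp add: algebra_simps)
      show ?thesis unfolding g f e1 e2 e3[symmetric] by (simp add: algebra_simps)
    qed
    finally show ?thesis using S(1) by simp
  qed
  then show ?thesis using 1 2 by auto
qed

lemma second_var_eq:
  assumes neq: "\<And>n. \<gamma> (xs n) \<noteq> \<gamma> (xs (n + 1))"
  shows "second_var \<gamma> xs M N \<xi> = (\<Sum>n\<in>{M..<N}. l11 (xs n) (xs (n + 1)) * (\<xi> n)\<^sup>2
    + 2 * l12 (xs n) (xs (n + 1)) * \<xi> n * \<xi> (n + 1) + l11 (xs (n + 1)) (xs n) * (\<xi> (n + 1))\<^sup>2)"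
proof -
  define f where "f n t = Lgeo \<gamma> (xs n + t * \<xi> n) (xs (n + 1) + t * \<xi> (n + 1))" for n t
  have "\<forall>n. \<exists>g. (\<forall>\<^sub>F t in nhds 0. (f n has_real_derivative g t) (at t)) \<and>
    (g has_real_derivative (l11 (xs n) (xs (n + 1)) * (\<xi> n)\<^sup>2
    + 2 * l12 (xs n) (xs (n + 1)) * \<xi> n * \<xi> (n + 1) + l11 (xs (n + 1)) (xs n) * (\<xi> (n + 1))\<^sup>2)) (at 0)"
    unfolding f_def[abs_def] by (intro allI Lgeo_second_deriv neq)
  from choice[OF this] obtain f' where f': "\<And>n. \<forall>\<^sub>F t in nhds 0. (f n has_real_derivative f' n t) (at t)"
    "\<And>n. (f' n has_real_derivative (l11 (xs n) (xs (n + 1)) * (\<xi> n)\<^sup>2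
    + 2 * l12 (xs n) (xs (n + 1)) * \<xi> n * \<xi> (n + 1) + l11 (xs (n + 1)) (xs n) * (\<xi> (n + 1))\<^sup>2)) (at 0)"
    by blast
  have "\<forall>\<^sub>F t in nhds 0. \<forall>n\<in>{M..<N}. (f n has_real_derivative f' n t) (at t)"
    using f'(1) by (intro eventually_ball_finite) auto
  then have "\<forall>\<^sub>F t in nhds 0. deriv (\<lambda>t. \<Sum>n\<in>{M..<N}. f n t) t = (\<Sum>n\<in>{M..<N}. f' n t)"
    by eventually_elim (auto intro!: DERIV_imp_deriv DERIV_sum)
  then have "deriv (deriv (\<lambda>t. \<Sum>n\<in>{M..<N}. f n t)) 0 = deriv (\<lambda>t. \<Sum>n\<in>{M..<N}. f' n t) 0"
    by (rule deriv_cong_ev) simp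
  also have "\<dots> = (\<Sum>n\<in>{M..<N}. l11 (xs n) (xs (n + 1)) * (\<xi> n)\<^sup>2
    + 2 * l12 (xs n) (xs (n + 1)) * \<xi> n * \<xi> (n + 1) + l11 (xs (n + 1)) (xs n) * (\<xi> (n + 1))\<^sup>2)"
    by (intro DERIV_imp_deriv DERIV_sum f')
  finally show ?thesis by (simp add: second_var_def f_def)
qed

end

section \<open>Second variation along a sequence of chords\<close>

text \<open>The \<open>n\<close>-th chord has length \<open>L n\<close>; at the \<open>n\<close>-th bounce the curvature is \<open>K n\<close> and the sine
  of the angle is \<open>s n\<close>. Below, \<open>A n\<close>, \<open>E n\<close>, \<open>B n\<close> are the second derivatives
  \<open>L\<^sub>1\<^sub>1\<close>, \<open>L\<^sub>2\<^sub>2\<close>, \<open>L\<^sub>1\<^sub>2\<close> of the length of the \<open>n\<close>-th chord, and \<open>al j n\<close> encodes the solution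
  of the Riccati recursion with a Dirichlet condition at index \<open>n + j + 1\<close>; \<open>p j n\<close> is minus the
  corresponding pivot of the tridiagonal Hessian.\<close>

locale chord_sequence =
  fixes L s K :: "int \<Rightarrow> real"
  assumes L_pos: "0 < L n" and L_less: "L n < pi" and s_pos: "0 < s n"
begin

definition A where "A n = (s n)\<^sup>2 * cot (L n) - K n * s n"
definition E where "E n = (s (n + 1))\<^sup>2 * cot (L n) - K (n + 1) * s (n + 1)"
definition B where "B n = s n * s (n + 1) / sin (L n)"
definition q where "q \<xi> n = A n * (\<xi> n)\<^sup>2 + 2 * B n * \<xi> n * \<xi> (n + 1) + E n * (\<xi> (n + 1))\<^sup>2"
  for \<xi> :: "int \<Rightarrow> real"

fun al :: "nat \<Rightarrow> int \<Rightarrow> real" where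
  "al 0 n = L n"
| "al (Suc j) n = L n - (pi / 2 - arctan (2 * K (n + 1) / s (n + 1) - cot (al j (n + 1))))"

declare al.simps(2) [simp del]

text \<open>The piece of chord \<open>n - 1\<close> next to bounce \<open>n\<close>;
  \<open>cot (al j n) + cot (bt j n) = 2 * K n / s n\<close> is the mirror equation. The arctan form
  keeps it in (0, pi) whatever the value of \<open>al j n\<close>.\<close>

definition bt where "bt j n = pi / 2 - arctan (2 * K n / s n - cot (al j n))"
text \<open>The Riccati variable: the coefficient of the square of \<open>\<xi> n\<close> that
  remains of the form on the chords \<open>n\<close>, ..., \<open>n + j\<close> once
  \<open>\<xi> (n + 1)\<close>, ..., \<open>\<xi> (n + j)\<close> are eliminated and
  \<open>\<xi> (n + j + 1) = 0\<close>. For \<open>j = 0\<close> it is \<open>A n\<close>.\<close>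

definition w where "w j n = (s n)\<^sup>2 * cot (al j n) - K n * s n"
definition p where "p j n = - w j (n + 1) - E n"

lemma al_Suc: "al (Suc j) n = L n - bt j (n + 1)" by (simp add: bt_def al.simps(2))

lemma bt_bounds: "0 < bt j n" "bt j n < pi"
  using arctan_bounded[of "2 * K n / s n - cot (al j n)"] unfolding bt_def by auto

lemma cot_bt: "cot (bt j n) = 2 * K n / s n - cot (al j n)"
  unfolding bt_def cot_altdef tan_cot by (simp add: tan_arctan)

lemma sin_L_pos: "0 < sin (L n)" using L_pos L_less by (intro sin_gt_zero)

lemma p_eq: "p j n = (s (n + 1))\<^sup>2 * sin (al (Suc j) n) / (sin (bt j (n + 1)) * sin (L n))"
proof -
  have sb: "0 < sin (bt j (n + 1))" using bt_bounds by (intro sin_gt_zero)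
  have "p j n = (s (n + 1))\<^sup>2 * (cot (bt j (n + 1)) - cot (L n))"
    using s_pos[of "n + 1"] unfolding p_def w_def E_def cot_bt
    by (simp add: field_simps power2_eq_square)
  also have "cot (bt j (n + 1)) - cot (L n) = sin (al (Suc j) n) / (sin (bt j (n + 1)) * sin (L n))"
    unfolding al_Suc sin_diff cot_def using sb sin_L_pos[of n] by (simp add: field_simps)
  finally show ?thesis by simp
qed

text \<open>By \<open>p_eq\<close> the pivot has the sign of sin (al (Suc j) n). The lengths and the
  pieces \<open>bt\<close> lie in (0, pi), so their difference lies in (-pi, pi), where sin has the
  sign of its argument.\<close>

lemma p_pos_iff: "0 < p j n \<longleftrightarrow> 0 < al (Suc j) n"
proof -
  have sb: "0 < sin (bt j (n + 1))" using bt_bounds by (intro sin_gt_zero)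
  have "0 < p j n \<longleftrightarrow> 0 < sin (al (Suc j) n)"
  proof -
    define c where "c = (s (n + 1))\<^sup>2 / (sin (bt j (n + 1)) * sin (L n))"
    have "0 < c" using sb sin_L_pos[of n] s_pos[of "n + 1"] by (simp add: c_def)
    moreover have "p j n = c * sin (al (Suc j) n)" by (simp add: p_eq c_def)
    ultimately show ?thesis by (simp add: zero_less_mult_iff)
  qed
  moreover have b: "- pi < al (Suc j) n" "al (Suc j) n < pi"
    using bt_bounds[of j "n + 1"] L_pos[of n] L_less[of n] unfolding al_Suc by auto
  ultimately show ?thesis
    using sin_gt_zero[of "al (Suc j) n"] sin_ge_zero[of "- al (Suc j) n"] by force
qed

text \<open>The Riccati recursion w = A + B^2 / p, multiplied out. It reduces to cot x - cot y = sin
  (y - x) / (sin x sin y) for the two ways of cutting chord \<open>n\<close>.\<close>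

lemma w_step:
  assumes "0 < al (Suc j) n"
  shows "(w (Suc j) n - A n) * p j n = (B n)\<^sup>2"
proof -
  have sb: "0 < sin (bt j (n + 1))" using bt_bounds by (intro sin_gt_zero)
  have sa: "0 < sin (al (Suc j) n)"
    using assms bt_bounds[of j "n + 1"] L_less[of n] unfolding al_Suc by (intro sin_gt_zero) auto
  have bL: "bt j (n + 1) = L n - al (Suc j) n" by (simp add: al_Suc)
  have "cot (al (Suc j) n) - cot (L n) = sin (bt j (n + 1)) / (sin (al (Suc j) n) * sin (L n))"
    unfolding bL sin_diff cot_def using sa sin_L_pos[of n] by (simp add: field_simps)
  moreover have "w (Suc j) n - A n = (s n)\<^sup>2 * (cot (al (Suc j) n) - cot (L n))"
    unfolding w_def A_def by (simp add: algebra_simps)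
  ultimately have W: "w (Suc j) n - A n = (s n)\<^sup>2 * (sin (bt j (n + 1)) / (sin (al (Suc j) n) * sin (L n)))"
    by simp
  show ?thesis
    unfolding W p_eq B_def using sb sa sin_L_pos[of n] by (simp add: field_simps power2_eq_square)
qed

text \<open>Completing the square in \<open>\<xi> (n + 1)\<close>. Summed over \<open>n\<close>, the
  terms in \<open>w\<close> telescope and minus the pivots times squares remain.\<close>

lemma q_step:
  assumes "0 < al (Suc j) n"
  shows "q \<xi> n = w (Suc j) n * (\<xi> n)\<^sup>2 - w j (n + 1) * (\<xi> (n + 1))\<^sup>2
    - p j n * (\<xi> (n + 1) - B n / p j n * \<xi> n)\<^sup>2"
proof -
  have p: "0 < p j n" using assms p_pos_iff by simp
  define c where "c = B n / p j n"
  have e0: "B n = c * p j n" using p by (simp add: c_def)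
  have "(w (Suc j) n - A n) * p j n = (c\<^sup>2 * p j n) * p j n"
    using w_step[OF assms] unfolding e0 by (simp only: power2_eq_square mult_ac)
  then have "w (Suc j) n - A n = c\<^sup>2 * p j n" using p by (metis mult_right_cancel less_irrefl)
  then have e1: "A n = w (Suc j) n - c\<^sup>2 * p j n" by simp
  have e2: "E n = - w j (n + 1) - p j n" by (simp add: p_def)
  show ?thesis unfolding q_def c_def[symmetric] unfolding e1 e2 e0 power2_eq_square by (simp only: algebra_simps)
qed

lemma sum_q_split: "M < N \<Longrightarrow> (\<Sum>i\<in>{M..<N}. q \<xi> i) = q \<xi> M + (\<Sum>i\<in>{M + 1..<N}. q \<xi> i)"
  for M N :: int
proof -
  assume "M < N"
  then have "{M..<N} = insert M {M + 1..<N}" by auto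
  then show ?thesis by simp
qed

text \<open>The equality case is carried through the induction because definiteness must be strict:
  if no square contributes and \<open>\<xi> n = 0\<close>, then each entry forces the next one to
  vanish.\<close>

lemma sum_q_le:
  assumes pos: "\<And>j n. 0 < al j n" and N: "N = n + 1 + int j" and z: "\<xi> N = 0"
  shows "(\<Sum>i\<in>{n..<N}. q \<xi> i) \<le> w j n * (\<xi> n)\<^sup>2 \<and>
    ((\<Sum>i\<in>{n..<N}. q \<xi> i) = w j n * (\<xi> n)\<^sup>2 \<and> \<xi> n = 0 \<longrightarrow> (\<forall>i\<in>{n..N}. \<xi> i = 0))"
  using N
proof (induction j arbitrary: n)
  case 0
  then have "{n..<N} = {n}" "{n..N} = {n, N}" by auto
  then show ?case using 0 z by (auto simp: q_def w_def A_def)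
next
  case (Suc j)
  have N': "N = (n + 1) + 1 + int j" using Suc.prems by simp
  have IH: "(\<Sum>i\<in>{n + 1..<N}. q \<xi> i) \<le> w j (n + 1) * (\<xi> (n + 1))\<^sup>2"
    "(\<Sum>i\<in>{n + 1..<N}. q \<xi> i) = w j (n + 1) * (\<xi> (n + 1))\<^sup>2 \<Longrightarrow> \<xi> (n + 1) = 0 \<Longrightarrow> (\<forall>i\<in>{n + 1..N}. \<xi> i = 0)"
    using Suc.IH[OF N'] by blast+
  have p: "0 < p j n" using pos p_pos_iff by simp
  let ?r = "p j n * (\<xi> (n + 1) - B n / p j n * \<xi> n)\<^sup>2"
  have r: "0 \<le> ?r" using p by simp
  have eq: "(\<Sum>i\<in>{n..<N}. q \<xi> i) = w (Suc j) n * (\<xi> n)\<^sup>2 - w j (n + 1) * (\<xi> (n + 1))\<^sup>2 - ?r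
     + (\<Sum>i\<in>{n + 1..<N}. q \<xi> i)"
    using Suc.prems by (subst sum_q_split) (simp, simp only: q_step[OF pos, where j=j])
  show ?case
  proof (intro conjI impI)
    show "(\<Sum>i\<in>{n..<N}. q \<xi> i) \<le> w (Suc j) n * (\<xi> n)\<^sup>2"
      using eq IH(1) r by linarith
    assume h: "(\<Sum>i\<in>{n..<N}. q \<xi> i) = w (Suc j) n * (\<xi> n)\<^sup>2 \<and> \<xi> n = 0"
    then have "?r = 0" "(\<Sum>i\<in>{n + 1..<N}. q \<xi> i) = w j (n + 1) * (\<xi> (n + 1))\<^sup>2"
      using eq IH(1) r by linarith+
    moreover from this have "\<xi> (n + 1) = 0" using p h by simp
    ultimately have "\<forall>i\<in>{n + 1..N}. \<xi> i = 0" using IH(2) by blast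
    then show "\<forall>i\<in>{n..N}. \<xi> i = 0"
      using h by (metis atLeastAtMost_iff order_le_less zless_imp_add1_zle)
  qed
qed

text \<open>Back substitution: \<open>\<xi>\<close> is chosen so that every completed square
  vanishes. Only the pivots up to horizon \<open>j\<close> have to be positive, which allows its use
  at the first failure.\<close>

lemma exists_extremal:
  assumes "\<And>i m. i \<le> j \<Longrightarrow> 0 < al i m"
  shows "\<exists>\<xi>. \<xi> n = 1 \<and> (\<forall>i. i < n \<or> n + int j < i \<longrightarrow> \<xi> i = 0) \<and>
    (\<Sum>i\<in>{n..<n + 1 + int j}. q \<xi> i) = w j n"
  using assms
proof (induction j arbitrary: n)
  case 0
  have "{n..<n + 1 + int 0} = {n}" by auto
  then show ?case
    by (intro exI[of _ "\<lambda>i. if i = n then 1 else 0"]) (auto simp: q_def w_def A_def)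
next
  case (Suc j)
  obtain \<xi> where \<xi>: "\<xi> (n + 1) = 1" "\<And>i. i < n + 1 \<or> n + 1 + int j < i \<Longrightarrow> \<xi> i = 0"
    "(\<Sum>i\<in>{n + 1..<n + 1 + 1 + int j}. q \<xi> i) = w j (n + 1)"
    using Suc.IH[of "n + 1"] Suc.prems by auto
  have a: "0 < al (Suc j) n" using Suc.prems by simp
  have p: "0 < p j n" using a p_pos_iff by simp
  define c where "c = B n / p j n"
  define \<eta> where "\<eta> i = (if i = n then 1 else c * \<xi> i)" for i
  have "(\<Sum>i\<in>{n..<n + 1 + int (Suc j)}. q \<eta> i) = q \<eta> n + (\<Sum>i\<in>{n + 1..<n + 1 + 1 + int j}. q \<eta> i)"
    by (subst sum_q_split) (auto simp: algebra_simps)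
  also have "(\<Sum>i\<in>{n + 1..<n + 1 + 1 + int j}. q \<eta> i) = (\<Sum>i\<in>{n + 1..<n + 1 + 1 + int j}. c\<^sup>2 * q \<xi> i)"
    by (intro sum.cong refl) (auto simp: q_def \<eta>_def power2_eq_square algebra_simps)
  also have "\<dots> = c\<^sup>2 * w j (n + 1)" using \<xi>(3) by (simp add: sum_distrib_left[symmetric])
  also have "q \<eta> n = w (Suc j) n - w j (n + 1) * c\<^sup>2"
    unfolding q_step[OF a] by (simp add: \<eta>_def \<xi>(1) c_def)
  finally have "(\<Sum>i\<in>{n..<n + 1 + int (Suc j)}. q \<eta> i) = w (Suc j) n" by simp
  moreover have "\<eta> n = 1" "\<forall>i. i < n \<or> n + int (Suc j) < i \<longrightarrow> \<eta> i = 0"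
    using \<xi>(2) by (auto simp: \<eta>_def)
  ultimately show ?case by blast
qed

theorem negative_definite_iff:
  "(\<forall>M N. M < N \<longrightarrow> (\<forall>\<xi>. (\<forall>n. (n \<le> M \<or> N \<le> n) \<longrightarrow> \<xi> n = 0) \<and> (\<exists>n. \<xi> n \<noteq> 0) \<longrightarrow>
      (\<Sum>n\<in>{M..<N}. q \<xi> n) < 0)) \<longleftrightarrow> (\<forall>j n. 0 < al j n)" (is "?neg \<longleftrightarrow> ?pos")
proof
  assume pos: ?pos
  show ?neg
  proof (intro allI impI, elim conjE exE)
    fix M N :: int and \<xi> :: "int \<Rightarrow> real" and n
    assume MN: "M < N" and z: "\<forall>n. (n \<le> M \<or> N \<le> n) \<longrightarrow> \<xi> n = 0" and n: "\<xi> n \<noteq> 0"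
    \<comment> \<open>The horizon for which \<open>al j M\<close> has its Dirichlet condition at
      \<open>M + j + 1 = N\<close>.\<close>
    define j where "j = nat (N - M - 1)"
    have N: "N = M + 1 + int j" using MN by (simp add: j_def)
    have zz: "\<xi> M = 0" "\<xi> N = 0" using z by auto
    have *: "(\<Sum>i\<in>{M..<N}. q \<xi> i) \<le> 0" "(\<Sum>i\<in>{M..<N}. q \<xi> i) = 0 \<Longrightarrow> (\<forall>i\<in>{M..N}. \<xi> i = 0)"
      using sum_q_le[where n=M and j=j and N=N and \<xi>=\<xi>] pos N zz by auto
    have "\<not> (n \<le> M \<or> N \<le> n)" using n z by blast
    then have "n \<in> {M..N}" by auto
    then have "(\<Sum>i\<in>{M..<N}. q \<xi> i) \<noteq> 0" using * n by blast
    then show "(\<Sum>n\<in>{M..<N}. q \<xi> n) < 0" using * by linarith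
  qed
next
  assume neg: ?neg
  have "\<forall>n. 0 < al j n" for j
  proof (induction j rule: less_induct)
    case (less j)
    show ?case
    proof (cases j)
      case 0
      then show ?thesis using L_pos by simp
    next
      case (Suc i)
      show ?thesis
      proof (rule ccontr)
        assume "\<not> (\<forall>n. 0 < al j n)"
        then obtain n where n: "\<not> 0 < al (Suc i) n" using Suc by auto
        then have p: "p i n \<le> 0" using p_pos_iff by (meson not_less)
        \<comment> \<open>At the smallest failing horizon the extremal vector starting at
          \<open>n + 1\<close> still exists. Being 0 at \<open>n\<close>, it gets only
          \<open>E n\<close> from the additional chord, so the form equals \<open>- p i n\<close>,
          which is not negative.\<close>
        obtain \<xi> where \<xi>: "\<xi> (n + 1) = 1" "\<And>m. m < n + 1 \<or> n + 1 + int i < m \<Longrightarrow> \<xi> m = 0"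
          "(\<Sum>m\<in>{n + 1..<n + 1 + 1 + int i}. q \<xi> m) = w i (n + 1)"
          using exists_extremal[of i "n + 1"] less Suc by fastforce
        have "(\<Sum>m\<in>{n..<n + 1 + 1 + int i}. q \<xi> m) < 0"
          using \<xi>(1,2) by (intro neg[rule_format]) (auto intro: exI[of _ "n + 1"])
        moreover have "(\<Sum>m\<in>{n..<n + 1 + 1 + int i}. q \<xi> m) = - p i n"
          using \<xi> by (subst sum_q_split) (auto simp: q_def p_def)
        ultimately show False using p by simp
      qed
    qed
  qed
  then show ?pos by blast
qed

end

section \<open>Orbits, time reversal and the Riccati criterion for m-orbits\<close>

context spherical_billiard
begin

abbreviation T where "T \<equiv> billiard_map \<gamma> P"
abbreviation \<Omega> where "\<Omega> \<equiv> phase_space P"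
text \<open>Time reversal. On the phase space \<open>R T R\<close> inverts \<open>T\<close>, so
  properties of the inverse are inherited from \<open>T\<close>.\<close>

definition R :: "real \<times> real \<Rightarrow> real \<times> real" where "R z = (fst z, pi - snd z)"
definition Tinv where "Tinv z = R (T (R z))"

text \<open>Turns a phase point into an ordered pair of distinct parameters, on which
  \<open>T\<close> is known explicitly.\<close>

lemma phase_point:
  assumes "z \<in> \<Omega>"
  obtains x y where "x \<in> {0..<P}" "y \<in> {0..<P}" "x \<noteq> y" "\<gamma> x \<noteq> \<gamma> y" "z = (x, ang x y)" "T z = (y, pi - ang y x)"
proof -
  obtain x t where z: "z = (x, t)" "x \<in> {0..<P}" "t \<in> {0<..<pi}"
    using assms by (auto simp: phase_space_def)
  then have "t \<in> ang x ` {x<..<x + P}" by (simp only: ang_image)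
  then obtain y' where y': "y' \<in> {x<..<x + P}" "t = ang x y'" by blast
  define y where "y = (if y' < P then y' else y' - P)"
  have y: "y \<in> {0..<P}" "y \<noteq> x" "ang x y = t"
    using y' z periodic_comps(5)[of x "y' - P"] by (auto simp: y_def)
  have "\<gamma> x \<noteq> \<gamma> y" using inj_onD[OF simple, of x y] y(1,2) z(2) by blast
  then show ?thesis using that[of x y] y z billiard_map_ang[of x y] by auto
qed

lemma T_in: "z \<in> \<Omega> \<Longrightarrow> T z \<in> \<Omega>"
  by (erule phase_point) (use ang_bounds in \<open>auto simp: phase_space_def\<close>)

lemma R_in: "z \<in> \<Omega> \<Longrightarrow> R z \<in> \<Omega>" and R_R: "R (R z) = z"
  by (auto simp: R_def phase_space_def)

lemma Tinv_T: "z \<in> \<Omega> \<Longrightarrow> Tinv (T z) = z"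
  by (erule phase_point) (simp add: Tinv_def R_def billiard_map_ang)

lemma T_Tinv: "z \<in> \<Omega> \<Longrightarrow> T (Tinv z) = z"
  using Tinv_T[OF R_in, of z] R_R by (simp add: Tinv_def) metis

lemma Tinv_in: "z \<in> \<Omega> \<Longrightarrow> Tinv z \<in> \<Omega>"
  by (simp add: Tinv_def R_in T_in)

lemma T_pow_in: "z \<in> \<Omega> \<Longrightarrow> (T ^^ n) z \<in> \<Omega>" and Tinv_pow_in: "z \<in> \<Omega> \<Longrightarrow> (Tinv ^^ n) z \<in> \<Omega>"
  by (induction n) (simp_all add: T_in Tinv_in)

definition orb :: "real \<times> real \<Rightarrow> int \<Rightarrow> real \<times> real" where
  "orb z n = (if 0 \<le> n then (T ^^ nat n) z else (Tinv ^^ nat (- n)) z)"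

lemma orb_in: "z \<in> \<Omega> \<Longrightarrow> orb z n \<in> \<Omega>"
  by (simp add: orb_def T_pow_in Tinv_pow_in)

lemma orb_step: "z \<in> \<Omega> \<Longrightarrow> T (orb z n) = orb z (n + 1)"
proof (cases "0 \<le> n")
  case True
  then have "nat (n + 1) = Suc (nat n)" by simp
  then show ?thesis using True by (simp add: orb_def)
next
  case False
  assume z: "z \<in> \<Omega>"
  define m where "m = nat (- n - 1)"
  have m: "nat (- n) = Suc m" "nat (- (n + 1)) = m" using False by (simp_all add: m_def)
  show ?thesis
  proof (cases "n + 1 = 0")
    case True
    then have "n = -1" by simp
    then show ?thesis using z by (simp add: orb_def T_Tinv)
  next
    case F: False
    then have "\<not> 0 \<le> n + 1" using False by simp
    then show ?thesis using False z m by (simp add: orb_def T_Tinv Tinv_pow_in)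
  qed
qed

text \<open>\<open>T\<close> is injective on the phase space, so the two-sided sequence quantified
  in \<open>m_set\<close> is determined by its value at 0.\<close>

lemma orb_unique:
  assumes "ws 0 = z" "\<And>n. ws n \<in> \<Omega>" "\<And>n. T (ws n) = ws (n + 1)"
  shows "ws n = orb z n"
proof -
  have pos: "ws (int m) = (T ^^ m) z" for m
  proof (induction m)
    case (Suc m)
    then show ?case using assms(3)[of "int m"] by (simp add: add.commute)
  qed (simp add: assms(1))
  have neg: "ws (- int m) = (Tinv ^^ m) z" for m
  proof (induction m)
    case (Suc m)
    have "Tinv (ws (- int m)) = ws (- int (Suc m))"
      using Tinv_T[OF assms(2), of "- int (Suc m)"] assms(3)[of "- int (Suc m)"] by simp
    then show ?case using Suc by simp
  qed (simp add: assms(1))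
  show ?thesis using pos[of "nat n"] neg[of "nat (- n)"] by (cases "0 \<le> n") (auto simp: orb_def)
qed

definition len where "len z = arccos (cosL (fst z) (fst (T z)))"

fun alpha :: "nat \<Rightarrow> real \<times> real \<Rightarrow> real" where
  "alpha 0 z = len z"
| "alpha (Suc j) z = len z - (pi / 2 - arctan (2 * k (fst (T z)) / sin (snd (T z)) - cot (alpha j (T z))))"

text \<open>The chords of an orbit form a \<open>chord_sequence\<close>, and with ncomp / sinL as
  the sine of the angle, the coefficients of the second variation are its \<open>A\<close>,
  \<open>E\<close> and \<open>B\<close>.\<close>

lemma m_config_orb_iff:
  assumes z: "z \<in> \<Omega>"
  shows "m_config \<gamma> (fst \<circ> orb z) \<longleftrightarrow> (\<forall>j n. 0 < alpha j (orb z n))"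
proof -
  define x where "x n = fst (orb z n)" for n
  have st: "x n \<in> {0..<P} \<and> \<gamma> (x n) \<noteq> \<gamma> (x (n + 1)) \<and> snd (orb z n) = ang (x n) (x (n + 1)) \<and>
      snd (orb z (n + 1)) = pi - ang (x (n + 1)) (x n)" for n
  proof -
    obtain u y where "u \<in> {0..<P}" "\<gamma> u \<noteq> \<gamma> y" "orb z n = (u, ang u y)" "T (orb z n) = (y, pi - ang y u)"
      by (rule phase_point[OF orb_in[OF z, of n]])
    moreover from this have "orb z (n + 1) = (y, pi - ang y u)" using orb_step[OF z, of n] by metis
    ultimately show ?thesis by (simp add: x_def)
  qed
  then have neq: "\<gamma> (x n) \<noteq> \<gamma> (x (n + 1))" for n by blast
  define L where "L n = len (orb z n)" for n
  define s where "s n = sin (snd (orb z n))" for n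
  define K where "K n = k (x n)" for n
  have L: "L n = arccos (cosL (x n) (x (n + 1)))" for n
    by (simp add: L_def len_def x_def orb_step[OF z])
  have Lb: "0 < L n" "L n < pi" "cos (L n) = cosL (x n) (x (n + 1))" "sin (L n) = sinL (x n) (x (n + 1))" for n
    using cosL_bounds[OF neq[of n]] unfolding L
    by (auto simp: arccos_lt_bounded sin_arccos sinL_def intro: arccos_lt_bounded)
  have s1: "s n = ncomp (x n) (x (n + 1)) / sinL (x n) (x (n + 1))" for n
    unfolding s_def using st[of n] sin_ang by simp
  \<comment> \<open>An angle and its supplement have the same sine, so \<open>s (n + 1)\<close> can
    be computed from the arriving chord as well; this is where the reflection law enters.\<close>
  have s2: "s (n + 1) = ncomp (x (n + 1)) (x n) / sinL (x n) (x (n + 1))" for n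
    unfolding s_def using st[of n] sin_ang[OF neq[symmetric]] L_sym by simp
  interpret cs: chord_sequence L s K
    using Lb sinL_pos[OF neq] ncomp_pos[OF neq] by unfold_locales (simp_all add: s1)
  have q: "cs.q \<xi> n = l11 (x n) (x (n + 1)) * (\<xi> n)\<^sup>2
    + 2 * l12 (x n) (x (n + 1)) * \<xi> n * \<xi> (n + 1) + l11 (x (n + 1)) (x n) * (\<xi> (n + 1))\<^sup>2" for \<xi> n
  proof -
    have "cs.A n = l11 (x n) (x (n + 1))" "cs.E n = l11 (x (n + 1)) (x n)" "cs.B n = l12 (x n) (x (n + 1))"
      unfolding cs.A_def cs.E_def cs.B_def l11_def l12_def s1[of n] s2[of n] cot_def Lb K_def
        L_sym[of "x (n + 1)" "x n"]
      by (simp_all add: power_divide power2_eq_square power3_eq_cube)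
    then show ?thesis by (simp add: cs.q_def)
  qed
  have al: "cs.al j n = alpha j (orb z n)" for j n
  proof (induction j arbitrary: n)
    case (Suc j)
    show ?case
      unfolding cs.al.simps(2) alpha.simps(2) orb_step[OF z] Suc.IH by (simp only: L_def K_def s_def x_def)
  qed (simp add: L_def)
  have "second_var \<gamma> (fst \<circ> orb z) M N \<xi> = (\<Sum>n\<in>{M..<N}. cs.q \<xi> n)" for M N \<xi>
  proof -
    have "fst \<circ> orb z = x" by (simp add: x_def fun_eq_iff)
    then show ?thesis using second_var_eq[where xs=x, OF neq] unfolding q by simp
  qed
  then show ?thesis unfolding m_config_def al[symmetric] cs.negative_definite_iff[symmetric] by simp
qed

lemma m_set_iff: "z \<in> m_set \<gamma> P \<longleftrightarrow> z \<in> \<Omega> \<and> (\<forall>j n. 0 < alpha j (orb z n))"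
proof -
  have "(\<exists>zs. zs 0 = z \<and> (\<forall>n. zs n \<in> \<Omega> \<and> T (zs n) = zs (n + 1)) \<and> m_config \<gamma> (fst \<circ> zs))
     \<longleftrightarrow> m_config \<gamma> (fst \<circ> orb z)" if z: "z \<in> \<Omega>"
  proof
    assume "m_config \<gamma> (fst \<circ> orb z)"
    then show "\<exists>zs. zs 0 = z \<and> (\<forall>n. zs n \<in> \<Omega> \<and> T (zs n) = zs (n + 1)) \<and> m_config \<gamma> (fst \<circ> zs)"
      using z orb_in orb_step by (intro exI[of _ "orb z"]) (auto simp: orb_def)
  next
    assume "\<exists>zs. zs 0 = z \<and> (\<forall>n. zs n \<in> \<Omega> \<and> T (zs n) = zs (n + 1)) \<and> m_config \<gamma> (fst \<circ> zs)"
    then obtain zs where zs: "zs 0 = z" "\<And>n. zs n \<in> \<Omega>" "\<And>n. T (zs n) = zs (n + 1)" "m_config \<gamma> (fst \<circ> zs)"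
      by blast
    have "zs = orb z" using orb_unique[OF zs(1-3)] by (simp add: fun_eq_iff)
    then show "m_config \<gamma> (fst \<circ> orb z)" using zs(4) by simp
  qed
  then show ?thesis using m_config_orb_iff unfolding m_set_def by auto
qed

section \<open>The invariant measure and averaging over m-orbits\<close>

lemma curve_measurable [measurable]:
  "\<gamma> \<in> borel_measurable borel" "\<tau> \<in> borel_measurable borel" "nu \<in> borel_measurable borel" "k \<in> borel_measurable borel"
  by (intro borel_measurable_continuous_onI continuous_curve)+

lemma comps_measurable [measurable]:
  assumes [measurable]: "f \<in> borel_measurable M" "g \<in> borel_measurable M"
  shows "(\<lambda>z. cosL (f z) (g z)) \<in> borel_measurable M" "(\<lambda>z. sinL (f z) (g z)) \<in> borel_measurable M"
    "(\<lambda>z. tcomp (f z) (g z)) \<in> borel_measurable M" "(\<lambda>z. ncomp (f z) (g z)) \<in> borel_measurable M"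
    "(\<lambda>z. ang (f z) (g z)) \<in> borel_measurable M" "(\<lambda>z. l12 (f z) (g z)) \<in> borel_measurable M"
proof -
  show [measurable]: "(\<lambda>z. cosL (f z) (g z)) \<in> borel_measurable M"
    "(\<lambda>z. tcomp (f z) (g z)) \<in> borel_measurable M" "(\<lambda>z. ncomp (f z) (g z)) \<in> borel_measurable M"
    unfolding cosL_def tcomp_def ncomp_def by measurable
  have [measurable]: "(\<lambda>z. ncomp (g z) (f z)) \<in> borel_measurable M" unfolding ncomp_def by measurable
  show [measurable]: "(\<lambda>z. sinL (f z) (g z)) \<in> borel_measurable M" unfolding sinL_def by measurable
  show "(\<lambda>z. ang (f z) (g z)) \<in> borel_measurable M" unfolding ang_def by measurable
  show "(\<lambda>z. l12 (f z) (g z)) \<in> borel_measurable M" unfolding l12_def by measurable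
qed

lemma Omega_measurable [measurable]: "\<Omega> \<in> sets borel"
proof -
  have "\<Omega> = {z. 0 \<le> fst z \<and> fst z < P \<and> 0 < snd z \<and> snd z < pi}" by (auto simp: phase_space_def)
  then show ?thesis by simp
qed

text \<open>The invariant measure on Borel sets, cut off to the phase space and hence finite.
  \<open>measure_billiard_measure\<close> identifies it with \<open>billiard_measure\<close> on
  Borel subsets of the phase space.\<close>

definition mu :: "(real \<times> real) measure" where
  "mu = density lborel (\<lambda>z. ennreal (sin (snd z)) * indicator \<Omega> z)"

lemma sets_mu [measurable_cong, simp]: "sets mu = sets borel" by (simp add: mu_def)
lemma space_mu [simp]: "space mu = UNIV" by (simp add: mu_def)

lemma nn_integral_mu:
  assumes [measurable]: "f \<in> borel_measurable borel"
  shows "(\<integral>\<^sup>+z. f z \<partial>mu)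
      = (\<integral>\<^sup>+x. indicator {0..<P} x * (\<integral>\<^sup>+t. f (x, t) * ennreal (sin t) * indicator {0<..<pi} t \<partial>lborel) \<partial>lborel)"
proof -
  have [measurable]: "f \<in> borel_measurable (borel \<Otimes>\<^sub>M borel)" by (simp add: borel_prod)
  have "(\<integral>\<^sup>+z. f z \<partial>mu) = (\<integral>\<^sup>+z. ennreal (sin (snd z)) * indicator \<Omega> z * f z \<partial>(lborel \<Otimes>\<^sub>M lborel))"
    unfolding mu_def lborel_prod by (rule nn_integral_density) measurable
  also have "\<dots> = (\<integral>\<^sup>+x. \<integral>\<^sup>+t. ennreal (sin t) * indicator \<Omega> (x, t) * f (x, t) \<partial>lborel \<partial>lborel)"
    by (subst lborel.nn_integral_fst[symmetric]) (simp_all add: lborel_prod)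
  also have "\<dots> = (\<integral>\<^sup>+x. \<integral>\<^sup>+t. indicator {0..<P} x * (f (x, t) * ennreal (sin t) * indicator {0<..<pi} t) \<partial>lborel \<partial>lborel)"
    by (intro nn_integral_cong) (auto simp: phase_space_def mult_ac split: split_indicator)
  also have "\<dots> = (\<integral>\<^sup>+x. indicator {0..<P} x * (\<integral>\<^sup>+t. f (x, t) * ennreal (sin t) * indicator {0<..<pi} t \<partial>lborel) \<partial>lborel)"
    by (intro nn_integral_cong nn_integral_cmult) measurable
  finally show ?thesis .
qed

text \<open>The substitution t = \<open>ang x y\<close> on each fibre turns sin t dt into
  \<open>l12 x y\<close> dy.\<close>

lemma nn_integral_mu_chord_open:
  assumes [measurable]: "f \<in> borel_measurable borel"
  shows "(\<integral>\<^sup>+z. f z \<partial>mu)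
      = (\<integral>\<^sup>+x. indicator {0..<P} x * (\<integral>\<^sup>+y. f (x, ang x y) * ennreal (l12 x y) * indicator {x<..<x + P} y \<partial>lborel) \<partial>lborel)"
  unfolding nn_integral_mu[OF assms]
proof (rule nn_integral_cong)
  fix x
  have [measurable]: "f \<in> borel_measurable (borel \<Otimes>\<^sub>M borel)" by (simp add: borel_prod)
  have sin_cont: "continuous_on {x<..<x + P} (\<lambda>y. ncomp y x / (sinL x y)\<^sup>2)"
    unfolding ncomp_def sinL_def cosL_def
    using sinL_pos[OF curve_neq, of x] 
    by (intro continuous_intros continuous_curve) (force simp: sinL_def cosL_def)
  have "(\<integral>\<^sup>+t. f (x, t) * ennreal (sin t) * indicator {0<..<pi} t \<partial>lborel)
      = (\<integral>\<^sup>+t. f (x, t) * ennreal (sin t) * indicator (ang x ` {x<..<x + P}) t \<partial>lborel)"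
    by (simp add: ang_image)
  also have "\<dots> = (\<integral>\<^sup>+y. f (x, ang x y) * ennreal (sin (ang x y)) * ennreal (ncomp y x / (sinL x y)\<^sup>2) * indicator {x<..<x + P} y \<partial>lborel)"
  proof (rule nn_integral_substitution_open_interval)
    show "(\<lambda>t. f (x, t) * ennreal (sin t)) \<in> borel_measurable borel" by measurable
    show "(ang x has_real_derivative ncomp y x / (sinL x y)\<^sup>2) (at y)" if "x < y" "y < x + P" for y
      using ang_deriv2[OF curve_neq[OF that]] .
    show "0 < ncomp y x / (sinL x y)\<^sup>2" if "x < y" "y < x + P" for y
      using curve_neq[OF that] by (intro divide_pos_pos zero_less_power ncomp_pos sinL_pos) auto
  qed (use P_pos sin_cont in auto)
  also have "\<dots> = (\<integral>\<^sup>+y. f (x, ang x y) * ennreal (l12 x y) * indicator {x<..<x + P} y \<partial>lborel)"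
  proof (intro nn_integral_cong)
    fix y
    show "f (x, ang x y) * ennreal (sin (ang x y)) * ennreal (ncomp y x / (sinL x y)\<^sup>2) * indicator {x<..<x + P} y
      = f (x, ang x y) * ennreal (l12 x y) * indicator {x<..<x + P} y"
    proof (cases "y \<in> {x<..<x + P}")
      case True
      then have n: "\<gamma> x \<noteq> \<gamma> y" by (intro curve_neq) auto
      have "l12 x y = sin (ang x y) * (ncomp y x / (sinL x y)\<^sup>2)"
        by (simp add: l12_def sin_ang[OF n] power2_eq_square power3_eq_cube)
      moreover have "0 \<le> sin (ang x y)" "0 \<le> ncomp y x / (sinL x y)\<^sup>2"
        using ang_bounds[OF n] ncomp_pos[OF n[symmetric]] by (auto intro: sin_ge_zero)
      ultimately have "ennreal (l12 x y) = ennreal (sin (ang x y)) * ennreal (ncomp y x / (sinL x y)\<^sup>2)"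
        by (simp only: ennreal_mult)
      then show ?thesis by (simp only: mult.assoc)
    qed simp
  qed
  finally show "indicator {0..<P} x * (\<integral>\<^sup>+t. f (x, t) * ennreal (sin t) * indicator {0<..<pi} t \<partial>lborel)
     = indicator {0..<P} x * (\<integral>\<^sup>+y. f (x, ang x y) * ennreal (l12 x y) * indicator {x<..<x + P} y \<partial>lborel)"
    by (simp only:)
qed

definition offdiag :: "(real \<times> real) set" where
  "offdiag = {z. fst z \<in> {0..<P} \<and> snd z \<in> {0..<P} \<and> fst z \<noteq> snd z}"

lemma nn_integral_mu_chord:
  assumes [measurable]: "f \<in> borel_measurable borel"
  shows "(\<integral>\<^sup>+z. f z \<partial>mu)
      = (\<integral>\<^sup>+x. \<integral>\<^sup>+y. f (x, ang x y) * ennreal (l12 x y) * indicator offdiag (x, y) \<partial>lborel \<partial>lborel)"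
  unfolding nn_integral_mu_chord_open[OF assms]
proof (intro nn_integral_cong)
  fix x
  have [measurable]: "f \<in> borel_measurable (borel \<Otimes>\<^sub>M borel)" by (simp add: borel_prod)
  show "indicator {0..<P} x * (\<integral>\<^sup>+y. f (x, ang x y) * ennreal (l12 x y) * indicator {x<..<x + P} y \<partial>lborel)
     = (\<integral>\<^sup>+y. f (x, ang x y) * ennreal (l12 x y) * indicator offdiag (x, y) \<partial>lborel)"
  proof (cases "x \<in> {0..<P}")
    case True
    have "(\<integral>\<^sup>+y. f (x, ang x y) * ennreal (l12 x y) * indicator {x<..<x + P} y \<partial>lborel)
       = (\<integral>\<^sup>+y. f (x, ang x y) * ennreal (l12 x y) * indicator ({0..<P} - {x}) y \<partial>lborel)"
      using True by (intro nn_integral_period_shift) (auto simp: periodic_comps l12_def)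
    also have "\<dots> = (\<integral>\<^sup>+y. f (x, ang x y) * ennreal (l12 x y) * indicator offdiag (x, y) \<partial>lborel)"
      using True by (intro nn_integral_cong) (auto simp: offdiag_def split: split_indicator)
    finally show ?thesis using True by simp
  next
    case False
    then have "indicator offdiag (x, y) = (0 :: ennreal)" for y by (auto simp: offdiag_def)
    then show ?thesis using False by simp
  qed
qed

text \<open>Outside the phase space \<open>billiard_map\<close> is an unspecified value; \<open>Tm\<close> is a Borel function
  that agrees with it on the phase space.\<close>

definition Y where "Y z = (if z \<in> \<Omega> then fst (T z) else 0)"
definition Tm where "Tm z = (Y z, pi - ang (Y z) (fst z))"

lemma Tm_eq: "z \<in> \<Omega> \<Longrightarrow> Tm z = T z"
  by (erule phase_point) (auto simp: Tm_def Y_def phase_space_def ang_bounds)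

lemma Tm_ang: "x \<in> {0..<P} \<Longrightarrow> y \<in> {0..<P} \<Longrightarrow> x \<noteq> y \<Longrightarrow> Tm (x, ang x y) = (y, pi - ang y x)"
proof -
  assume a: "x \<in> {0..<P}" "y \<in> {0..<P}" "x \<noteq> y"
  then have "\<gamma> x \<noteq> \<gamma> y" using inj_onD[OF simple, of x y] by blast
  then have "(x, ang x y) \<in> \<Omega>" using a ang_bounds by (simp add: phase_space_def)
  then show ?thesis using Tm_eq billiard_map_ang[OF a] by simp
qed

text \<open>Seen from x, angles increase over the end points in (x, P) and then, past the base
  point, over [0, x). The first disjunct is the wrapped part, which starts at the angle of the chord
  to 0; the second is the part before wrapping. This gives measurability of \<open>Y\<close> from
  that of \<open>ang\<close>.\<close>

lemma Y_le_iff: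
  assumes z: "z \<in> \<Omega>" and c: "0 \<le> c" "c < P"
  shows "Y z \<le> c \<longleftrightarrow> (0 < fst z \<and> ang (fst z) 0 \<le> snd z \<and> (c < fst z \<longrightarrow> snd z \<le> ang (fst z) c))
    \<or> (fst z < c \<and> snd z \<le> ang (fst z) c)"
proof -
  obtain x y where xy: "x \<in> {0..<P}" "y \<in> {0..<P}" "x \<noteq> y" "z = (x, ang x y)" "T z = (y, pi - ang y x)"
    using phase_point[OF z] by metis
  have Yz: "Y z = y" using z xy by (simp add: Y_def)
  have mono: "ang x u < ang x v" if "x < u" "u < v" "v < x + P" for u v
    using that by (rule ang_strict_mono)
  have mono_iff: "ang x u \<le> ang x v \<longleftrightarrow> u \<le> v" if "x < u" "u < x + P" "x < v" "v < x + P" for u v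
    using mono[of u v] mono[of v u] that by (cases u v rule: linorder_cases) auto
  have sh: "ang x u = ang x (u + P)" for u by (simp add: periodic_comps)
  show ?thesis
  proof (cases "x < y")
    case True
    have 1: "0 < x \<Longrightarrow> \<not> ang x 0 \<le> ang x y" using sh[of 0] mono_iff[of "0 + P" y] True xy by auto
    have 2: "x < c \<Longrightarrow> ang x y \<le> ang x c \<longleftrightarrow> y \<le> c" using mono_iff[of y c] True xy c by auto
    show ?thesis unfolding Yz unfolding xy(4) fst_conv snd_conv using 1 2 True by linarith
  next
    case False
    then have yx: "y < x" using xy by auto
    have 1: "ang x 0 \<le> ang x y" using sh[of 0] sh[of y] mono_iff[of "0 + P" "y + P"] yx xy by auto
    have 2: "c < x \<Longrightarrow> ang x y \<le> ang x c \<longleftrightarrow> y \<le> c"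
      using sh[of c] sh[of y] mono_iff[of "y + P" "c + P"] yx xy c by auto
    have 3: "x < c \<Longrightarrow> \<not> ang x y \<le> ang x c" using sh[of y] mono_iff[of "y + P" c] yx xy c by auto
    have 4: "0 < x" using yx xy(2) by auto
    show ?thesis unfolding Yz unfolding xy(4) fst_conv snd_conv using 1 2 3 4 yx by linarith
  qed
qed

lemma Y_range: "0 \<le> Y z" "Y z < P"
proof -
  have "0 \<le> Y z \<and> Y z < P"
  proof (cases "z \<in> \<Omega>")
    case True
    then show ?thesis by (rule phase_point) (use True in \<open>simp add: Y_def\<close>)
  qed (simp add: Y_def P_pos)
  then show "0 \<le> Y z" "Y z < P" by auto
qed

lemma Y_measurable [measurable]: "Y \<in> borel_measurable borel"
proof (rule borel_measurable_iff_le[THEN iffD2], rule allI)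
  fix c :: real
  consider "c < 0" | "P \<le> c" | "0 \<le> c" "c < P" by linarith
  then show "{w \<in> space borel. Y w \<le> c} \<in> sets borel"
  proof cases
    case 1
    then have "{w \<in> space borel. Y w \<le> c} = {}" using Y_range(1) by (auto simp: not_le intro: less_le_trans)
    then show ?thesis by (simp only: sets.empty_sets)
  next
    case 2
    then have "{w \<in> space borel. Y w \<le> c} = UNIV" using Y_range(2) by (auto intro: less_imp_le less_le_trans)
    then show ?thesis by simp
  next
    case 3
    have "{w \<in> space borel. Y w \<le> c} = (\<Omega> \<inter> {z. (0 < fst z \<and> ang (fst z) 0 \<le> snd z \<and> (c < fst z \<longrightarrow> snd z \<le> ang (fst z) c))
      \<or> (fst z < c \<and> snd z \<le> ang (fst z) c)}) \<union> - \<Omega>"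
      using Y_le_iff[OF _ 3] 3 by (auto simp: Y_def)
    moreover have "{z :: real \<times> real. (0 < fst z \<and> ang (fst z) 0 \<le> snd z \<and> (c < fst z \<longrightarrow> snd z \<le> ang (fst z) c))
      \<or> (fst z < c \<and> snd z \<le> ang (fst z) c)} \<in> sets borel"
      by measurable
    ultimately show ?thesis by auto
  qed
qed

lemma Tm_measurable [measurable]: "Tm \<in> borel_measurable borel"
proof -
  have "Tm \<in> borel \<rightarrow>\<^sub>M borel \<Otimes>\<^sub>M borel" unfolding Tm_def[abs_def] by measurable
  then show ?thesis by (simp add: borel_prod)
qed

lemma R_measurable [measurable]: "R \<in> borel_measurable borel"
proof -
  have "R \<in> borel \<rightarrow>\<^sub>M borel \<Otimes>\<^sub>M borel" unfolding R_def[abs_def] by measurable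
  then show ?thesis by (simp add: borel_prod)
qed

lemma nn_integral_mu_R:
  assumes [measurable]: "f \<in> borel_measurable borel"
  shows "(\<integral>\<^sup>+z. f (R z) \<partial>mu) = (\<integral>\<^sup>+z. f z \<partial>mu)"
proof -
  have [measurable]: "f \<in> borel_measurable (borel \<Otimes>\<^sub>M borel)" by (simp add: borel_prod)
  have "(\<integral>\<^sup>+t. f (x, pi - t) * ennreal (sin t) * indicator {0<..<pi} t \<partial>lborel)
      = (\<integral>\<^sup>+t. f (x, t) * ennreal (sin t) * indicator {0<..<pi} t \<partial>lborel)" for x
    by (subst (2) nn_integral_real_affine[where c="-1" and t=pi])
      (auto intro!: nn_integral_cong split: split_indicator)
  moreover have "(\<lambda>z. f (fst z, pi - snd z)) \<in> borel_measurable borel" by measurable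
  ultimately show ?thesis by (simp add: nn_integral_mu R_def)
qed

text \<open>In chord coordinates \<open>T\<close> exchanges the two ends and then reverses time. The
  exchange preserves \<open>l12\<close> and \<open>offdiag\<close>, and time reversal preserves
  sin.\<close>

lemma nn_integral_mu_T:
  assumes [measurable]: "f \<in> borel_measurable borel"
  shows "(\<integral>\<^sup>+z. f (Tm z) \<partial>mu) = (\<integral>\<^sup>+z. f z \<partial>mu)"
proof -
  have [measurable]: "f \<in> borel_measurable (borel \<Otimes>\<^sub>M borel)" by (simp add: borel_prod)
  have [measurable]: "offdiag \<in> sets (borel \<Otimes>\<^sub>M borel)"
    unfolding offdiag_def borel_prod atLeastLessThan_iff by measurable
  have [measurable]: "offdiag \<in> sets borel" unfolding offdiag_def atLeastLessThan_iff by measurable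
  have sym: "l12 x y = l12 y x" for x y by (simp add: l12_def L_sym[of x y] mult.commute)
  have "(\<integral>\<^sup>+z. f (Tm z) \<partial>mu)
      = (\<integral>\<^sup>+x. \<integral>\<^sup>+y. f (Tm (x, ang x y)) * ennreal (l12 x y) * indicator offdiag (x, y) \<partial>lborel \<partial>lborel)"
    by (rule nn_integral_mu_chord) measurable
  also have "\<dots> = (\<integral>\<^sup>+x. \<integral>\<^sup>+y. f (R (y, ang y x)) * ennreal (l12 y x) * indicator offdiag (y, x) \<partial>lborel \<partial>lborel)"
    by (intro nn_integral_cong) (auto simp: offdiag_def Tm_ang R_def sym split: split_indicator)
  also have "\<dots> = (\<integral>\<^sup>+y. \<integral>\<^sup>+x. f (R (y, ang y x)) * ennreal (l12 y x) * indicator offdiag (y, x) \<partial>lborel \<partial>lborel)"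
    by (rule lborel_pair.Fubini') (simp add: R_def)
  also have "\<dots> = (\<integral>\<^sup>+z. f (R z) \<partial>mu)"
    by (rule nn_integral_mu_chord[symmetric]) measurable
  also have "\<dots> = (\<integral>\<^sup>+z. f z \<partial>mu)" by (rule nn_integral_mu_R) measurable
  finally show ?thesis .
qed

lemma emeasure_mu: "emeasure mu UNIV = ennreal (2 * P)"
proof -
  have "(\<integral>\<^sup>+t. ennreal (sin t) * indicator {0<..<pi} t \<partial>lborel) = (\<integral>\<^sup>+t. ennreal (sin t) * indicator {0..pi} t \<partial>lborel)"
    by (intro nn_integral_cong) (auto simp: indicator_def less_le)
  also have "\<dots> = ennreal (- cos pi - - cos 0)"
    by (intro nn_integral_FTC_Icc) (auto intro!: derivative_eq_intros sin_ge_zero)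
  finally have s: "(\<integral>\<^sup>+t. ennreal (sin t) * indicator {0<..<pi} t \<partial>lborel) = 2" by simp
  have "emeasure mu UNIV = (\<integral>\<^sup>+z. 1 \<partial>mu)" by simp
  also have "\<dots> = (\<integral>\<^sup>+x. indicator {0..<P} x * 2 \<partial>lborel)"
    by (subst nn_integral_mu) (simp_all add: s)
  also have "\<dots> = 2 * ennreal P" using P_pos by (subst nn_integral_multc) (simp_all add: mult.commute)
  finally show ?thesis using P_pos by (simp add: ennreal_mult)
qed

lemma finite_measure_mu: "finite_measure mu"
  by standard (simp add: emeasure_mu)

lemma AE_mu_Omega: "AE z in mu. z \<in> \<Omega>"
  unfolding mu_def by (subst AE_density) (auto split: split_indicator)

lemma measure_billiard_measure:
  assumes [measurable]: "B \<in> sets borel" and "B \<subseteq> \<Omega>"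
  shows "measure billiard_measure B = measure mu B"
proof -
  have "emeasure billiard_measure B = (\<integral>\<^sup>+z. ennreal (sin (snd z)) * indicator B z \<partial>lebesgue)"
    unfolding billiard_measure_def by (rule emeasure_density) (auto intro!: measurable_completion)
  also have "\<dots> = (\<integral>\<^sup>+z. ennreal (sin (snd z)) * indicator B z \<partial>lborel)"
    by (rule nn_integral_completion)
  also have "\<dots> = (\<integral>\<^sup>+z. ennreal (sin (snd z)) * indicator \<Omega> z * indicator B z \<partial>lborel)"
    using assms by (intro nn_integral_cong) (auto split: split_indicator)
  also have "\<dots> = emeasure mu B" unfolding mu_def by (rule emeasure_density[symmetric]) auto
  finally show ?thesis by (simp add: measure_def)
qed

section \<open>Borel versions of the chord length and of the Riccati solutions\<close>

definition chord where "chord x y = pi / 2 - arctan (cosL x y / sinL x y)"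

lemma chord_measurable [measurable]:
  assumes [measurable]: "f \<in> borel_measurable M" "g \<in> borel_measurable M"
  shows "(\<lambda>z. chord (f z) (g z)) \<in> borel_measurable M"
  unfolding chord_def by measurable

text \<open>Holds without restriction: on the diagonal \<open>sinL\<close> is 0, division by 0 gives
  0, and \<open>chord\<close> takes the value pi / 2.\<close>

lemma chord_bounds: "0 < chord x y" "chord x y < pi"
  using arctan_bounded[of "cosL x y / sinL x y"] by (auto simp: chord_def)

lemma arccos_cosL:
  assumes "\<gamma> x \<noteq> \<gamma> y"
  shows "arccos (cosL x y) = chord x y"
proof -
  have s: "0 < sinL x y" "(sinL x y)\<^sup>2 = 1 - (cosL x y)\<^sup>2" using sinL_pos[OF assms] sinL_sq[OF assms] by auto
  have "sqrt (1 + (cosL x y / sinL x y)\<^sup>2) = 1 / sinL x y"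
  proof -
    have "1 + (cosL x y / sinL x y)\<^sup>2 = (1 / sinL x y)\<^sup>2"
      using s by (simp add: power_divide field_simps)
    then show ?thesis using s(1) by (simp add: real_sqrt_divide)
  qed
  then have "cos (chord x y) = cosL x y" using s(1) by (simp add: chord_def cos_diff sin_arctan)
  then show ?thesis using chord_bounds[of x y] by (metis arccos_cos less_imp_le)
qed

definition lenm where "lenm z = chord (fst z) (Y z)"

lemma lenm_eq: "z \<in> \<Omega> \<Longrightarrow> lenm z = len z"
  by (erule phase_point) (simp add: lenm_def len_def arccos_cosL Y_def phase_space_def ang_bounds)

fun alpham :: "nat \<Rightarrow> real \<times> real \<Rightarrow> real" where
  "alpham 0 z = lenm z"
| "alpham (Suc j) z = lenm z - (pi / 2 - arctan (2 * k (fst (Tm z)) / sin (snd (Tm z)) - cot (alpham j (Tm z))))"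

declare alpham.simps(2) [simp del]

definition betam where "betam j z = pi / 2 - arctan (2 * k (fst z) / sin (snd z) - cot (alpham j z))"

lemma alpham_Suc: "alpham (Suc j) z = lenm z - betam j (Tm z)"
  by (simp add: alpham.simps(2) betam_def)

lemma alpham_eq: "z \<in> \<Omega> \<Longrightarrow> alpham j z = alpha j z"
  by (induction j arbitrary: z) (simp_all add: lenm_eq alpham.simps(2) Tm_eq T_in)

lemma alpham_measurable [measurable]: "alpham j \<in> borel_measurable borel"
proof (induction j)
  case 0
  have "alpham 0 = (\<lambda>z. chord (fst z) (Y z))" by (simp add: fun_eq_iff lenm_def)
  then show ?case by simp
next
  case (Suc j)
  note [measurable] = Suc
  have "alpham (Suc j) = (\<lambda>z. chord (fst z) (Y z) - (pi / 2 - arctan (2 * k (fst (Tm z)) / sin (snd (Tm z)) - cot (alpham j (Tm z)))))"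
    by (simp add: fun_eq_iff lenm_def alpham.simps(2))
  then show ?case by simp
qed

lemma betam_measurable [measurable]: "betam j \<in> borel_measurable borel"
  unfolding betam_def[abs_def] by measurable

lemma lenm_measurable [measurable]: "lenm \<in> borel_measurable borel"
  unfolding lenm_def[abs_def] by measurable

abbreviation Mset where "Mset \<equiv> m_set \<gamma> P"

lemma Mset_sub: "Mset \<subseteq> \<Omega>" by (auto simp: m_set_def)

lemma Tm_pow: "z \<in> \<Omega> \<Longrightarrow> (Tm ^^ n) z = (T ^^ n) z"
  by (induction n) (simp_all add: Tm_eq T_pow_in)

definition Tminv where "Tminv z = R (Tm (R z))"

lemma Tminv_pow: "z \<in> \<Omega> \<Longrightarrow> (Tminv ^^ n) z = (Tinv ^^ n) z"
  by (induction n) (simp_all add: Tminv_def Tm_eq Tinv_pow_in R_in Tinv_def)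

text \<open>Backward iterates are Borel maps by time reversal, so the criterion along the orbit is a
  countable intersection of Borel conditions.\<close>

lemma Mset_measurable [measurable]: "Mset \<in> sets borel"
proof -
  have eq: "Mset = \<Omega> \<inter> (\<Inter>j n. {z. 0 < alpham j ((Tm ^^ n) z)} \<inter> {z. 0 < alpham j ((Tminv ^^ n) z)})"
  proof (intro set_eqI iffI)
    fix z assume "z \<in> Mset"
    then have z: "z \<in> \<Omega>" "\<And>j n. 0 < alpha j (orb z n)" by (auto simp: m_set_iff)
    have "0 < alpham j ((Tm ^^ n) z)" for j n
      using z(2)[of j "int n"] z(1) by (simp add: Tm_pow alpham_eq T_pow_in orb_def)
    moreover have "0 < alpham j ((Tminv ^^ n) z)" for j n
    proof -
      have "orb z (- int n) = (Tinv ^^ n) z" by (cases "n = 0") (auto simp: orb_def)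
      then show ?thesis using z(2)[of j "- int n"] z(1) by (simp add: Tminv_pow alpham_eq Tinv_pow_in)
    qed
    ultimately show "z \<in> \<Omega> \<inter> (\<Inter>j n. {z. 0 < alpham j ((Tm ^^ n) z)} \<inter> {z. 0 < alpham j ((Tminv ^^ n) z)})"
      using z(1) by simp
  next
    fix z assume "z \<in> \<Omega> \<inter> (\<Inter>j n. {z. 0 < alpham j ((Tm ^^ n) z)} \<inter> {z. 0 < alpham j ((Tminv ^^ n) z)})"
    then have z: "z \<in> \<Omega>" "\<And>j n. 0 < alpham j ((Tm ^^ n) z)" "\<And>j n. 0 < alpham j ((Tminv ^^ n) z)" by auto
    have "0 < alpha j (orb z n)" for j n
      using z(2)[of j "nat n"] z(3)[of j "nat (- n)"] z(1)
      by (simp add: Tm_pow Tminv_pow alpham_eq T_pow_in Tinv_pow_in orb_def)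
    then show "z \<in> Mset" using z(1) by (simp add: m_set_iff)
  qed
  have [measurable]: "Tm ^^ n \<in> borel_measurable borel" "Tminv ^^ n \<in> borel_measurable borel" for n
    by (intro funpow_borel_measurable; simp add: Tminv_def[abs_def])+
  show ?thesis unfolding eq by measurable
qed

lemma orb_T: "z \<in> \<Omega> \<Longrightarrow> orb (T z) n = orb z (n + 1)"
  using orb_unique[of "\<lambda>n. orb z (n + 1)" "T z" n] orb_step[of z] orb_in[of z] orb_step[of z 0]
  by (simp add: orb_def[of z 0])

lemma Mset_T: "z \<in> \<Omega> \<Longrightarrow> T z \<in> Mset \<longleftrightarrow> z \<in> Mset"
proof -
  assume z: "z \<in> \<Omega>"
  have "(\<forall>n. Q (orb z (n + 1))) \<longleftrightarrow> (\<forall>n. Q (orb z n))" for Q :: "real \<times> real \<Rightarrow> bool"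
    by (metis diff_add_cancel)
  from this[of "\<lambda>w. \<forall>j. 0 < alpha j w"] show ?thesis using z by (simp add: m_set_iff T_in orb_T) blast
qed

lemma Mset_alpham:
  assumes "z \<in> Mset"
  shows "0 < alpham j z" "alpham j z < pi"
proof -
  have z: "z \<in> \<Omega>" using assms Mset_sub by auto
  have "0 < alpha j (orb z 0)" using assms by (simp add: m_set_iff)
  then show "0 < alpham j z" by (simp add: alpham_eq[OF z] orb_def)
  show "alpham j z < pi"
  proof (cases j)
    case 0
    then show ?thesis using chord_bounds by (simp add: lenm_def)
  next
    case (Suc i)
    have "0 < betam i (Tm z)" using arctan_bounded unfolding betam_def by auto
    moreover have "lenm z < pi" using chord_bounds by (simp add: lenm_def)
    ultimately show ?thesis by (simp add: Suc alpham_Suc)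
  qed
qed

lemma betam_bounds: "0 < betam j z" "betam j z < pi"
  using arctan_bounded[of "2 * k (fst z) / sin (snd z) - cot (alpham j z)"] unfolding betam_def by auto

definition mirror where "mirror z = 2 * arctan (sin (snd z) / k (fst z))"

lemma mirror_measurable [measurable]: "mirror \<in> borel_measurable borel"
  unfolding mirror_def[abs_def] by measurable

lemma mirror_bounds: "\<bar>mirror z\<bar> \<le> pi"
  using arctan_bounded[of "sin (snd z) / k (fst z)"] by (auto simp: mirror_def)

lemma mirror_le: "z \<in> Mset \<Longrightarrow> mirror z \<le> alpham j z + betam j z"
proof -
  assume z: "z \<in> Mset"
  then have "z \<in> \<Omega>" using Mset_sub by auto
  then have "0 < sin (snd z)" by (auto simp: phase_space_def intro: sin_gt_zero)
  then have "0 < k (fst z) / sin (snd z)" using curv_pos by simp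
  from arccot_add_ge[OF Mset_alpham[OF z, of j] this] show ?thesis
    by (simp add: mirror_def betam_def)
qed

lemma bounded_integrable_mu:
  fixes f :: "real \<times> real \<Rightarrow> real"
  assumes "f \<in> borel_measurable borel" "\<And>z. \<bar>f z\<bar> \<le> B"
  shows "integrable mu f"
proof -
  interpret finite_measure mu by (rule finite_measure_mu)
  show ?thesis using assms by (intro integrable_const_bound[of _ B]) auto
qed

lemma distr_mu_Tm: "distr mu borel Tm = mu"
proof (rule measure_eqI)
  fix A assume "A \<in> sets (distr mu borel Tm)"
  then have [measurable]: "A \<in> sets borel" by simp
  have "emeasure (distr mu borel Tm) A = emeasure mu (Tm -` A)" by (simp add: emeasure_distr)
  also have "\<dots> = (\<integral>\<^sup>+z. indicator A (Tm z) \<partial>mu)"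
  proof -
    have "Tm -` A \<in> sets borel" using measurable_sets[OF Tm_measurable, of A] by simp
    then have "emeasure mu (Tm -` A) = (\<integral>\<^sup>+z. indicator (Tm -` A) z \<partial>mu)" by simp
    then show ?thesis by (simp add: indicator_def)
  qed
  also have "\<dots> = (\<integral>\<^sup>+z. indicator A z \<partial>mu)" by (rule nn_integral_mu_T) measurable
  also have "\<dots> = emeasure mu A" by simp
  finally show "emeasure (distr mu borel Tm) A = emeasure mu A" .
qed simp

text \<open>Along an m-orbit the chord splits as \<open>len z = \<alpha>\<^sub>j\<^sub>+\<^sub>1 z + \<beta>\<^sub>j (T z)\<close>. Integrating over
  the invariant set of m-orbits and averaging over \<open>j < n\<close> telescopes, so the infinite-horizon
  solution of the Riccati recursion is not needed.\<close>

lemma integral_lenm_ge_mirror: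
  "(\<integral>z. indicator Mset z * mirror z \<partial>mu) \<le> (\<integral>z. indicator Mset z * lenm z \<partial>mu)"
proof -
  let ?I = "indicator Mset :: real \<times> real \<Rightarrow> real"
  define l where "l = (\<integral>z. ?I z * lenm z \<partial>mu)"
  define h where "h = (\<integral>z. ?I z * mirror z \<partial>mu)"
  define a where "a j = (\<integral>z. ?I z * alpham j z \<partial>mu)" for j
  define b where "b j = (\<integral>z. ?I z * betam j z \<partial>mu)" for j
  have il: "integrable mu (\<lambda>z. ?I z * lenm z)"
    using chord_bounds by (intro bounded_integrable_mu[where B=pi]) (auto simp: lenm_def less_imp_le abs_le_iff split: split_indicator intro: order_trans[of _ 0])
  have ih: "integrable mu (\<lambda>z. ?I z * mirror z)"
    using mirror_bounds by (intro bounded_integrable_mu[where B=pi]) (auto split: split_indicator)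
  have ia: "integrable mu (\<lambda>z. ?I z * alpham j z)" for j
    using Mset_alpham(1)[of _ j] Mset_alpham(2)[of _ j] by (intro bounded_integrable_mu[where B=pi])
      (auto simp: abs_of_pos less_imp_le indicator_def)
  have ib: "integrable mu (\<lambda>z. ?I z * betam j z)" for j
    using betam_bounds[of j] by (intro bounded_integrable_mu[where B=pi])
      (auto simp: abs_of_pos less_imp_le indicator_def)
  \<comment> \<open>Both invariances are used here: the indicator may be evaluated at
    \<open>z\<close> or at \<open>Tm z\<close>, and the integral of \<open>betam j\<close> composed
    with \<open>Tm\<close> over the m-orbits is that of \<open>betam j\<close>.\<close>
  have a_Suc: "a (Suc j) = l - b j" for j
  proof -
    have 1: "integrable mu (\<lambda>z. ?I (Tm z) * betam j (Tm z))"
      using ib[of j] by (subst (asm) distr_mu_Tm[symmetric]) (simp add: integrable_distr_eq)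
    have "a (Suc j) = (\<integral>z. ?I z * lenm z - ?I (Tm z) * betam j (Tm z) \<partial>mu)"
      unfolding a_def
    proof (rule integral_cong_AE)
      show "AE z in mu. ?I z * alpham (Suc j) z = ?I z * lenm z - ?I (Tm z) * betam j (Tm z)"
        using AE_mu_Omega
      proof eventually_elim
        case (elim z)
        then have "Tm z \<in> Mset \<longleftrightarrow> z \<in> Mset" by (simp add: Tm_eq Mset_T)
        then show ?case by (simp add: alpham_Suc split: split_indicator)
      qed
    qed measurable
    also have "\<dots> = l - (\<integral>z. ?I (Tm z) * betam j (Tm z) \<partial>mu)"
      unfolding l_def by (rule Bochner_Integration.integral_diff[OF il 1])
    also have "(\<integral>z. ?I (Tm z) * betam j (Tm z) \<partial>mu) = b j"
      unfolding b_def by (subst (2) distr_mu_Tm[symmetric]) (simp add: integral_distr)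
    finally show ?thesis .
  qed
  have hab: "h \<le> a j + b j" for j
  proof -
    have "h \<le> (\<integral>z. ?I z * alpham j z + ?I z * betam j z \<partial>mu)"
      unfolding h_def using mirror_le[of _ j]
      by (intro integral_mono ih Bochner_Integration.integrable_add ia ib) (auto split: split_indicator)
    then show ?thesis
      unfolding a_def b_def by (subst (asm) Bochner_Integration.integral_add[OF ia ib])
  qed
  have a_nonneg: "0 \<le> a j" for j
    unfolding a_def using Mset_alpham(1)[of _ j]
    by (intro integral_nonneg_AE AE_I2) (auto simp: less_imp_le split: split_indicator)
  have a0: "a 0 = l" by (simp add: a_def l_def)
  have step: "h - l \<le> a j - a (Suc j)" for j using hab[of j] a_Suc[of j] by simp
  have tel: "real n * (h - l) \<le> a 0 - a n" for n
  proof (induction n)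
    case (Suc n)
    then show ?case using step[of n] by (simp add: algebra_simps)
  qed simp
  \<comment> \<open>The partial sums stay below \<open>l\<close> because every \<open>a n\<close> is
    nonnegative, so the constant increment \<open>h - l\<close> cannot be positive.\<close>
  have bnd: "real n * (h - l) \<le> l" for n using tel[of n] a_nonneg[of n] a0 by simp
  have "h - l \<le> 0"
  proof (rule ccontr)
    assume "\<not> h - l \<le> 0"
    then obtain n :: nat where "l < real n * (h - l)" using reals_Archimedean3[of "h - l"] by auto
    then show False using bnd[of n] by simp
  qed
  then show ?thesis by (simp add: l_def h_def)
qed

lemma integral_mirror: "(\<integral>z. mirror z \<partial>mu) = 2 * pi * integral {0..P} (\<lambda>x. sqrt (1 + (k x)\<^sup>2) - k x)"
proof -
  have nonneg: "0 \<le> sqrt (1 + (k x)\<^sup>2) - k x" for x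
    using real_sqrt_ge_abs2[of "k x" 1] by (smt (verit) real_le_rsqrt)
  have cont: "continuous_on {0..P} (\<lambda>x. 2 * pi * (sqrt (1 + (k x)\<^sup>2) - k x))"
    by (intro continuous_intros continuous_curve)
  have fib: "(\<integral>\<^sup>+t. ennreal (mirror (x, t)) * ennreal (sin t) * indicator {0<..<pi} t \<partial>lborel)
      = ennreal (2 * pi * (sqrt (1 + (k x)\<^sup>2) - k x))" for x
  proof -
    have kp: "0 < k x" using curv_pos by simp
    have *: "0 \<le> arctan (1 / k x * sin t)" "0 \<le> sin t" if "0 \<le> t" "t \<le> pi" for t
      using kp sin_ge_zero[OF that] by auto
    have "(\<integral>\<^sup>+t. ennreal (mirror (x, t)) * ennreal (sin t) * indicator {0<..<pi} t \<partial>lborel)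
       = (\<integral>\<^sup>+t. ennreal (2 * (arctan (1 / k x * sin t) * sin t)) * indicator {0..pi} t \<partial>lborel)"
    proof (intro nn_integral_cong)
      fix t
      consider "t \<in> {0<..<pi}" | "t = 0" | "t = pi" | "t \<notin> {0..pi}" by fastforce
      then show "ennreal (mirror (x, t)) * ennreal (sin t) * indicator {0<..<pi} t
          = ennreal (2 * (arctan (1 / k x * sin t) * sin t)) * indicator {0..pi} t"
      proof cases
        case 1
        then show ?thesis using *[of t] by (simp add: mirror_def ennreal_mult[symmetric] mult.assoc)
      qed auto
    qed
    also have "\<dots> = ennreal (2 * (pi * (sqrt (1 + (1 / k x)\<^sup>2) - 1) / (1 / k x)))"
      using kp * by (intro nn_integral_has_integral_lebesgue' has_integral_mult_right integral_arctan_sin) auto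
    also have "2 * (pi * (sqrt (1 + (1 / k x)\<^sup>2) - 1) / (1 / k x)) = 2 * pi * (sqrt (1 + (k x)\<^sup>2) - k x)"
    proof -
      have "sqrt (1 + (1 / k x)\<^sup>2) = sqrt (1 + (k x)\<^sup>2) / k x"
      proof -
        have "1 + (1 / k x)\<^sup>2 = (1 + (k x)\<^sup>2) / (k x)\<^sup>2" using kp by (simp add: power_divide field_simps)
        then show ?thesis using kp by (simp add: real_sqrt_divide)
      qed
      then show ?thesis using kp by (simp add: field_simps)
    qed
    finally show ?thesis .
  qed
  have "(\<integral>\<^sup>+z. ennreal (mirror z) \<partial>mu) = (\<integral>\<^sup>+x. indicator {0..<P} x * ennreal (2 * pi * (sqrt (1 + (k x)\<^sup>2) - k x)) \<partial>lborel)"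
    by (subst nn_integral_mu) (simp_all add: fib)
  also have "\<dots> = (\<integral>\<^sup>+x. ennreal (2 * pi * (sqrt (1 + (k x)\<^sup>2) - k x)) * indicator {0..P} x \<partial>lborel)"
  proof (rule nn_integral_cong_AE)
    have "AE x in lborel. x \<noteq> P" by (rule AE_lborel_singleton)
    then show "AE x in lborel. indicator {0..<P} x * ennreal (2 * pi * (sqrt (1 + (k x)\<^sup>2) - k x))
       = ennreal (2 * pi * (sqrt (1 + (k x)\<^sup>2) - k x)) * indicator {0..P} x"
      by eventually_elim (auto simp: indicator_def)
  qed
  also have "\<dots> = ennreal (integral {0..P} (\<lambda>x. 2 * pi * (sqrt (1 + (k x)\<^sup>2) - k x)))"
    using nonneg by (intro nn_integral_has_integral_lebesgue' integrable_integral integrable_continuous_interval cont) auto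
  finally have nn: "(\<integral>\<^sup>+z. ennreal (mirror z) \<partial>mu) = ennreal (2 * pi * integral {0..P} (\<lambda>x. sqrt (1 + (k x)\<^sup>2) - k x))"
    by simp
  have "AE z in mu. 0 \<le> mirror z"
    using AE_mu_Omega
  proof eventually_elim
    case (elim z)
    then have "0 \<le> sin (snd z)" by (auto simp: phase_space_def intro: sin_ge_zero)
    then show ?case using curv_pos[rule_format, of "fst z"] by (simp add: mirror_def)
  qed
  then have "(\<integral>z. mirror z \<partial>mu) = enn2real (\<integral>\<^sup>+z. ennreal (mirror z) \<partial>mu)"
    by (intro integral_eq_nn_integral) auto
  then show ?thesis unfolding nn using nonneg
    by (simp add: integral_nonneg integrable_continuous_interval continuous_on_diff continuous_on_real_sqrt continuous_on_add continuous_on_power continuous_curve)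
qed

text \<open>Minkowski's inequality from its tangent form: pairing (1, k x) with the unit vector (P,
  K) / r gives sqrt (1 + (k x)^2) >= (P + K k x) / r pointwise, and the right-hand side integrates
  to r.\<close>

lemma integral_mirror_ge:
  assumes K: "K = integral {0..P} k"
  shows "2 * pi * (sqrt (P\<^sup>2 + K\<^sup>2) - K) \<le> (\<integral>z. mirror z \<partial>mu)"
proof -
  define r where "r = sqrt (P\<^sup>2 + K\<^sup>2)"
  have r: "0 < r" "r\<^sup>2 = P\<^sup>2 + K\<^sup>2" using P_pos by (auto simp: r_def add_pos_nonneg)
  have ik: "k integrable_on {0..P}" by (intro integrable_continuous_interval continuous_curve)
  have tangent: "(P + K * k x) / r - k x \<le> sqrt (1 + (k x)\<^sup>2) - k x" for x
  proof -
    have "(P + K * k x)\<^sup>2 + (P * k x - K)\<^sup>2 = r\<^sup>2 * (1 + (k x)\<^sup>2)"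
      unfolding r(2) by (simp add: power2_eq_square algebra_simps)
    then have "(P + K * k x)\<^sup>2 \<le> r\<^sup>2 * (1 + (k x)\<^sup>2)" by (smt (verit) zero_le_power2)
    then have "P + K * k x \<le> sqrt (r\<^sup>2 * (1 + (k x)\<^sup>2))" by (rule real_le_rsqrt)
    also have "\<dots> = r * sqrt (1 + (k x)\<^sup>2)" using r(1) by (simp add: real_sqrt_mult)
    finally show ?thesis using r(1) by (simp add: field_simps)
  qed
  have "((\<lambda>x. (P + K * k x) / r - k x) has_integral (P * P + K * K) / r - K) {0..P}"
  proof -
    have "((\<lambda>x. P) has_integral P * P) {0..P}" using has_integral_const_real[of P 0 P] P_pos by simp
    moreover have "(k has_integral K) {0..P}" unfolding K using ik by (rule integrable_integral)
    ultimately show ?thesis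
      by (intro has_integral_diff has_integral_divide has_integral_add has_integral_mult_right)
  qed
  moreover have "((\<lambda>x. sqrt (1 + (k x)\<^sup>2) - k x) has_integral integral {0..P} (\<lambda>x. sqrt (1 + (k x)\<^sup>2) - k x)) {0..P}"
    by (intro integrable_integral integrable_continuous_interval continuous_intros continuous_curve)
  ultimately have "(P * P + K * K) / r - K \<le> integral {0..P} (\<lambda>x. sqrt (1 + (k x)\<^sup>2) - k x)"
    by (rule has_integral_le) (rule tangent)
  moreover have "(P * P + K * K) / r = r" using r by (simp add: power2_eq_square[symmetric] field_simps)
  ultimately show ?thesis unfolding integral_mirror r_def[symmetric] by simp
qed

section \<open>Area, Gauss-Bonnet and Santalo\<close>

text \<open>The cone over \<open>D\<close> without its apex, unbounded in radius. Scale invariance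
  makes its indicator admissible in \<open>nn_integral_cone\<close>.\<close>

definition unitD where "unitD = {v. v \<noteq> 0 \<and> (1 / norm v) *\<^sub>R v \<in> D}"

lemma unitD_measurable [measurable]: "unitD \<in> sets borel"
proof -
  obtain U where U: "open U" "D = sphere 0 1 \<inter> U"
    using openin_inner_region by (auto simp: openin_open)
  have "unitD = {v. v \<noteq> 0} \<inter> (\<lambda>v. (1 / norm v) *\<^sub>R v) -` U"
    by (auto simp: unitD_def U(2))
  moreover have "(\<lambda>v::real^3. (1 / norm v) *\<^sub>R v) -` U \<in> sets borel"
    using U(1) measurable_sets[of "\<lambda>v::real^3. (1 / norm v) *\<^sub>R v" borel borel U] by simp
  moreover have "{v::real^3. v \<noteq> 0} \<in> sets borel" by measurable
  ultimately show ?thesis by (simp add: sets.Int)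
qed

lemma unitD_scale: "0 < s \<Longrightarrow> s *\<^sub>R v \<in> unitD \<longleftrightarrow> v \<in> unitD"
  by (simp add: unitD_def)

lemma unitD_nu: "v \<in> unitD \<Longrightarrow> 0 < v \<bullet> nu x"
  using inner_region_nu_pos[of "(1 / norm v) *\<^sub>R v" x] by (auto simp: unitD_def zero_less_divide_iff)

text \<open>For s > 0 the direction is interior to the chord. For s < 0 the identity can be solved
  for \<open>\<gamma> y\<close>, which would become a positive combination of an interior point and
  \<open>\<gamma> x\<close>, hence itself interior.\<close>

lemma chord_ray_in_unitD_iff:
  assumes "\<gamma> x \<noteq> \<gamma> y"
  shows "\<gamma> y + s *\<^sub>R \<gamma> x \<in> unitD \<longleftrightarrow> 0 < s"
proof
  define v where "v = \<gamma> y + s *\<^sub>R \<gamma> x"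
  {
    assume s: "0 < s"
    have v0: "v \<noteq> 0"
      using hemisphere s by (metis add_pos_pos inner_add_left inner_scaleR_left inner_zero_left less_irrefl mult_pos_pos v_def)
    then have n: "norm ((1 / norm v) *\<^sub>R v) = 1" by simp
    have eq: "(1 / norm v) *\<^sub>R v = (s / norm v) *\<^sub>R \<gamma> x + (1 / norm v) *\<^sub>R \<gamma> y"
      by (simp add: v_def scaleR_add_right)
    have "(1 / norm v) *\<^sub>R v \<in> D"
      using s v0 by (intro inner_region_comb[OF curve_in_closure curve_in_closure assms _ _ eq n]) auto
    then show "v \<in> unitD" using v0 by (simp add: unitD_def)
  }
  {
    assume v: "v \<in> unitD"
    show "0 < s"
    proof (rule ccontr)
      assume "\<not> 0 < s"
      define u where "u = (1 / norm v) *\<^sub>R v"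
      have u: "u \<in> D" and v0: "v \<noteq> 0" using v by (auto simp: unitD_def u_def)
      have uc: "u \<notin> range \<gamma>" using u inner_region_subset(1) by auto
      have "\<gamma> y \<in> D"
      proof (cases "s = 0")
        case True
        then have "u = \<gamma> y" using on_sphere by (simp add: u_def v_def)
        then show ?thesis using u by simp
      next
        case False
        then have s: "0 < - s" using \<open>\<not> 0 < s\<close> by simp
        have eq: "\<gamma> y = norm v *\<^sub>R u + (- s) *\<^sub>R \<gamma> x" using v0 by (simp add: u_def v_def)
        have "u \<in> closure D" using u closure_subset by blast
        moreover have "u \<noteq> \<gamma> x" using uc by auto
        ultimately show ?thesis using s v0 on_sphere
          by (intro inner_region_comb[OF _ curve_in_closure _ _ _ eq]) auto
      qed
      then show False using inner_region_subset(1) by auto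
    qed
  }
qed

text \<open>Polar integration about \<open>\<gamma> x\<close>: each half great circle into the
  region leaves it at exactly one \<open>\<gamma> y\<close>, so \<open>y\<close> replaces the polar
  angle. The condition w > cosL / sinL, that is cot r > cot L, expresses that the point lies before
  the exit.\<close>

lemma cone_integral:
  fixes \<phi> :: "real^3 \<Rightarrow> ennreal"
  assumes [measurable]: "\<phi> \<in> borel_measurable borel" and hom: "\<And>s v. 0 < s \<Longrightarrow> \<phi> (s *\<^sub>R v) = \<phi> v"
  shows "3 * (\<integral>\<^sup>+v. \<phi> v * indicator (unitD \<inter> cball 0 1) v \<partial>lborel)
    = (\<integral>\<^sup>+y. (\<integral>\<^sup>+w. \<phi> (\<gamma> y + (sinL x y * w - cosL x y) *\<^sub>R \<gamma> x) * ennreal (1 / sqrt (1 + w\<^sup>2) ^ 3)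
         * indicator {cosL x y / sinL x y<..} w \<partial>lborel) * ennreal (ncomp y x / (sinL x y)\<^sup>2) * indicator {x<..<x + P} y \<partial>lborel)"
proof -
  define f where "f v = \<phi> v * indicator unitD v" for v
  have [measurable]: "f \<in> borel_measurable borel" unfolding f_def[abs_def] by measurable
  have fhom: "f (s *\<^sub>R v) = f v" if "0 < s" for s v
    using that hom by (simp add: f_def unitD_scale indicator_def)
  define G where "G q = (\<integral>\<^sup>+w. f ((sqrt (1 + q\<^sup>2) * w) *\<^sub>R \<gamma> x + q *\<^sub>R \<tau> x + nu x) * ennreal (1 / (1 + q\<^sup>2) * (1 / sqrt (1 + w\<^sup>2) ^ 3)) \<partial>lborel)" for q
  have [measurable]: "G \<in> borel_measurable borel" unfolding G_def[abs_def] by measurable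
  have "3 * (\<integral>\<^sup>+v. \<phi> v * indicator (unitD \<inter> cball 0 1) v \<partial>lborel)
      = 3 * (\<integral>\<^sup>+v. f v * indicator {v. 0 < v \<bullet> nu x \<and> norm v \<le> 1} v \<partial>lborel)"
    using unitD_nu by (intro arg_cong[where f="\<lambda>u. 3 * u"], intro nn_integral_cong) (auto simp: f_def indicator_def)
  also have "\<dots> = (\<integral>\<^sup>+q. G q \<partial>lborel)"
    unfolding G_def using nu_facts[of x] frame[of x]
    by (intro nn_integral_cone fhom) auto
  \<comment> \<open>The slope tcomp / ncomp decreases in \<open>y\<close>, while the substitution
    rule wants an increasing function.\<close>
  also have "\<dots> = (\<integral>\<^sup>+q. G (- q) \<partial>lborel)"
    by (subst nn_integral_real_affine[where c="-1" and t=0]) auto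
  also have "\<dots> = (\<integral>\<^sup>+q. G (- q) * indicator ((\<lambda>y. - (tcomp x y / ncomp x y)) ` {x<..<x + P}) q \<partial>lborel)"
  proof -
    have "(\<lambda>y. - (tcomp x y / ncomp x y)) ` {x<..<x + P} = uminus ` UNIV"
      unfolding ratio_surj[of x, symmetric] image_image ..
    then show ?thesis by simp
  qed
  also have "\<dots> = (\<integral>\<^sup>+y. G (- (- (tcomp x y / ncomp x y))) * ennreal (ncomp y x / (ncomp x y)\<^sup>2) * indicator {x<..<x + P} y \<partial>lborel)"
  proof (rule nn_integral_substitution_open_interval)
    fix y assume "x < y" "y < x + P"
    then have n: "\<gamma> x \<noteq> \<gamma> y" by (rule curve_neq)
    show "((\<lambda>y. - (tcomp x y / ncomp x y)) has_real_derivative ncomp y x / (ncomp x y)\<^sup>2) (at y)"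
      using DERIV_minus[OF ratio_deriv[OF n]] by simp
    show "0 < ncomp y x / (ncomp x y)\<^sup>2"
      using n by (intro divide_pos_pos zero_less_power ncomp_pos) auto
  next
    have "ncomp x y \<noteq> 0" if "y \<in> {x<..<x + P}" for y
      using ncomp_pos[OF curve_neq, of x y] that by auto
    then show "continuous_on {x<..<x + P} (\<lambda>y. ncomp y x / (ncomp x y)\<^sup>2)"
      unfolding ncomp_def by (intro continuous_intros continuous_curve) auto
  qed (use P_pos in auto)
  also have "\<dots> = (\<integral>\<^sup>+y. (\<integral>\<^sup>+w. \<phi> (\<gamma> y + (sinL x y * w - cosL x y) *\<^sub>R \<gamma> x) * ennreal (1 / sqrt (1 + w\<^sup>2) ^ 3)
         * indicator {cosL x y / sinL x y<..} w \<partial>lborel) * ennreal (ncomp y x / (sinL x y)\<^sup>2) * indicator {x<..<x + P} y \<partial>lborel)"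
  proof (intro nn_integral_cong)
    fix y
    show "G (- (- (tcomp x y / ncomp x y))) * ennreal (ncomp y x / (ncomp x y)\<^sup>2) * indicator {x<..<x + P} y
      = (\<integral>\<^sup>+w. \<phi> (\<gamma> y + (sinL x y * w - cosL x y) *\<^sub>R \<gamma> x) * ennreal (1 / sqrt (1 + w\<^sup>2) ^ 3)
         * indicator {cosL x y / sinL x y<..} w \<partial>lborel) * ennreal (ncomp y x / (sinL x y)\<^sup>2) * indicator {x<..<x + P} y"
    proof (cases "y \<in> {x<..<x + P}")
      case True
      then have n: "\<gamma> x \<noteq> \<gamma> y" by (intro curve_neq) auto
      define N S C r where "N = ncomp x y" and "S = sinL x y" and "C = cosL x y" and "r = tcomp x y / ncomp x y"
      have N: "0 < N" and S: "0 < S" using ncomp_pos[OF n] sinL_pos[OF n] by (auto simp: N_def S_def)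
      have N': "0 < ncomp y x" using ncomp_pos n by metis
      have sr: "sqrt (1 + r\<^sup>2) = S / N" using sqrt_ratio[OF n] by (simp add: r_def S_def N_def)
      then have sr2: "1 + r\<^sup>2 = (S / N)\<^sup>2" by (metis add_nonneg_nonneg real_sqrt_pow2 zero_le_one zero_le_power2)
      \<comment> \<open>Up to the positive factor 1 / N, the point with coordinates (q, w) lies in
        the plane of the chord, on the ray decided by \<open>chord_ray_in_unitD_iff\<close>.\<close>
      have vec: "(sqrt (1 + r\<^sup>2) * w) *\<^sub>R \<gamma> x + r *\<^sub>R \<tau> x + nu x = (1 / N) *\<^sub>R (\<gamma> y + (S * w - C) *\<^sub>R \<gamma> x)" for w
      proof -
        have "\<gamma> y = C *\<^sub>R \<gamma> x + (N * r) *\<^sub>R \<tau> x + N *\<^sub>R nu x"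
          using frame_expand[of "\<gamma> y" x] N by (simp add: C_def cosL_def N_def r_def ncomp_def tcomp_def inner_commute)
        then show ?thesis unfolding sr using N by (simp add: algebra_simps)
      qed
      have f: "f ((sqrt (1 + r\<^sup>2) * w) *\<^sub>R \<gamma> x + r *\<^sub>R \<tau> x + nu x)
          = \<phi> (\<gamma> y + (S * w - C) *\<^sub>R \<gamma> x) * indicator {C / S<..} w" for w
      proof -
        have "(0 < S * w - C) \<longleftrightarrow> C / S < w" using S by (simp add: field_simps)
        then show ?thesis
          unfolding vec using N by (subst fhom) (auto simp: f_def chord_ray_in_unitD_iff[OF n] indicator_def)
      qed
      have "G r = (\<integral>\<^sup>+w. ennreal (1 / (S / N)\<^sup>2) * (\<phi> (\<gamma> y + (S * w - C) *\<^sub>R \<gamma> x) * ennreal (1 / sqrt (1 + w\<^sup>2) ^ 3) * indicator {C / S<..} w) \<partial>lborel)"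
        unfolding G_def f unfolding sr2 by (intro nn_integral_cong, subst ennreal_mult) (auto simp: mult_ac)
      also have "\<dots> = ennreal (1 / (S / N)\<^sup>2) * (\<integral>\<^sup>+w. (\<phi> (\<gamma> y + (S * w - C) *\<^sub>R \<gamma> x) * ennreal (1 / sqrt (1 + w\<^sup>2) ^ 3) * indicator {C / S<..} w) \<partial>lborel)"
        by (rule nn_integral_cmult) measurable
      finally have "G r * ennreal (ncomp y x / N\<^sup>2)
         = (\<integral>\<^sup>+w. (\<phi> (\<gamma> y + (S * w - C) *\<^sub>R \<gamma> x) * ennreal (1 / sqrt (1 + w\<^sup>2) ^ 3) * indicator {C / S<..} w) \<partial>lborel)
           * (ennreal (1 / (S / N)\<^sup>2) * ennreal (ncomp y x / N\<^sup>2))"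
        by (simp only: mult_ac)
      also have "ennreal (1 / (S / N)\<^sup>2) * ennreal (ncomp y x / N\<^sup>2) = ennreal (ncomp y x / S\<^sup>2)"
        using N S N' by (subst ennreal_mult[symmetric]) (auto simp: power_divide)
      finally show ?thesis using True by (simp add: r_def N_def S_def C_def)
    qed simp
  qed
  finally show ?thesis .
qed

definition total_curv where "total_curv = integral {0..P} k"

text \<open>The cone in \<open>sph_area\<close> and the truncated cone differ at most by the apex.
  As a set not known to be Borel beforehand, the former is compared in the Lebesgue measure.\<close>

lemma sph_area_eq: "ennreal (sph_area D) = 3 * emeasure lborel (unitD \<inter> cball 0 1)"
proof -
  let ?N = "unitD \<inter> cball 0 1"
  define cone where "cone = {t *\<^sub>R v | t v. 0 \<le> t \<and> t \<le> 1 \<and> v \<in> D}"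
  have N0: "?N \<subseteq> cone"
  proof
    fix v assume v: "v \<in> ?N"
    then have "v = norm v *\<^sub>R ((1 / norm v) *\<^sub>R v)" by (auto simp: unitD_def)
    then show "v \<in> cone" using v unfolding cone_def mem_Collect_eq
      by (intro exI[of _ "norm v"] exI[of _ "(1 / norm v) *\<^sub>R v"]) (auto simp: unitD_def)
  qed
  have "cone - {0} \<subseteq> ?N"
  proof
    fix w assume "w \<in> cone - {0}"
    then obtain t v where t: "w = t *\<^sub>R v" "0 < t" "t \<le> 1" "v \<in> D" by (auto simp: cone_def less_le)
    moreover have "norm v = 1" using t(4) inner_region_subset(1) by auto
    ultimately show "w \<in> ?N" by (auto simp: unitD_def)
  qed
  then have eq: "cone = ?N \<union> (cone \<inter> {0})" using N0 by auto
  have [measurable]: "?N \<in> sets borel" by measurable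
  have "cone \<inter> {0} \<in> null_sets lebesgue"
  proof -
    have "{0::real^3} \<in> null_sets lebesgue" by (simp add: null_sets_completionI)
    then show ?thesis by (cases "0 \<in> cone") (simp_all add: Int_insert_right)
  qed
  then have "emeasure lebesgue cone = emeasure lebesgue ?N"
    by (subst eq) (rule emeasure_Un_null_set, auto)
  also have "\<dots> = emeasure lborel ?N" by (simp add: emeasure_completion)
  finally have e: "emeasure lebesgue cone = emeasure lborel ?N" .
  have "emeasure lborel ?N \<le> emeasure lborel (cball (0::real^3) 1)" by (intro emeasure_mono) auto
  also have "\<dots> < \<infinity>" by (intro emeasure_bounded_finite) auto
  finally have "emeasure lborel ?N \<noteq> \<infinity>" by simp
  then have "ennreal (measure lebesgue cone) = emeasure lborel ?N"
    by (simp add: measure_def e less_top)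
  then show ?thesis by (simp add: sph_area_def cone_def[symmetric] ennreal_mult)
qed

lemma sph_area_nonneg: "0 \<le> sph_area D" by (simp add: sph_area_def)

text \<open>Gauss-Bonnet: in polar coordinates about \<open>\<gamma> 0\<close> the area integrand is the derivative of
  the angle defect \<open>ang 0 y - ang y 0 - \<integral> k\<close> of the lune cut off by the chord from \<open>0\<close> to \<open>y\<close>.\<close>

lemma sph_area_gauss_bonnet: "sph_area D = 2 * pi - total_curv"
proof -
  define \<Phi> where "\<Phi> y = ang 0 y - ang y 0 - integral {0..y} k" for y
  define f where "f y = (1 - cosL 0 y) * (ncomp y 0 / (sinL 0 y)\<^sup>2)" for y
  have neq: "\<gamma> 0 \<noteq> \<gamma> y" if "0 < y" "y < P" for y using curve_neq[of 0 y] that by simp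
  have dk: "((\<lambda>y. integral {0..y} k) has_real_derivative k y) (at y)" if "0 < y" "y < P" for y
  proof -
    have "((\<lambda>y. integral {0..y} k) has_real_derivative k y) (at y within {0..P})"
      using integral_has_real_derivative[where a=0 and b=P and t=y, OF continuous_curve(4)] that by simp
    moreover have "at y within {0..P} = at y"
      using that by (intro at_within_interior) simp
    ultimately show ?thesis by simp
  qed
  have ci: "continuous_on {0..P} (\<lambda>y. integral {0..y} k)"
    by (intro indefinite_integral_continuous_1 integrable_continuous_interval continuous_curve)
  have lim0: "((\<lambda>y. integral {0..y} k) \<longlongrightarrow> 0) (at_right 0)"
  proof -
    have "((\<lambda>y. integral {0..y} k) \<longlongrightarrow> integral {0..0} k) (at 0 within {0..P})"
      using bspec[OF ci[unfolded continuous_on_def], of 0] P_pos by simp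
    then show ?thesis using P_pos by (simp add: at_within_Icc_at_right)
  qed
  have limP: "((\<lambda>y. integral {0..y} k) \<longlongrightarrow> total_curv) (at_left P)"
  proof -
    have "((\<lambda>y. integral {0..y} k) \<longlongrightarrow> integral {0..P} k) (at P within {0..P})"
      using bspec[OF ci[unfolded continuous_on_def], of P] P_pos by simp
    then show ?thesis using P_pos by (simp add: at_within_Icc_at_left total_curv_def)
  qed
  have der: "(\<Phi> has_real_derivative f y) (at y)" if "0 < y" "y < P" for y
  proof -
    have "(\<Phi> has_real_derivative (ncomp y 0 / (sinL 0 y)\<^sup>2 - - (k y - ncomp y 0 * cosL 0 y / (sinL 0 y)\<^sup>2) - k y)) (at y)"
      unfolding \<Phi>_def[abs_def]
      by (intro DERIV_diff ang_deriv2 ang_deriv1 dk neq that)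
    moreover have "ncomp y 0 / (sinL 0 y)\<^sup>2 - - (k y - ncomp y 0 * cosL 0 y / (sinL 0 y)\<^sup>2) - k y = f y"
      unfolding f_def left_diff_distrib by simp
    ultimately show ?thesis by simp
  qed
  have cont: "continuous_on {0<..<P} f"
  proof -
    have "sinL 0 y \<noteq> 0" if "y \<in> {0<..<P}" for y using sinL_pos[OF neq, of y] that by auto
    then show ?thesis unfolding f_def[abs_def] ncomp_def sinL_def cosL_def
      by (intro continuous_intros continuous_curve) auto
  qed
  have nonneg: "0 \<le> f y" if "0 < y" "y < P" for y
    using cosL_bounds[OF neq[OF that]] ncomp_pos[OF neq[OF that, symmetric]] by (simp add: f_def)
  \<comment> \<open>At both ends the chord degenerates along the tangent: the difference of the two
    angles starts at -pi and ends at pi, which accounts for the term 2 pi.\<close>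
  have A: "(\<Phi> \<longlongrightarrow> 0 - pi - 0) (at_right 0)"
    unfolding \<Phi>_def[abs_def] by (intro tendsto_intros ang_lim lim0)
  have B: "(\<Phi> \<longlongrightarrow> pi - 0 - total_curv) (at_left P)"
    unfolding \<Phi>_def[abs_def] using ang_lim[of 0] by (intro tendsto_intros limP) simp_all
  note FTC = nn_integral_FTC_open[OF P_pos der cont nonneg A B]
  have "3 * emeasure lborel (unitD \<inter> cball 0 1) = 3 * (\<integral>\<^sup>+v. 1 * indicator (unitD \<inter> cball 0 1) v \<partial>lborel)"
    by simp
  also have "\<dots> = (\<integral>\<^sup>+y. (\<integral>\<^sup>+w. 1 * ennreal (1 / sqrt (1 + w\<^sup>2) ^ 3)
         * indicator {cosL 0 y / sinL 0 y<..} w \<partial>lborel) * ennreal (ncomp y 0 / (sinL 0 y)\<^sup>2) * indicator {0<..<0 + P} y \<partial>lborel)"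
    by (rule cone_integral) auto
  also have "\<dots> = (\<integral>\<^sup>+y. ennreal (f y) * indicator {0<..<P} y \<partial>lborel)"
  proof (intro nn_integral_cong)
    fix y
    show "(\<integral>\<^sup>+w. 1 * ennreal (1 / sqrt (1 + w\<^sup>2) ^ 3)
         * indicator {cosL 0 y / sinL 0 y<..} w \<partial>lborel) * ennreal (ncomp y 0 / (sinL 0 y)\<^sup>2) * indicator {0<..<0 + P} y
      = ennreal (f y) * indicator {0<..<P} y"
    proof (cases "y \<in> {0<..<P}")
      case True
      then have n: "\<gamma> 0 \<noteq> \<gamma> y" using neq by auto
      have "(\<integral>\<^sup>+w. 1 * ennreal (1 / sqrt (1 + w\<^sup>2) ^ 3) * indicator {cosL 0 y / sinL 0 y<..} w \<partial>lborel)
          = ennreal (1 - cosL 0 y)"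
        unfolding nn_integral_Ioi_Ici mult_1 using sinL_pos[OF n] sinL_sq[OF n] by (intro nn_integral_Ici_inverse_powers) auto
      moreover have "0 \<le> 1 - cosL 0 y" "0 \<le> ncomp y 0 / (sinL 0 y)\<^sup>2"
        using cosL_bounds[OF n] ncomp_pos[OF n[symmetric]] by auto
      ultimately show ?thesis using True by (simp only: f_def ennreal_mult add_0)
    qed simp
  qed
  also have "\<dots> = ennreal (2 * pi - total_curv)"
    using FTC(1) by (simp add: algebra_simps)
  finally show ?thesis using FTC(2) sph_area_nonneg unfolding sph_area_eq[symmetric] by simp
qed

lemma lenm_ang:
  assumes "x \<in> {0..<P}" "y \<in> {x<..<x + P}"
  shows "lenm (x, ang x y) = chord x y"
proof -
  define y' where "y' = (if y < P then y else y - P)"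
  have y': "y' \<in> {0..<P}" "x \<noteq> y'" using assms by (auto simp: y'_def)
  have "ang x y' = ang x y" "chord x y' = chord x y"
    using periodic_comps(1,2,5)[of x "y - P"] by (auto simp: y'_def chord_def)
  moreover have "Y (x, ang x y') = y'" using Tm_ang[OF assms(1) y'] by (simp add: Tm_def)
  ultimately show ?thesis by (simp add: lenm_def)
qed

text \<open>The integrand is homogeneous of degree 0 in \<open>v\<close>, so \<open>v\<close> may be
  normalised; it is then the one in \<open>winding_integral_le\<close>. The antipode is off the
  curve because it lies in the opposite hemisphere.\<close>

lemma nn_integral_visual_angle_le:
  assumes "v \<in> unitD"
  shows "(\<integral>\<^sup>+x. ennreal ((v \<bullet> nu x) * norm v / ((norm v)\<^sup>2 - (v \<bullet> \<gamma> x)\<^sup>2)) * indicator {0..<P} x \<partial>lborel) \<le> ennreal (2 * pi)"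
proof -
  define u where "u = (1 / norm v) *\<^sub>R v"
  have u: "u \<in> D" and v0: "v \<noteq> 0" using assms by (auto simp: unitD_def u_def)
  have u1: "norm u = 1" using v0 by (simp add: u_def)
  have off: "\<gamma> x \<noteq> u" "\<gamma> x \<noteq> - u" for x
  proof -
    show "\<gamma> x \<noteq> u" using u inner_region_subset(1) by auto
    show "\<gamma> x \<noteq> - u"
    proof
      assume "\<gamma> x = - u"
      then have "\<gamma> x \<bullet> e = - (u \<bullet> e)" by simp
      then show False using hemisphere[rule_format, of x] inner_region_subset(2)[OF u] by simp
    qed
  qed
  have eq: "(v \<bullet> nu x) * norm v / ((norm v)\<^sup>2 - (v \<bullet> \<gamma> x)\<^sup>2) = (u \<bullet> nu x) / (1 - (u \<bullet> \<gamma> x)\<^sup>2)" for x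
  proof -
    have "v = norm v *\<^sub>R u" using v0 by (simp add: u_def)
    then have i: "v \<bullet> w = norm v * (u \<bullet> w)" for w by (metis inner_scaleR_left)
    have "(v \<bullet> nu x) * norm v = (norm v)\<^sup>2 * (u \<bullet> nu x)"
      "(norm v)\<^sup>2 - (v \<bullet> \<gamma> x)\<^sup>2 = (norm v)\<^sup>2 * (1 - (u \<bullet> \<gamma> x)\<^sup>2)"
      by (simp_all add: i power2_eq_square algebra_simps)
    then show ?thesis using v0 by simp
  qed
  obtain I where I: "((\<lambda>x. (u \<bullet> nu x) / (1 - (u \<bullet> \<gamma> x)\<^sup>2)) has_integral I) {0..P}" "\<bar>I\<bar> \<le> 2 * pi"
    using winding_integral_le[OF u1 off] by blast
  have nonneg: "0 \<le> (u \<bullet> nu x) / (1 - (u \<bullet> \<gamma> x)\<^sup>2)" for x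
  proof -
    have "\<bar>u \<bullet> \<gamma> x\<bar> \<le> 1" using Cauchy_Schwarz_ineq2[of u "\<gamma> x"] u1 on_sphere by simp
    then have "(u \<bullet> \<gamma> x)\<^sup>2 \<le> 1" by (simp add: abs_square_le_1)
    then show ?thesis using inner_region_nu_pos[OF u, of x] by (simp add: divide_nonneg_nonneg)
  qed
  have "(\<integral>\<^sup>+x. ennreal ((v \<bullet> nu x) * norm v / ((norm v)\<^sup>2 - (v \<bullet> \<gamma> x)\<^sup>2)) * indicator {0..<P} x \<partial>lborel)
      \<le> (\<integral>\<^sup>+x. ennreal ((u \<bullet> nu x) / (1 - (u \<bullet> \<gamma> x)\<^sup>2)) * indicator {0..P} x \<partial>lborel)"
    unfolding eq by (intro nn_integral_mono) (auto simp: indicator_def)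
  also have "\<dots> = ennreal I" using nonneg by (intro nn_integral_has_integral_lebesgue' I(1))
  also have "\<dots> \<le> ennreal (2 * pi)" using I(2) by (intro ennreal_leI) simp
  finally show ?thesis .
qed

text \<open>Santalo's formula, as an inequality: writing the chord length as an integral along the chord
  and passing to polar coordinates about each \<open>\<gamma> x\<close> turns the left-hand side into the integral
  over the region of the angle under which the boundary is seen from an interior point.\<close>

lemma integral_lenm_le: "(\<integral>z. lenm z \<partial>mu) \<le> 2 * pi * sph_area D"
proof -
  \<comment> \<open>With r the distance from \<open>\<gamma> x\<close> to the direction of
    \<open>v\<close>, \<open>h x v\<close> is sin phi / sin r: the rate in \<open>x\<close> of the
    visual angle at \<open>v\<close>. Its denominator cancels the polar area element sin r dr, which
    leaves sin phi times the length of the chord.\<close>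
  define h where "h x v = ennreal ((v \<bullet> nu x) * norm v / ((norm v)\<^sup>2 - (v \<bullet> \<gamma> x)\<^sup>2))" for x v
  have hm: "(\<lambda>z. h (f z) (g z)) \<in> borel_measurable M"
    if [measurable]: "f \<in> borel_measurable M" "g \<in> borel_measurable M" for f g and M :: "'m measure"
    unfolding h_def by measurable
  let ?N = "unitD \<inter> cball 0 1"
  have hom: "h x (s *\<^sub>R v) = h x v" if "0 < s" for s x v
  proof -
    have e: "(s *\<^sub>R v \<bullet> nu x) * norm (s *\<^sub>R v) = s\<^sup>2 * ((v \<bullet> nu x) * norm v)"
      "(norm (s *\<^sub>R v))\<^sup>2 - (s *\<^sub>R v \<bullet> \<gamma> x)\<^sup>2 = s\<^sup>2 * ((norm v)\<^sup>2 - (v \<bullet> \<gamma> x)\<^sup>2)"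
      using that by (simp_all add: power2_eq_square algebra_simps)
    show ?thesis unfolding h_def e using that by simp
  qed
  have fib: "(\<integral>\<^sup>+y. ennreal (lenm (x, ang x y)) * ennreal (l12 x y) * indicator {x<..<x + P} y \<partial>lborel)
      = 3 * (\<integral>\<^sup>+v. h x v * indicator ?N v \<partial>lborel)" if x: "x \<in> {0..<P}" for x
  proof -
    have "3 * (\<integral>\<^sup>+v. h x v * indicator ?N v \<partial>lborel)
      = (\<integral>\<^sup>+y. (\<integral>\<^sup>+w. h x (\<gamma> y + (sinL x y * w - cosL x y) *\<^sub>R \<gamma> x) * ennreal (1 / sqrt (1 + w\<^sup>2) ^ 3)
         * indicator {cosL x y / sinL x y<..} w \<partial>lborel) * ennreal (ncomp y x / (sinL x y)\<^sup>2) * indicator {x<..<x + P} y \<partial>lborel)"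
      by (intro cone_integral hom hm) auto
    also have "\<dots> = (\<integral>\<^sup>+y. ennreal (lenm (x, ang x y)) * ennreal (l12 x y) * indicator {x<..<x + P} y \<partial>lborel)"
    proof (intro nn_integral_cong)
      fix y
      show "(\<integral>\<^sup>+w. h x (\<gamma> y + (sinL x y * w - cosL x y) *\<^sub>R \<gamma> x) * ennreal (1 / sqrt (1 + w\<^sup>2) ^ 3)
         * indicator {cosL x y / sinL x y<..} w \<partial>lborel) * ennreal (ncomp y x / (sinL x y)\<^sup>2) * indicator {x<..<x + P} y
        = ennreal (lenm (x, ang x y)) * ennreal (l12 x y) * indicator {x<..<x + P} y"
      proof (cases "y \<in> {x<..<x + P}")
        case True
        then have n: "\<gamma> x \<noteq> \<gamma> y" by (intro curve_neq) auto
        define N S C where "N = ncomp x y" and "S = sinL x y" and "C = cosL x y"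
        have N: "0 < N" and S: "0 < S" "S\<^sup>2 = 1 - C\<^sup>2"
          using ncomp_pos[OF n] sinL_pos[OF n] sinL_sq[OF n] by (auto simp: N_def S_def C_def)
        have N': "0 < ncomp y x" using ncomp_pos[OF n[symmetric]] .
        have hv: "h x (\<gamma> y + (S * w - C) *\<^sub>R \<gamma> x) * ennreal (1 / sqrt (1 + w\<^sup>2) ^ 3) = ennreal (N / S) * ennreal (1 / (1 + w\<^sup>2))" for w
        proof -
          define v where "v = \<gamma> y + (S * w - C) *\<^sub>R \<gamma> x"
          define q where "q = sqrt (1 + w\<^sup>2)"
          have q: "0 < q" "q\<^sup>2 = 1 + w\<^sup>2" by (auto simp: q_def add_pos_nonneg)
          have vn: "v \<bullet> nu x = N" by (simp add: v_def inner_add_left nu_facts N_def ncomp_def)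
          have C': "\<gamma> y \<bullet> \<gamma> x = C" "\<gamma> x \<bullet> \<gamma> y = C" by (simp_all add: C_def cosL_def inner_commute)
          have vg: "v \<bullet> \<gamma> x = S * w"
            by (simp add: v_def inner_add_left inner_curve_self C')
          have "v \<bullet> v = 1 + 2 * (S * w - C) * C + (S * w - C)\<^sup>2"
            by (simp add: v_def inner_add_left inner_add_right inner_curve_self C' power2_eq_square algebra_simps)
          also have "\<dots> = S\<^sup>2 * (1 + w\<^sup>2)"
            using S(2) by (simp add: power2_eq_square algebra_simps)
          finally have vv: "(norm v)\<^sup>2 = (S * q)\<^sup>2" by (simp add: power2_norm_eq_inner q(2) power_mult_distrib)
          then have nv: "norm v = S * q" using S(1) q(1) by (simp add: power2_eq_iff_nonneg)
          have "(norm v)\<^sup>2 - (v \<bullet> \<gamma> x)\<^sup>2 = S\<^sup>2"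
            unfolding vv vg power_mult_distrib q(2) by (simp add: algebra_simps)
          then have "h x v = ennreal (N * (S * q) / S\<^sup>2)" by (simp add: h_def vn nv)
          then have "h x v * ennreal (1 / q ^ 3) = ennreal (N * (S * q) / S\<^sup>2 * (1 / q ^ 3))"
            using N S(1) q(1) by (simp add: ennreal_mult[symmetric])
          also have "N * (S * q) / S\<^sup>2 * (1 / q ^ 3) = N / S * (1 / q\<^sup>2)"
            using S(1) q(1) by (simp add: power2_eq_square power3_eq_cube)
          also have "ennreal \<dots> = ennreal (N / S) * ennreal (1 / (1 + w\<^sup>2))"
            unfolding q(2) using N S by (intro ennreal_mult) (auto simp: add_nonneg_nonneg)
          finally show ?thesis by (simp add: v_def q_def)
        qed
        have "(\<integral>\<^sup>+w. h x (\<gamma> y + (S * w - C) *\<^sub>R \<gamma> x) * ennreal (1 / sqrt (1 + w\<^sup>2) ^ 3) * indicator {C / S<..} w \<partial>lborel)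
            = (\<integral>\<^sup>+w. ennreal (N / S) * (ennreal (1 / (1 + w\<^sup>2)) * indicator {C / S<..} w) \<partial>lborel)"
          unfolding hv by (simp only: mult.assoc)
        also have "\<dots> = ennreal (N / S) * (\<integral>\<^sup>+w. ennreal (1 / (1 + w\<^sup>2)) * indicator {C / S<..} w \<partial>lborel)"
          by (rule nn_integral_cmult) measurable
        also have "(\<integral>\<^sup>+w. ennreal (1 / (1 + w\<^sup>2)) * indicator {C / S<..} w \<partial>lborel) = ennreal (chord x y)"
          unfolding nn_integral_Ioi_Ici chord_def C_def[symmetric] S_def[symmetric] using S by (intro nn_integral_Ici_inverse_powers) auto
        finally have 1: "(\<integral>\<^sup>+w. h x (\<gamma> y + (S * w - C) *\<^sub>R \<gamma> x) * ennreal (1 / sqrt (1 + w\<^sup>2) ^ 3) * indicator {C / S<..} w \<partial>lborel)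
          = ennreal (N / S) * ennreal (chord x y)" .
        have "l12 x y = N / S * (ncomp y x / S\<^sup>2)"
          by (simp add: l12_def N_def S_def power2_eq_square power3_eq_cube)
        then have 2: "ennreal (l12 x y) = ennreal (N / S) * ennreal (ncomp y x / S\<^sup>2)"
          using N N' S(1) by (simp only: ennreal_mult divide_nonneg_nonneg less_imp_le zero_le_power2)
        show ?thesis using True
          unfolding C_def[symmetric] S_def[symmetric] 1 2 lenm_ang[OF x True] by (simp add: mult_ac)
      qed simp
    qed
    finally show ?thesis by simp
  qed
  have [measurable]: "Measurable.pred (borel \<Otimes>\<^sub>M borel) (\<lambda>z :: real \<times> (real^3). snd z \<in> cball 0 1)"
    unfolding mem_cball dist_norm by measurable
  have Hm: "(\<lambda>(x, v). h x v * indicator {0..<P} x * indicator ?N v) \<in> borel_measurable (lborel \<Otimes>\<^sub>M lborel)"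
    unfolding h_def by measurable
  have "(\<integral>\<^sup>+z. ennreal (lenm z) \<partial>mu)
      = (\<integral>\<^sup>+x. indicator {0..<P} x * (\<integral>\<^sup>+y. ennreal (lenm (x, ang x y)) * ennreal (l12 x y) * indicator {x<..<x + P} y \<partial>lborel) \<partial>lborel)"
    by (rule nn_integral_mu_chord_open) measurable
  also have "\<dots> = (\<integral>\<^sup>+x. indicator {0..<P} x * (3 * (\<integral>\<^sup>+v. h x v * indicator ?N v \<partial>lborel)) \<partial>lborel)"
    using fib by (intro nn_integral_cong) (auto simp: indicator_def)
  also have "\<dots> = (\<integral>\<^sup>+x. 3 * (\<integral>\<^sup>+v. h x v * indicator {0..<P} x * indicator ?N v \<partial>lborel) \<partial>lborel)"
    by (intro nn_integral_cong) (auto simp: indicator_def)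
  also have "\<dots> = 3 * (\<integral>\<^sup>+x. \<integral>\<^sup>+v. h x v * indicator {0..<P} x * indicator ?N v \<partial>lborel \<partial>lborel)"
    by (rule nn_integral_cmult[OF lborel.borel_measurable_nn_integral[OF Hm]])
  finally have eq: "(\<integral>\<^sup>+z. ennreal (lenm z) \<partial>mu)
      = 3 * (\<integral>\<^sup>+x. \<integral>\<^sup>+v. h x v * indicator {0..<P} x * indicator ?N v \<partial>lborel \<partial>lborel)" .
  have "(\<integral>\<^sup>+x. \<integral>\<^sup>+v. h x v * indicator {0..<P} x * indicator ?N v \<partial>lborel \<partial>lborel)
      = (\<integral>\<^sup>+v. \<integral>\<^sup>+x. h x v * indicator {0..<P} x * indicator ?N v \<partial>lborel \<partial>lborel)"
    by (rule lborel_pair.Fubini'[OF Hm, symmetric])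
  also have "\<dots> = (\<integral>\<^sup>+v. (\<integral>\<^sup>+x. h x v * indicator {0..<P} x \<partial>lborel) * indicator ?N v \<partial>lborel)"
    by (intro nn_integral_cong nn_integral_multc) (auto intro!: borel_measurable_times_ennreal hm)
  also have "\<dots> \<le> (\<integral>\<^sup>+v. ennreal (2 * pi) * indicator ?N v \<partial>lborel)"
    using nn_integral_visual_angle_le by (intro nn_integral_mono) (auto simp: h_def indicator_def)
  also have "\<dots> = ennreal (2 * pi) * emeasure lborel ?N"
    by (rule nn_integral_cmult_indicator) simp
  finally have "(\<integral>\<^sup>+z. ennreal (lenm z) \<partial>mu) \<le> 3 * (ennreal (2 * pi) * emeasure lborel ?N)"
    unfolding eq by (rule mult_left_mono) simp
  also have "\<dots> = ennreal (2 * pi) * (3 * emeasure lborel ?N)" by (simp only: mult_ac)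
  also have "\<dots> = ennreal (2 * pi * sph_area D)"
    unfolding sph_area_eq[symmetric] using sph_area_nonneg by (simp add: ennreal_mult)
  finally have "enn2real (\<integral>\<^sup>+z. ennreal (lenm z) \<partial>mu) \<le> 2 * pi * sph_area D"
    using sph_area_nonneg by (intro enn2real_leI) auto
  moreover have "(\<integral>z. lenm z \<partial>mu) = enn2real (\<integral>\<^sup>+z. ennreal (lenm z) \<partial>mu)"
    using chord_bounds by (intro integral_eq_nn_integral) (auto simp: lenm_def less_imp_le)
  ultimately show ?thesis by simp
qed

section \<open>The final estimate\<close>

lemma curv_min:
  obtains x0 where "Inf (k ` {0..P}) = k x0" "\<forall>x\<in>{0..P}. k x0 \<le> k x"
proof -
  obtain x0 where x0: "x0 \<in> {0..P}" "\<forall>x\<in>{0..P}. k x0 \<le> k x"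
    using continuous_attains_inf[OF compact_Icc _ continuous_curve(4), of 0 P] P_pos by auto
  then have "Inf (k ` {0..P}) = k x0" by (intro cInf_eq_minimum) auto
  then show ?thesis by (rule that) (use x0 in auto)
qed

lemma delta_bound:
  "delta_nonm \<gamma> P \<ge>
     pi / (2 * arctan (1 / Inf (geod_curv \<gamma> ` {0..P}))) *
     ((P\<^sup>2 + (sph_area (inner_region \<gamma> e))\<^sup>2 - 4 * pi * sph_area (inner_region \<gamma> e)) /
      (P * (2 * pi + sqrt (P\<^sup>2 + (2 * pi - sph_area (inner_region \<gamma> e))\<^sup>2))))"
proof -
  define A where "A = sph_area D"
  define K where "K = total_curv"
  have AK: "K = 2 * pi - A" using sph_area_gauss_bonnet by (simp add: A_def K_def)
  obtain x0 where x0: "Inf (k ` {0..P}) = k x0" "\<forall>x\<in>{0..P}. k x0 \<le> k x" by (rule curv_min)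
  define c where "c = 2 * arctan (1 / k x0)"
  have kx0: "0 < k x0" using curv_pos by simp
  then have c: "0 < c" by (simp add: c_def)
  interpret finite_measure mu by (rule finite_measure_mu)
  let ?I = "indicator Mset :: real \<times> real \<Rightarrow> real" and ?J = "indicator (\<Omega> - Mset) :: real \<times> real \<Rightarrow> real"
  have lenm_b: "\<bar>lenm z\<bar> \<le> pi" "0 \<le> lenm z" for z
    using chord_bounds[of "fst z" "Y z"] by (auto simp: lenm_def)
  have ints: "integrable mu lenm" "integrable mu (\<lambda>z. ?I z * lenm z)" "integrable mu (\<lambda>z. ?I z * mirror z)"
    "integrable mu (\<lambda>z. ?J z * mirror z)" "integrable mu mirror"
    using lenm_b mirror_bounds by (intro bounded_integrable_mu[where B=pi]; auto simp: indicator_def)+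
  have "(\<integral>z. mirror z \<partial>mu) = (\<integral>z. ?I z * mirror z + ?J z * mirror z \<partial>mu)"
  proof (rule integral_cong_AE)
    show "AE z in mu. mirror z = ?I z * mirror z + ?J z * mirror z"
      using AE_mu_Omega by eventually_elim (auto simp: indicator_def)
  qed measurable
  also have "\<dots> = (\<integral>z. ?I z * mirror z \<partial>mu) + (\<integral>z. ?J z * mirror z \<partial>mu)"
    by (rule Bochner_Integration.integral_add[OF ints(3,4)])
  finally have split: "(\<integral>z. mirror z \<partial>mu) = (\<integral>z. ?I z * mirror z \<partial>mu) + (\<integral>z. ?J z * mirror z \<partial>mu)" .
  have "(\<integral>z. ?J z * mirror z \<partial>mu) \<le> (\<integral>z. c * ?J z \<partial>mu)"
  proof (rule integral_mono[OF ints(4)])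
    show "integrable mu (\<lambda>z. c * ?J z)"
      using c by (intro bounded_integrable_mu[where B=c]) (auto simp: indicator_def)
    fix z
    show "?J z * mirror z \<le> c * ?J z"
    proof (cases "z \<in> \<Omega> - Mset")
      case True
      then have "k x0 \<le> k (fst z)" using x0(2) by (auto simp: phase_space_def)
      then have "sin (snd z) / k (fst z) \<le> 1 / k x0" using kx0 by (intro frac_le) auto
      then have "mirror z \<le> c" by (simp add: mirror_def c_def arctan_le_iff)
      then show ?thesis using True by simp
    qed simp
  qed
  also have "\<dots> = c * measure mu (\<Omega> - Mset)" by simp
  finally have J: "(\<integral>z. ?J z * mirror z \<partial>mu) \<le> c * measure mu (\<Omega> - Mset)" .
  have I: "(\<integral>z. ?I z * mirror z \<partial>mu) \<le> 2 * pi * A"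
  proof -
    have "(\<integral>z. ?I z * mirror z \<partial>mu) \<le> (\<integral>z. ?I z * lenm z \<partial>mu)" by (rule integral_lenm_ge_mirror)
    also have "\<dots> \<le> (\<integral>z. lenm z \<partial>mu)"
      using lenm_b by (intro integral_mono ints) (auto simp: indicator_def)
    also have "\<dots> \<le> 2 * pi * A" unfolding A_def by (rule integral_lenm_le)
    finally show ?thesis .
  qed
  define s where "s = sqrt (P\<^sup>2 + (2 * pi - A)\<^sup>2)"
  have s: "0 < s" "s\<^sup>2 = P\<^sup>2 + (2 * pi - A)\<^sup>2" using P_pos by (auto simp: s_def add_pos_nonneg)
  have "2 * pi * (sqrt (P\<^sup>2 + K\<^sup>2) - K) \<le> (\<integral>z. mirror z \<partial>mu)"
    by (rule integral_mirror_ge) (simp add: K_def total_curv_def)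
  then have "2 * pi * (s - (2 * pi - A)) \<le> (\<integral>z. mirror z \<partial>mu)" by (simp add: s_def AK)
  \<comment> \<open>Since the total curvature is 2 pi - A, the area terms on the two sides
    cancel.\<close>
  then have main: "2 * pi * (s - 2 * pi) \<le> c * measure mu (\<Omega> - Mset)"
    using split I J by (simp add: algebra_simps)
  have "measure mu \<Omega> = 2 * P"
  proof -
    have "measure mu \<Omega> = measure mu UNIV" using AE_mu_Omega by (intro measure_eq_AE) auto
    then show ?thesis using P_pos by (simp add: measure_def emeasure_mu)
  qed
  then have delta: "delta_nonm \<gamma> P = measure mu (\<Omega> - Mset) / (2 * P)"
    unfolding delta_nonm_def by (simp add: measure_billiard_measure sets.Diff)
  \<comment> \<open>Difference of squares: the stated fraction is (s - 2 pi) / P, extended by 2 pi +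
    s.\<close>
  have "s\<^sup>2 - (2 * pi)\<^sup>2 = P\<^sup>2 + A\<^sup>2 - 4 * pi * A"
    unfolding s(2) by (simp add: power2_eq_square algebra_simps)
  moreover have "s\<^sup>2 - (2 * pi)\<^sup>2 = (s - 2 * pi) * (2 * pi + s)" by (simp add: power2_eq_square algebra_simps)
  ultimately have num: "P\<^sup>2 + A\<^sup>2 - 4 * pi * A = (s - 2 * pi) * (2 * pi + s)" by simp
  have p: "0 < 2 * pi + s" using s(1) by (simp add: add_pos_pos)
  have "pi / c * ((P\<^sup>2 + A\<^sup>2 - 4 * pi * A) / (P * (2 * pi + s))) = (2 * pi * (s - 2 * pi)) / c / (2 * P)"
  proof -
    have "(s - 2 * pi) * (2 * pi + s) / (P * (2 * pi + s)) = (s - 2 * pi) / P" using p by simp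
    then show ?thesis unfolding num by simp
  qed
  also have "\<dots> \<le> measure mu (\<Omega> - Mset) / (2 * P)"
    using main c P_pos by (intro divide_right_mono) (auto simp: field_simps)
  finally show ?thesis unfolding delta x0(1) A_def[symmetric] s_def[symmetric] c_def[symmetric] .
qed

end

theorem theorem1p1:
  fixes \<gamma> :: "real \<Rightarrow> real^3" and P :: real and e :: "real^3"
  assumes P_pos: "0 < P"
    and on_sphere: "\<forall>x. norm (\<gamma> x) = 1"
    and periodic: "\<forall>x. \<gamma> (x + P) = \<gamma> x"
    and simple: "inj_on \<gamma> {0..<P}"
    and smooth: "smooth_curve \<gamma>"
    and arclength: "\<forall>x. norm (tang \<gamma> x) = 1"
    and hemisphere: "\<forall>x. 0 < \<gamma> x \<bullet> e"
    and strictly_convex: "sph_strictly_convex (inner_region \<gamma> e)"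
    and curv_pos: "\<forall>x. 0 < geod_curv \<gamma> x"
  shows "delta_nonm \<gamma> P \<ge>
     pi / (2 * arctan (1 / Inf (geod_curv \<gamma> ` {0..P}))) *
     ((P\<^sup>2 + (sph_area (inner_region \<gamma> e))\<^sup>2 - 4 * pi * sph_area (inner_region \<gamma> e)) /
      (P * (2 * pi + sqrt (P\<^sup>2 + (2 * pi - sph_area (inner_region \<gamma> e))\<^sup>2))))"
proof -
  interpret spherical_billiard \<gamma> P e by unfold_locales (use assms in auto)
  show ?thesis by (rule delta_bound)
qed

end
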